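(* Let $\ell>-2$ be real, let $\Omega\subseteq\overline{\mathbb R^{n+1}_+}$ be a backward time connected domain, and let $f=f(x,t)$ be a smooth function defined on $\Omega$. Suppose that the smooth function $w(x,r;b)\in C^{m,2,0}_{x,r,t}$ (the third variable being $b$) satisfies $$w_{rr}-A(x,\partial_x)w=0\quad\text{for all }(x,r)\in\Omega_\phi\text{ and for all }(x,b)\in\Omega,$$ $$w(x,0;b)=f(x,b),\qquad w_r(x,0;b)=0\quad\text{for all }(x,b)\in\Omega.$$ Then the function $$u(x,t)=c_\ell\int_0^t db\int_0^{|\phi(t)-\phi(b)|}\left((\phi(t)+\phi(b))^2-r^2\right)^{-\gamma}F\left(\gamma,\gamma;1;\frac{(\phi(t)-\phi(b))^2-r^2}{(\phi(t)+\phi(b))^2-r^2}\right)w(x,r;b)\,dr,$$ defined on $\Omega$, is continuous and satisfies $$u_{tt}-t^\ell A(x,\partial_x)u=f(x,t)$$ in the sense of distributions $\mathcal D'(\Omega)$. The function $u$ takes the vanishing initial value $u(x,0)=0$ for all $x\in\widetilde\Omega$. If, additionally, $\ell<4$, then $u_t$ is continuous in $\Omega$ and $u_t(x,0)=0$ for all $x\in\widetilde\Omega$.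
   Context: $\mathbb R^{n+1}_+=\{(x,t): x\in\mathbb R^n,\ t>0\}$. A set $\Omega\subseteq\overline{\mathbb R^{n+1}_+}$ is backward time (line-)connected (to $t=0$) if for every $(x,t)\in\Omega$ the segment $\{(x,s): s\in(0,t]\}$ is contained in $\Omega$. A domain is a connected (relatively) open set. $\widetilde\Omega=\pi_x(\Omega)\subseteq\mathbb R^n$ is the projection of $\Omega$ to the $x$-space. Values at $t=0$ are understood as values of the continuous extension to $t=0$. $\phi(t)=\frac{2}{\ell+2}t^{(\ell+2)/2}$, $\gamma=\frac{\ell}{2(\ell+2)}$, $c_\ell=\left(\frac{\ell+2}{4}\right)^{-\ell/(\ell+2)}$. $F(a,b;c;z)$ is Gauss's hypergeometric function. The $\phi$-image of $\Omega$ is $\Omega_\phi=\bigcup_{(x,t)\in\Omega}\{(x,\tau):\tau\in(0,\phi(t)]\}$. $A(x,\partial_x)=\sum_{|\alpha|\le m}a_\alpha(x)\partial_x^\alpha$ is a linear partial differential operator of order $m$ in $x$ with coefficients $a_\alpha\in C^\infty(\widetilde\Omega)$. $C^{m,2,0}_{x,r,t}$ denotes functions that are continuous together with their partial derivatives up to order $m$ in $x$, up to order $2$ in $r$, and merely continuous in the third variable (here $b$). For $w$ this is meant up to $r=0$ and $b=0$: every $(x_0,t_0)\in\Omega$ with $t_0>0$ has a neighborhood $U_{x_0}$ of $x_0$ such that $w\in C^{m,2,0}_{x,r,t}(U_{x_0}\times[0,\phi(t_0)]\times[0,t_0])$. *)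

theory Defs
  imports "HOL-Analysis.Analysis"
begin

definition dir_deriv :: "'a::real_normed_vector \<Rightarrow> ('a \<Rightarrow> 'b::real_normed_vector) \<Rightarrow> 'a \<Rightarrow> 'b" where
  "dir_deriv v g p = vector_derivative (\<lambda>s. g (p + s *\<^sub>R v)) (at 0)"

fun dir_derivs :: "'a::real_normed_vector list \<Rightarrow> ('a \<Rightarrow> 'b::real_normed_vector) \<Rightarrow> 'a \<Rightarrow> 'b" where
  "dir_derivs [] g = g"
| "dir_derivs (v # vs) g = dir_deriv v (dir_derivs vs g)"

text \<open>All iterated partial derivatives of order at most \<open>k\<close>, in every order of
  differentiation, exist on \<open>S\<close> and are continuous there. Meant for open \<open>S\<close>.\<close>

definition Ck_on :: "nat \<Rightarrow> 'a::euclidean_space set \<Rightarrow> ('a \<Rightarrow> 'b::real_normed_vector) \<Rightarrow> bool" where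
  "Ck_on k S g \<longleftrightarrow>
     (\<forall>vs. set vs \<subseteq> Basis \<longrightarrow> length vs \<le> k \<longrightarrow> continuous_on S (dir_derivs vs g)) \<and>
     (\<forall>vs. set vs \<subseteq> Basis \<longrightarrow> length vs < k \<longrightarrow>
        (\<forall>v\<in>Basis. \<forall>p\<in>S. (\<lambda>s. dir_derivs vs g (p + s *\<^sub>R v)) differentiable (at 0)))"

definition Cinf_on :: "'a::euclidean_space set \<Rightarrow> ('a \<Rightarrow> 'b::real_normed_vector) \<Rightarrow> bool" where
  "Cinf_on S g \<longleftrightarrow> (\<forall>k. Ck_on k S g)"

text \<open>Smoothness on a set that need not be open (a relatively open subset of a closed half
  space may contain boundary points): local smooth extendability.\<close>

definition smooth_on :: "'a::euclidean_space set \<Rightarrow> ('a \<Rightarrow> 'b::real_normed_vector) \<Rightarrow> bool" where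
  "smooth_on S g \<longleftrightarrow>
     (\<forall>p\<in>S. \<exists>V h. open V \<and> p \<in> V \<and> Cinf_on V h \<and> (\<forall>q\<in>V \<inter> S. h q = g q))"

text \<open>The \<open>j\<close>-th derivative of a function of one real variable relative to \<open>J\<close>; it is one-sided
  at an end point of an interval \<open>J\<close>.\<close>

fun deriv_within :: "real set \<Rightarrow> nat \<Rightarrow> (real \<Rightarrow> 'b::real_normed_vector) \<Rightarrow> real \<Rightarrow> 'b" where
  "deriv_within J 0 g = g"
| "deriv_within J (Suc j) g = (\<lambda>r. vector_derivative (deriv_within J j g) (at r within J))"

text \<open>\<open>C\<^sup>m\<close> in \<open>x\<close>, \<open>C\<^sup>2\<close> in \<open>r\<close>, \<open>C\<^sup>0\<close> in \<open>b\<close> on \<open>U \<times> [0,R] \<times> [0,T]\<close>: the \<open>x\<close>-derivatives of order at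
  most \<open>m\<close> and the \<open>r\<close>-derivatives of order at most \<open>2\<close> exist and are jointly continuous in
  \<open>(x,r,b)\<close>. No mixed \<open>x\<close>-\<open>r\<close>-derivatives are required.\<close>

definition Cm20_on ::
  "nat \<Rightarrow> (real^'n) set \<Rightarrow> real \<Rightarrow> real \<Rightarrow> (real^'n \<Rightarrow> real \<Rightarrow> real \<Rightarrow> complex) \<Rightarrow> bool" where
  "Cm20_on m U R T w \<longleftrightarrow>
     (\<forall>r\<in>{0..R}. \<forall>b\<in>{0..T}. Ck_on m U (\<lambda>x. w x r b)) \<and>
     (\<forall>vs. set vs \<subseteq> Basis \<longrightarrow> length vs \<le> m \<longrightarrow>
        continuous_on (U \<times> {0..R} \<times> {0..T}) (\<lambda>(x, r, b). dir_derivs vs (\<lambda>y. w y r b) x)) \<and>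
     (\<forall>j<2. \<forall>x\<in>U. \<forall>r\<in>{0..R}. \<forall>b\<in>{0..T}.
        deriv_within {0..R} j (\<lambda>\<rho>. w x \<rho> b) differentiable (at r within {0..R})) \<and>
     (\<forall>j\<le>2. continuous_on (U \<times> {0..R} \<times> {0..T})
        (\<lambda>(x, r, b). deriv_within {0..R} j (\<lambda>\<rho>. w x \<rho> b) r))"

text \<open>Multi-indices are functions \<open>'n \<Rightarrow> nat\<close>. The index type carries no order, so
  \<open>\<partial>\<^sup>\<alpha>\<close> differentiates along an arbitrary word in which each coordinate \<open>i\<close> occurs \<open>\<alpha> i\<close> times;
  for functions with continuous derivatives up to order \<open>|\<alpha>|\<close> the choice is immaterial (Schwarz).\<close>

definition mi_word :: "('n::finite \<Rightarrow> nat) \<Rightarrow> 'n list" where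
  "mi_word \<alpha> = (SOME is. \<forall>i. count_list is i = \<alpha> i)"

definition mi_size :: "('n::finite \<Rightarrow> nat) \<Rightarrow> nat" where
  "mi_size \<alpha> = (\<Sum>i\<in>UNIV. \<alpha> i)"

definition mi_deriv :: "('n::finite \<Rightarrow> nat) \<Rightarrow> (real^'n \<Rightarrow> complex) \<Rightarrow> real^'n \<Rightarrow> complex" where
  "mi_deriv \<alpha> g = dir_derivs (map (\<lambda>i. axis i 1) (mi_word \<alpha>)) g"

definition pdo ::
  "nat \<Rightarrow> (('n::finite \<Rightarrow> nat) \<Rightarrow> real^'n \<Rightarrow> complex) \<Rightarrow> (real^'n \<Rightarrow> complex) \<Rightarrow> real^'n \<Rightarrow> complex" where
  "pdo m a g x = (\<Sum>\<alpha> | mi_size \<alpha> \<le> m. a \<alpha> x * mi_deriv \<alpha> g x)"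

text \<open>Distributions live on the interior of \<open>\<Omega>\<close> in the whole space, so for \<open>\<Omega>\<close> in the closed half
  space the supports of test functions stay away from \<open>t = 0\<close>.\<close>

definition test_functions :: "('a::euclidean_space) set \<Rightarrow> ('a \<Rightarrow> complex) set" where
  "test_functions \<Omega> = {\<psi>. Cinf_on UNIV \<psi> \<and> compact (closure {p. \<psi> p \<noteq> 0}) \<and>
                          closure {p. \<psi> p \<noteq> 0} \<subseteq> interior \<Omega>}"

type_synonym 'a functional = "('a \<Rightarrow> complex) \<Rightarrow> complex"

definition dist_of :: "('a::euclidean_space) set \<Rightarrow> ('a \<Rightarrow> complex) \<Rightarrow> 'a functional" where
  "dist_of \<Omega> g = (\<lambda>\<psi>. LINT p:\<Omega>|lborel. g p * \<psi> p)"

definition dist_mult :: "('a \<Rightarrow> complex) \<Rightarrow> 'a functional \<Rightarrow> 'a functional" where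
  "dist_mult h T = (\<lambda>\<psi>. T (\<lambda>p. h p * \<psi> p))"

definition dist_derivs :: "('a::euclidean_space) list \<Rightarrow> 'a functional \<Rightarrow> 'a functional" where
  "dist_derivs vs T = (\<lambda>\<psi>. (-1) ^ length vs * T (dir_derivs vs \<psi>))"

definition dist_tt :: "((real^'n) \<times> real) functional \<Rightarrow> ((real^'n) \<times> real) functional" where
  "dist_tt = dist_derivs [(0, 1), (0, 1)]"

definition dist_pdo ::
  "nat \<Rightarrow> (('n::finite \<Rightarrow> nat) \<Rightarrow> real^'n \<Rightarrow> complex) \<Rightarrow>
     ((real^'n) \<times> real) functional \<Rightarrow> ((real^'n) \<times> real) functional" where
  "dist_pdo m a T = (\<lambda>\<psi>. \<Sum>\<alpha> | mi_size \<alpha> \<le> m.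
     dist_mult (\<lambda>(x, t). a \<alpha> x) (dist_derivs (map (\<lambda>i. (axis i 1, 0)) (mi_word \<alpha>)) T) \<psi>)"

definition upper_half_space :: "((real^'n) \<times> real) set" where
  "upper_half_space = {(x, t). t > 0}"

definition half_space_domain :: "((real^'n) \<times> real) set \<Rightarrow> bool" where
  "half_space_domain \<Omega> \<longleftrightarrow>
     openin (top_of_set (closure upper_half_space)) \<Omega> \<and> connected \<Omega>"

definition backward_time_connected :: "((real^'n) \<times> real) set \<Rightarrow> bool" where
  "backward_time_connected \<Omega> \<longleftrightarrow> (\<forall>(x, t)\<in>\<Omega>. \<forall>s\<in>{0<..t}. (x, s) \<in> \<Omega>)"

text \<open>\<open>\<Omega>\<close> need not contain points with \<open>t = 0\<close>; the value of \<open>g\<close> at \<open>(x,0)\<close> is that of its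
  continuous extension (and of \<open>g\<close> itself if \<open>(x,0)\<close> belongs to \<open>\<Omega>\<close>).\<close>

definition has_initial_value ::
  "((real^'n) \<times> real \<Rightarrow> complex) \<Rightarrow> ((real^'n) \<times> real) set \<Rightarrow> real^'n \<Rightarrow> complex \<Rightarrow> bool" where
  "has_initial_value g \<Omega> x c \<longleftrightarrow>
     (g \<longlongrightarrow> c) (at (x, 0) within \<Omega>) \<and> ((x, 0) \<in> \<Omega> \<longrightarrow> g (x, 0) = c)"

definition phi :: "real \<Rightarrow> real \<Rightarrow> real" where
  "phi l t = 2 / (l + 2) * t powr ((l + 2) / 2)"

definition gam :: "real \<Rightarrow> real" where
  "gam l = l / (2 * (l + 2))"

definition c_const :: "real \<Rightarrow> real" where
  "c_const l = ((l + 2) / 4) powr (- l / (l + 2))"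

definition phi_image :: "real \<Rightarrow> ((real^'n) \<times> real) set \<Rightarrow> ((real^'n) \<times> real) set" where
  "phi_image l \<Omega> = (\<Union>(x, t)\<in>\<Omega>. {(x, \<tau>) | \<tau>. \<tau> \<in> {0<..phi l t}})"

text \<open>The series; in the kernel below its argument lies in \<open>[0,1)\<close> when \<open>0 < b \<le> t\<close>.\<close>

definition gauss_F :: "real \<Rightarrow> real \<Rightarrow> real \<Rightarrow> real \<Rightarrow> real" where
  "gauss_F a b c z = eval_fps (fps_hypergeo [a, b] [c] 1) z"

definition kernel :: "real \<Rightarrow> real \<Rightarrow> real \<Rightarrow> real \<Rightarrow> real" where
  "kernel l t b r =
     ((phi l t + phi l b)\<^sup>2 - r\<^sup>2) powr (- gam l) *
     gauss_F (gam l) (gam l) 1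
       (((phi l t - phi l b)\<^sup>2 - r\<^sup>2) / ((phi l t + phi l b)\<^sup>2 - r\<^sup>2))"

definition inner_integral ::
  "real \<Rightarrow> (real^'n \<Rightarrow> real \<Rightarrow> real \<Rightarrow> complex) \<Rightarrow> real^'n \<Rightarrow> real \<Rightarrow> real \<Rightarrow> complex" where
  "inner_integral l w x t b =
     (LINT r:{0..\<bar>phi l t - phi l b\<bar>}|lborel. complex_of_real (kernel l t b r) * w x r b)"

definition transform ::
  "real \<Rightarrow> (real^'n \<Rightarrow> real \<Rightarrow> real \<Rightarrow> complex) \<Rightarrow> (real^'n) \<times> real \<Rightarrow> complex" where
  "transform l w = (\<lambda>(x, t).
     complex_of_real (c_const l) * (LINT b:{0..t}|lborel. inner_integral l w x t b))"

text \<open>Lebesgue convergence of the iterated integral; \<open>b = 0\<close> is a null set, where the argument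
  of the hypergeometric series is \<open>1\<close>.\<close>

definition transform_converges ::
  "real \<Rightarrow> (real^'n \<Rightarrow> real \<Rightarrow> real \<Rightarrow> complex) \<Rightarrow> (real^'n) \<times> real \<Rightarrow> bool" where
  "transform_converges l w = (\<lambda>(x, t).
     (\<forall>b\<in>{0<..t}. set_integrable lborel {0..\<bar>phi l t - phi l b\<bar>}
        (\<lambda>r. complex_of_real (kernel l t b r) * w x r b)) \<and>
     set_integrable lborel {0..t} (inner_integral l w x t))"

end

theory Submission
  imports Defs
begin

text \<open>Read the formula from the inside out. Fix \<open>x\<close> and \<open>b > 0\<close> and regard \<open>k = w(x, \<cdot>; b)\<close> as a
  profile in \<open>r\<close>. The inner integral
  \<open>K k (t) = c \<integral>\<^sub>0\<^bsup>\<phi>(t) - \<phi>(b)\<^esup> E(r, t; b) k(r) dr\<close>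
  averages \<open>k\<close> against a Riemann function of the Euler-Poisson-Darboux equation: in the variable
  \<open>\<tau> = \<phi>(t)\<close> the kernel satisfies \<open>E\<^sub>\<tau>\<^sub>\<tau> + (2\<gamma>/\<tau>) E\<^sub>\<tau> = E\<^sub>r\<^sub>r\<close> (\<open>epd_equation\<close>), and on the characteristic
  \<open>r = \<phi>(t) - \<phi>(b)\<close> it is a constant times a power of \<open>\<tau>\<close> (\<open>epd_boundary\<close>). If \<open>k'(0) = 0\<close>, then
  differentiation under the integral and integration by parts in \<open>r\<close> make every boundary term
  cancel and leave \<open>(K k)'' = t\<^sup>l K(k'')\<close> with \<open>K k = 0\<close> and \<open>(K k)' = k(0)\<close> at \<open>t = b\<close>. In the
  integrated form (\<open>kmean_taylor\<close>)
  \<open>K k (t) = (t - b) k(0) + \<integral>\<^sub>b\<^sup>t (t - s) s\<^sup>l K(k'')(s) ds\<close>.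

  The constant profile gives \<open>K 1 = t - b\<close>. As the kernel is nonnegative, this yields
  \<open>\<bar>K k\<bar> \<le> (t - b) sup \<bar>k\<bar>\<close> (\<open>kmean_bound\<close>), an estimate that is uniform as \<open>b \<rightarrow> 0\<close>, where the
  kernel becomes singular.

  Integrate over \<open>b\<close>, exchange the order of integration and use \<open>w\<^sub>r\<^sub>r = A w\<close>: with \<open>\<T>\<close> denoting the
  whole transform, \<open>u = \<T> w\<close> satisfies (\<open>hmean_duhamel\<close>)
  \<open>u(x, t) = \<integral>\<^sub>0\<^sup>t (t - s) (f(x, s) + s\<^sup>l (\<T> A w)(x, s)) ds\<close>.
  By the bound \<open>\<T> A w = O(s\<^sup>2)\<close>, so for \<open>l > -2\<close> the integrand is continuous up to \<open>s = 0\<close>.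
  Hence \<open>u\<close> has two continuous \<open>t\<close>-derivatives for \<open>t > 0\<close>, \<open>u\<close> and \<open>u\<^sub>t\<close> extend continuously by \<open>0\<close> to
  \<open>t = 0\<close>, and \<open>u\<^sub>t\<^sub>t = f + t\<^sup>l \<T> A w\<close>.

  For fixed \<open>t\<close> the same bound says that \<open>\<T>\<close> is a bounded linear functional of the continuous
  function \<open>w(x, \<cdot>; \<cdot>)\<close>. It therefore commutes with differentiation in \<open>x\<close> (\<open>hmean_dir_deriv\<close>) and
  with multiplication by \<open>a\<^sub>\<alpha>(x)\<close>, so \<open>\<T> A w = A u\<close>. The equation thus holds pointwise in the
  interior, and integration by parts against a test function (\<open>integration_by_parts_word\<close>) turns
  it into the distributional one. Integration by parts reverses the order of the
  derivatives; the symmetry of mixed derivatives (\<open>dir_derivs_rev\<close>) restores it.\<close>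

section \<open>The hypergeometric series\<close>

text \<open>\<open>F(g, g; 1; z)\<close> as a formal power series. Its coefficients are the squares \<open>((g)\<^sub>n / n!)\<^sup>2\<close>, which is
  where the positivity of the kernel comes from.\<close>
definition gauss_fps :: "real \<Rightarrow> real fps" where
  "gauss_fps g = fps_hypergeo [g, g] [1] 1"

lemma gauss_fps_nth: "fps_nth (gauss_fps g) n = (pochhammer g n / fact n)\<^sup>2"
  by (simp add: gauss_fps_def pochhammer_fact [symmetric] power2_eq_square)

lemma gauss_fps_nth_Suc:
  "fps_nth (gauss_fps g) (Suc n) = ((g + real n) / (real n + 1))\<^sup>2 * fps_nth (gauss_fps g) n"
proof -
  have "pochhammer g (Suc n) / fact (Suc n) = (g + real n) / (real n + 1) * (pochhammer g n / fact n)"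
    by (simp add: pochhammer_Suc field_simps)
  then show ?thesis unfolding gauss_fps_nth by (simp only: power_mult_distrib)
qed

text \<open>The ratio of consecutive coefficients tends to \<open>1\<close>. The ratio test is used in the form
  \<open>c\<^sub>n\<^sub>+\<^sub>1 r \<le> q c\<^sub>n\<close>, which also covers the terminating series of the nonpositive integers \<open>g\<close>.\<close>
lemma gauss_fps_radius: "fps_conv_radius (gauss_fps g) \<ge> 1"
  unfolding fps_conv_radius_def
proof (rule conv_radius_geI_ex')
  fix r :: real assume r: "0 < r" "ereal r < 1"
  define q where "q = (\<lambda>n. (1 + (g - 1) * inverse (real (Suc n)))\<^sup>2 * r)"
  have "q \<longlonglongrightarrow> (1 + (g - 1) * 0)\<^sup>2 * r"
    unfolding q_def by (intro tendsto_intros LIMSEQ_inverse_real_of_nat)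
  moreover have "(1 + (g - 1) * 0)\<^sup>2 * r < (1 + r) / 2" using r by simp
  ultimately have "eventually (\<lambda>n. q n < (1 + r) / 2) sequentially"
    by (rule order_tendstoD)
  then obtain N where N: "\<And>n. n \<ge> N \<Longrightarrow> q n < (1 + r) / 2"
    by (auto simp: eventually_sequentially)
  have step: "fps_nth (gauss_fps g) (Suc n) * r ^ Suc n = q n * (fps_nth (gauss_fps g) n * r ^ n)" for n
  proof -
    have "1 + (g - 1) * inverse (real (Suc n)) = (g + real n) / (real n + 1)"
      by (simp add: field_simps)
    then show ?thesis unfolding gauss_fps_nth_Suc q_def by simp
  qed
  show "summable (\<lambda>n. fps_nth (gauss_fps g) n * of_real r ^ n)"
  proof (rule summable_ratio_test)
    show "(1 + r) / 2 < 1" using r by simp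
    fix n assume "n \<ge> N"
    have "norm (fps_nth (gauss_fps g) (Suc n) * r ^ Suc n) = q n * norm (fps_nth (gauss_fps g) n * r ^ n)"
      using r by (simp only: step norm_mult) (simp add: q_def)
    also have "\<dots> \<le> (1 + r) / 2 * norm (fps_nth (gauss_fps g) n * r ^ n)"
      using N[OF \<open>n \<ge> N\<close>] by (intro mult_right_mono) auto
    finally show "norm (fps_nth (gauss_fps g) (Suc n) * of_real r ^ Suc n)
       \<le> (1 + r) / 2 * norm (fps_nth (gauss_fps g) n * of_real r ^ n)" by simp
  qed
qed

definition gaussD :: "real \<Rightarrow> nat \<Rightarrow> real \<Rightarrow> real" where
  "gaussD g k = eval_fps ((fps_deriv ^^ k) (gauss_fps g))"

lemma gaussD_radius: "fps_conv_radius ((fps_deriv ^^ k) (gauss_fps g)) \<ge> 1"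
proof (induction k)
  case 0
  then show ?case using gauss_fps_radius by simp
next
  case (Suc k)
  then show ?case using fps_conv_radius_deriv order_trans by auto
qed

lemma gaussD_deriv:
  assumes "\<bar>z\<bar> < 1"
  shows "(gaussD g k has_field_derivative gaussD g (Suc k) z) (at z)"
proof -
  have "ereal (norm z) < fps_conv_radius ((fps_deriv ^^ k) (gauss_fps g))"
    using assms by (intro less_le_trans[OF _ gaussD_radius]) simp
  from has_field_derivative_eval_fps[OF this] show ?thesis by (simp add: gaussD_def)
qed

text \<open>Gauss's equation is the coefficient recursion \<open>(n + 1)\<^sup>2 c\<^sub>n\<^sub>+\<^sub>1 = (g + n)\<^sup>2 c\<^sub>n\<close>, read first as an
  identity of formal power series and then evaluated.\<close>
lemma gauss_ode:
  assumes "\<bar>z\<bar> < 1"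
  shows "z * (1 - z) * gaussD g 2 z + (1 - (2 * g + 1) * z) * gaussD g 1 z = g\<^sup>2 * gaussD g 0 z"
proof -
  let ?H = "gauss_fps g"
  have rec: "fps_nth ?H (Suc n) * (real n + 1)\<^sup>2 = (g + real n)\<^sup>2 * fps_nth ?H n" for n
    unfolding gauss_fps_nth_Suc by (simp add: power_divide)
  have fps: "fps_X * fps_deriv (fps_deriv ?H) + fps_deriv ?H =
      fps_X * (fps_X * fps_deriv (fps_deriv ?H)) + fps_const (2 * g + 1) * (fps_X * fps_deriv ?H)
       + fps_const (g\<^sup>2) * ?H"
  proof (rule fps_ext)
    fix n
    have l: "fps_nth (fps_X * fps_deriv (fps_deriv ?H) + fps_deriv ?H) n
        = fps_nth ?H (Suc n) * (real n + 1)\<^sup>2"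
      by (cases n) (simp_all add: algebra_simps power2_eq_square)
    have r: "fps_nth (fps_X * (fps_X * fps_deriv (fps_deriv ?H))
        + fps_const (2 * g + 1) * (fps_X * fps_deriv ?H) + fps_const (g\<^sup>2) * ?H) n
        = (g + real n)\<^sup>2 * fps_nth ?H n"
    proof (cases n)
      case (Suc k)
      then show ?thesis by (cases k) (simp_all add: algebra_simps power2_eq_square)
    qed (simp add: power2_eq_square)
    show "fps_nth (fps_X * fps_deriv (fps_deriv ?H) + fps_deriv ?H) n =
      fps_nth (fps_X * (fps_X * fps_deriv (fps_deriv ?H)) + fps_const (2 * g + 1) * (fps_X * fps_deriv ?H)
       + fps_const (g\<^sup>2) * ?H) n"
      unfolding l r by (rule rec)
  qed
  have e: "gaussD g 0 z = eval_fps ?H z" "gaussD g 1 z = eval_fps (fps_deriv ?H) z"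
    "gaussD g 2 z = eval_fps (fps_deriv (fps_deriv ?H)) z"
    by (simp_all add: gaussD_def numeral_2_eq_2)
  have r: "ereal (norm z) < fps_conv_radius ?H" "ereal (norm z) < fps_conv_radius (fps_deriv ?H)"
    "ereal (norm z) < fps_conv_radius (fps_deriv (fps_deriv ?H))"
    using less_le_trans[OF _ gaussD_radius[of 0 g]] less_le_trans[OF _ gaussD_radius[of 1 g]]
      less_le_trans[OF _ gaussD_radius[of 2 g]] assms by (simp_all add: numeral_2_eq_2)
  have rm: "ereal (norm z) < fps_conv_radius (A * B)"
    if "ereal (norm z) < fps_conv_radius A" "ereal (norm z) < fps_conv_radius B" for A B :: "real fps"
    using that by (intro less_le_trans[OF _ fps_conv_radius_mult]) simp
  have ra: "ereal (norm z) < fps_conv_radius (A + B)"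
    if "ereal (norm z) < fps_conv_radius A" "ereal (norm z) < fps_conv_radius B" for A B :: "real fps"
    using that by (intro less_le_trans[OF _ fps_conv_radius_add]) simp
  have rx: "ereal (norm z) < fps_conv_radius (fps_X :: real fps)"
    "ereal (norm z) < fps_conv_radius (fps_const c)" for c :: real
    by simp_all
  have "eval_fps (fps_X * fps_deriv (fps_deriv ?H) + fps_deriv ?H) z = z * gaussD g 2 z + gaussD g 1 z"
    unfolding e by (simp only: eval_fps_add eval_fps_mult rm ra r rx eval_fps_X)
  moreover have "eval_fps (fps_X * (fps_X * fps_deriv (fps_deriv ?H))
        + fps_const (2 * g + 1) * (fps_X * fps_deriv ?H) + fps_const (g\<^sup>2) * ?H) z
      = z * (z * gaussD g 2 z) + (2 * g + 1) * (z * gaussD g 1 z) + g\<^sup>2 * gaussD g 0 z"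
    unfolding e by (simp only: eval_fps_add eval_fps_mult rm ra r rx eval_fps_X eval_fps_const)
  ultimately have "z * gaussD g 2 z + gaussD g 1 z
      = z * (z * gaussD g 2 z) + (2 * g + 1) * (z * gaussD g 1 z) + g\<^sup>2 * gaussD g 0 z"
    unfolding fps by (rule trans[OF sym])
  then show ?thesis by (simp add: algebra_simps)
qed

lemma gauss_F_eq_gaussD: "gauss_F g g 1 z = gaussD g 0 z"
  unfolding gauss_F_def gaussD_def gauss_fps_def by (simp only: funpow_0)

lemma gaussD_0_0: "gaussD g 0 0 = 1"
  unfolding gaussD_def by (simp only: funpow_0 eval_fps_at_0 gauss_fps_nth) simp

lemma gaussD_nonneg:
  assumes "0 \<le> z" "z < 1"
  shows "0 \<le> gaussD g 0 z"
proof -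
  have "ereal (norm z) < fps_conv_radius (gauss_fps g)"
    using assms by (intro less_le_trans[OF _ gauss_fps_radius]) simp
  from sums_eval_fps[OF this] have "(\<lambda>n. fps_nth (gauss_fps g) n * z ^ n) sums gaussD g 0 z"
    unfolding gaussD_def by (simp only: funpow_0)
  moreover have "0 \<le> fps_nth (gauss_fps g) n * z ^ n" for n
    using assms by (simp add: gauss_fps_nth)
  ultimately show ?thesis
    using sums_le[OF _ sums_zero] by metis
qed

section \<open>The Euler-Poisson-Darboux kernel\<close>

text \<open>The function of \<open>P\<close> and \<open>Q\<close> that is homogeneous of degree \<open>-a\<close> and equals \<open>\<Phi>(P)\<close> on \<open>Q = 1\<close>. The kernel
  and all its partial derivatives in \<open>P\<close> and \<open>Q\<close> have this form, so that one chain rule suffices.\<close>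
definition homog :: "real \<Rightarrow> (real \<Rightarrow> real) \<Rightarrow> real \<Rightarrow> real \<Rightarrow> real" where
  "homog a \<Phi> P Q = Q powr (- a) * \<Phi> (P / Q)"

lemma homog_deriv:
  assumes P: "(P has_field_derivative P') (at s)" and Q: "(Q has_field_derivative Q') (at s)"
    and pos: "Q s > 0" and Phi: "(\<Phi> has_field_derivative \<Phi>' (P s / Q s)) (at (P s / Q s))"
  shows "((\<lambda>s. homog a \<Phi> (P s) (Q s)) has_field_derivative
     homog (a + 1) \<Phi>' (P s) (Q s) * P' + homog (a + 1) (\<lambda>z. - a * \<Phi> z - z * \<Phi>' z) (P s) (Q s) * Q') (at s)"
proof -
  have pw: "Q s powr (- a) = Q s * Q s powr (- (a + 1))"
  proof -
    have "Q s powr (1 + (- (a + 1))) = Q s * Q s powr (- (a + 1))"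
      using pos unfolding powr_add by simp
    moreover have "1 + (- (a + 1)) = - a" by simp
    ultimately show ?thesis by (simp only:)
  qed
  have "((\<lambda>s. P s / Q s) has_field_derivative (P' * Q s - P s * Q') / (Q s * Q s)) (at s)"
    using P Q pos by (intro DERIV_divide) auto
  from DERIV_chain2[OF Phi this]
  have d: "((\<lambda>s. \<Phi> (P s / Q s)) has_field_derivative
      \<Phi>' (P s / Q s) * ((P' * Q s - P s * Q') / (Q s * Q s))) (at s)" .
  have "((\<lambda>x. x powr (- a)) has_field_derivative - a * Q s powr (- a - 1)) (at (Q s))"
    using has_real_derivative_powr[OF pos, of "- a"] by simp
  moreover have "- a - 1 = - (a + 1)" by simp
  ultimately have "((\<lambda>x. x powr (- a)) has_field_derivative - a * Q s powr (- (a + 1))) (at (Q s))"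
    by (simp only:)
  from DERIV_chain2[OF this Q]
  have dp: "((\<lambda>s. Q s powr (- a)) has_field_derivative (- a * Q s powr (- (a + 1))) * Q') (at s)" .
  have alg: "- a * p * Q' * F + G * ((P' * y - x * Q') / (y * y)) * (y * p)
      = p * G * P' + p * (- a * F - x / y * G) * Q'" if "y > 0" for p F G x y :: real
    using that by (simp add: field_simps)
  from DERIV_mult[OF dp d] show ?thesis
    unfolding homog_def by (rule DERIV_cong) (unfold pw, rule alg[OF pos])
qed

text \<open>The two quadratic forms of the kernel. They vanish on the characteristic cones through the
  points \<open>\<tau> = \<sigma>\<close> and \<open>\<tau> = -\<sigma>\<close> of the axis \<open>r = 0\<close>.\<close>
definition coneP :: "real \<Rightarrow> real \<Rightarrow> real \<Rightarrow> real" where "coneP \<sigma> r \<tau> = (\<tau> - \<sigma>)\<^sup>2 - r\<^sup>2"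
definition coneQ :: "real \<Rightarrow> real \<Rightarrow> real \<Rightarrow> real" where "coneQ \<sigma> r \<tau> = (\<tau> + \<sigma>)\<^sup>2 - r\<^sup>2"

text \<open>The region \<open>\<bar>r\<bar> < \<tau>\<close> is open and contains the domain of integration \<open>0 \<le> r \<le> \<tau> - \<sigma>\<close> together with its
  end points, so the kernel can be differentiated freely up to the boundary of that domain. The
  reasons are \<open>Q - P = 4\<tau>\<sigma>\<close> and \<open>P + Q = 2(\<tau>\<^sup>2 + \<sigma>\<^sup>2 - r\<^sup>2)\<close>.\<close>
lemma coneQ_pos:
  assumes "\<sigma> > 0" "\<bar>r\<bar> < \<tau>"
  shows "coneQ \<sigma> r \<tau> > 0" "\<bar>coneP \<sigma> r \<tau> / coneQ \<sigma> r \<tau>\<bar> < 1"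
proof -
  have r2: "r\<^sup>2 < \<tau>\<^sup>2" using assms by (simp add: abs_square_less_1 power2_strict_mono)
  have ts: "\<tau> * \<sigma> > 0" using assms by (intro mult_pos_pos) auto
  have s2: "\<sigma>\<^sup>2 > 0" using assms by simp
  show Q: "coneQ \<sigma> r \<tau> > 0" using r2 ts s2 unfolding coneQ_def power2_sum by linarith
  have "coneP \<sigma> r \<tau> < coneQ \<sigma> r \<tau>" "- coneQ \<sigma> r \<tau> < coneP \<sigma> r \<tau>"
    using r2 ts s2 unfolding coneP_def coneQ_def power2_sum power2_diff by linarith+
  then show "\<bar>coneP \<sigma> r \<tau> / coneQ \<sigma> r \<tau>\<bar> < 1" using Q by (simp add: abs_less_iff field_simps)
qed

text \<open>The profiles, in the sense of \<open>homog\<close>, of the derivatives of the kernel with respect to \<open>Q\<close>, to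
  \<open>P\<close> and \<open>Q\<close>, and twice to \<open>Q\<close>. The derivatives with respect to \<open>P\<close> alone have the profiles \<open>F'\<close> and \<open>F''\<close>.\<close>
definition F_Q :: "real \<Rightarrow> real \<Rightarrow> real" where
  "F_Q g z = - g * gaussD g 0 z - z * gaussD g 1 z"
definition F_PQ :: "real \<Rightarrow> real \<Rightarrow> real" where
  "F_PQ g z = - (g + 1) * gaussD g 1 z - z * gaussD g 2 z"
definition F_QQ :: "real \<Rightarrow> real \<Rightarrow> real" where
  "F_QQ g z = - (g + 1) * F_Q g z - z * F_PQ g z"

lemma F_Q_deriv:
  assumes "\<bar>z\<bar> < 1" shows "(F_Q g has_field_derivative F_PQ g z) (at z)"
proof -
  have "((\<lambda>z. - g * gaussD g 0 z - z * gaussD g 1 z) has_field_derivative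
      - g * gaussD g 1 z - (1 * gaussD g 1 z + gaussD g 2 z * z)) (at z)"
    using gaussD_deriv[OF assms, of g 0] gaussD_deriv[OF assms, of g 1]
    by (intro DERIV_diff DERIV_cmult DERIV_mult DERIV_ident) (simp_all add: numeral_2_eq_2)
  then show ?thesis
    unfolding F_Q_def[abs_def] by (rule DERIV_cong) (simp add: F_PQ_def algebra_simps)
qed

text \<open>The kernel of the solution formula in the variables \<open>\<tau> = \<phi>(t)\<close>, \<open>\<sigma> = \<phi>(b)\<close>, see \<open>kernel_eq_epd\<close>.\<close>
definition epd :: "real \<Rightarrow> real \<Rightarrow> real \<Rightarrow> real \<Rightarrow> real" where
  "epd g \<sigma> r \<tau> = homog g (gaussD g 0) (coneP \<sigma> r \<tau>) (coneQ \<sigma> r \<tau>)"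

definition epd_P :: "real \<Rightarrow> real \<Rightarrow> real \<Rightarrow> real \<Rightarrow> real" where
  "epd_P g \<sigma> r \<tau> = homog (g + 1) (gaussD g 1) (coneP \<sigma> r \<tau>) (coneQ \<sigma> r \<tau>)"
definition epd_Q :: "real \<Rightarrow> real \<Rightarrow> real \<Rightarrow> real \<Rightarrow> real" where
  "epd_Q g \<sigma> r \<tau> = homog (g + 1) (F_Q g) (coneP \<sigma> r \<tau>) (coneQ \<sigma> r \<tau>)"
definition epd_PP :: "real \<Rightarrow> real \<Rightarrow> real \<Rightarrow> real \<Rightarrow> real" where
  "epd_PP g \<sigma> r \<tau> = homog (g + 2) (gaussD g 2) (coneP \<sigma> r \<tau>) (coneQ \<sigma> r \<tau>)"
definition epd_PQ :: "real \<Rightarrow> real \<Rightarrow> real \<Rightarrow> real \<Rightarrow> real" where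
  "epd_PQ g \<sigma> r \<tau> = homog (g + 2) (F_PQ g) (coneP \<sigma> r \<tau>) (coneQ \<sigma> r \<tau>)"
definition epd_QQ :: "real \<Rightarrow> real \<Rightarrow> real \<Rightarrow> real \<Rightarrow> real" where
  "epd_QQ g \<sigma> r \<tau> = homog (g + 2) (F_QQ g) (coneP \<sigma> r \<tau>) (coneQ \<sigma> r \<tau>)"

definition epd_t :: "real \<Rightarrow> real \<Rightarrow> real \<Rightarrow> real \<Rightarrow> real" where
  "epd_t g \<sigma> r \<tau> = epd_P g \<sigma> r \<tau> * (2 * (\<tau> - \<sigma>)) + epd_Q g \<sigma> r \<tau> * (2 * (\<tau> + \<sigma>))"
definition epd_r :: "real \<Rightarrow> real \<Rightarrow> real \<Rightarrow> real \<Rightarrow> real" where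
  "epd_r g \<sigma> r \<tau> = epd_P g \<sigma> r \<tau> * (- 2 * r) + epd_Q g \<sigma> r \<tau> * (- 2 * r)"
definition epd_tt :: "real \<Rightarrow> real \<Rightarrow> real \<Rightarrow> real \<Rightarrow> real" where
  "epd_tt g \<sigma> r \<tau> =
     (epd_PP g \<sigma> r \<tau> * (2 * (\<tau> - \<sigma>)) + epd_PQ g \<sigma> r \<tau> * (2 * (\<tau> + \<sigma>))) * (2 * (\<tau> - \<sigma>))
     + 2 * epd_P g \<sigma> r \<tau>
     + (epd_PQ g \<sigma> r \<tau> * (2 * (\<tau> - \<sigma>)) + epd_QQ g \<sigma> r \<tau> * (2 * (\<tau> + \<sigma>))) * (2 * (\<tau> + \<sigma>))
     + 2 * epd_Q g \<sigma> r \<tau>"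
definition epd_rr :: "real \<Rightarrow> real \<Rightarrow> real \<Rightarrow> real \<Rightarrow> real" where
  "epd_rr g \<sigma> r \<tau> =
     (epd_PP g \<sigma> r \<tau> + 2 * epd_PQ g \<sigma> r \<tau> + epd_QQ g \<sigma> r \<tau>) * (4 * r\<^sup>2)
     - 2 * epd_P g \<sigma> r \<tau> - 2 * epd_Q g \<sigma> r \<tau>"

context
  fixes g \<sigma> r \<tau> :: real
  assumes dom: "\<sigma> > 0" "\<bar>r\<bar> < \<tau>"
begin

lemma coneP_t: "((\<lambda>\<tau>. coneP \<sigma> r \<tau>) has_field_derivative 2 * (\<tau> - \<sigma>)) (at \<tau>)"
  unfolding coneP_def by (auto intro!: derivative_eq_intros)
lemma coneQ_t: "((\<lambda>\<tau>. coneQ \<sigma> r \<tau>) has_field_derivative 2 * (\<tau> + \<sigma>)) (at \<tau>)"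
  unfolding coneQ_def by (auto intro!: derivative_eq_intros)
lemma coneP_r: "((\<lambda>r. coneP \<sigma> r \<tau>) has_field_derivative - 2 * r) (at r)"
  unfolding coneP_def by (auto intro!: derivative_eq_intros)
lemma coneQ_r: "((\<lambda>r. coneQ \<sigma> r \<tau>) has_field_derivative - 2 * r) (at r)"
  unfolding coneQ_def by (auto intro!: derivative_eq_intros)

lemmas coneQ_pos' = coneQ_pos[OF dom]

lemma epd_deriv_t: "((\<lambda>\<tau>. epd g \<sigma> r \<tau>) has_field_derivative epd_t g \<sigma> r \<tau>) (at \<tau>)"
  using homog_deriv[where \<Phi> = "gaussD g 0" and \<Phi>' = "gaussD g 1" and a = g, OF coneP_t coneQ_t coneQ_pos'(1)]
    gaussD_deriv[OF coneQ_pos'(2), of g 0]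
  unfolding epd_def epd_t_def epd_P_def epd_Q_def F_Q_def by simp

lemma epd_deriv_r: "((\<lambda>r. epd g \<sigma> r \<tau>) has_field_derivative epd_r g \<sigma> r \<tau>) (at r)"
  using homog_deriv[where \<Phi> = "gaussD g 0" and \<Phi>' = "gaussD g 1" and a = g, OF coneP_r coneQ_r coneQ_pos'(1)]
    gaussD_deriv[OF coneQ_pos'(2), of g 0]
  unfolding epd_def epd_r_def epd_P_def epd_Q_def F_Q_def by simp

lemma plus2: "g + 1 + 1 = g + 2" by simp

lemma epd_P_deriv_t: "((\<lambda>\<tau>. epd_P g \<sigma> r \<tau>) has_field_derivative
    epd_PP g \<sigma> r \<tau> * (2 * (\<tau> - \<sigma>)) + epd_PQ g \<sigma> r \<tau> * (2 * (\<tau> + \<sigma>))) (at \<tau>)"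
  using homog_deriv[where \<Phi> = "gaussD g 1" and \<Phi>' = "gaussD g 2" and a = "g + 1", OF coneP_t coneQ_t coneQ_pos'(1)]
    gaussD_deriv[OF coneQ_pos'(2), of g 1]
  unfolding epd_P_def epd_PP_def epd_PQ_def F_PQ_def plus2 by (simp add: numeral_2_eq_2)

lemma epd_Q_deriv_t: "((\<lambda>\<tau>. epd_Q g \<sigma> r \<tau>) has_field_derivative
    epd_PQ g \<sigma> r \<tau> * (2 * (\<tau> - \<sigma>)) + epd_QQ g \<sigma> r \<tau> * (2 * (\<tau> + \<sigma>))) (at \<tau>)"
  using homog_deriv[where \<Phi> = "F_Q g" and \<Phi>' = "F_PQ g" and a = "g + 1", OF coneP_t coneQ_t coneQ_pos'(1)]
    F_Q_deriv[OF coneQ_pos'(2), of g]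
  unfolding epd_Q_def epd_PQ_def epd_QQ_def F_QQ_def plus2 by simp

lemma epd_P_deriv_r: "((\<lambda>r. epd_P g \<sigma> r \<tau>) has_field_derivative
    epd_PP g \<sigma> r \<tau> * (- 2 * r) + epd_PQ g \<sigma> r \<tau> * (- 2 * r)) (at r)"
  using homog_deriv[where \<Phi> = "gaussD g 1" and \<Phi>' = "gaussD g 2" and a = "g + 1", OF coneP_r coneQ_r coneQ_pos'(1)]
    gaussD_deriv[OF coneQ_pos'(2), of g 1]
  unfolding epd_P_def epd_PP_def epd_PQ_def F_PQ_def plus2 by (simp add: numeral_2_eq_2)

lemma epd_Q_deriv_r: "((\<lambda>r. epd_Q g \<sigma> r \<tau>) has_field_derivative
    epd_PQ g \<sigma> r \<tau> * (- 2 * r) + epd_QQ g \<sigma> r \<tau> * (- 2 * r)) (at r)"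
  using homog_deriv[where \<Phi> = "F_Q g" and \<Phi>' = "F_PQ g" and a = "g + 1", OF coneP_r coneQ_r coneQ_pos'(1)]
    F_Q_deriv[OF coneQ_pos'(2), of g]
  unfolding epd_Q_def epd_PQ_def epd_QQ_def F_QQ_def plus2 by simp

lemma epd_deriv_tt: "((\<lambda>\<tau>. epd_t g \<sigma> r \<tau>) has_field_derivative epd_tt g \<sigma> r \<tau>) (at \<tau>)"
proof -
  have "((\<lambda>\<tau>. 2 * (\<tau> - \<sigma>)) has_field_derivative 2) (at \<tau>)" "((\<lambda>\<tau>. 2 * (\<tau> + \<sigma>)) has_field_derivative 2) (at \<tau>)"
    by (auto intro!: derivative_eq_intros)
  from DERIV_add[OF DERIV_mult[OF epd_P_deriv_t this(1)] DERIV_mult[OF epd_Q_deriv_t this(2)]]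
  show ?thesis unfolding epd_t_def epd_tt_def by (rule DERIV_cong) simp
qed

lemma epd_deriv_rr: "((\<lambda>r. epd_r g \<sigma> r \<tau>) has_field_derivative epd_rr g \<sigma> r \<tau>) (at r)"
proof -
  have "((\<lambda>r. - 2 * r) has_field_derivative - 2) (at r)"
    by (auto intro!: derivative_eq_intros)
  from DERIV_add[OF DERIV_mult[OF epd_P_deriv_r this] DERIV_mult[OF epd_Q_deriv_r this]]
  show ?thesis unfolding epd_r_def epd_rr_def
    by (rule DERIV_cong) (simp add: algebra_simps power2_eq_square)
qed

text \<open>Expressed in \<open>P\<close> and \<open>Q\<close>, the Euler-Poisson-Darboux operator applied to a function \<open>G(P, Q)\<close> that
  is homogeneous of degree \<open>-g\<close> reduces, after Euler's relations for \<open>G\<^sub>P\<close> and \<open>G\<^sub>Q\<close>, to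
  \<open>-4(\<sigma>/\<tau>) ((Q - P) G\<^sub>P\<^sub>Q + g (G\<^sub>P - G\<^sub>Q))\<close>; and this expression vanishes by Gauss's equation.\<close>
lemma epd_equation: "epd_tt g \<sigma> r \<tau> + 2 * g / \<tau> * epd_t g \<sigma> r \<tau> = epd_rr g \<sigma> r \<tau>"
proof -
  define P Q z where "P = coneP \<sigma> r \<tau>" and "Q = coneQ \<sigma> r \<tau>" and "z = P / Q"
  have Q: "Q > 0" and z: "\<bar>z\<bar> < 1" using coneQ_pos' by (simp_all add: P_def Q_def z_def)
  have P: "P = z * Q" using Q by (simp add: z_def)
  define q where "q = Q powr (- (g + 2))"
  have q1: "Q powr (- (g + 1)) = Q * q"
  proof -
    have "Q powr (1 + (- (g + 2))) = Q * q"
      using Q unfolding q_def powr_add by simp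
    moreover have "1 + (- (g + 2)) = - (g + 1)" by simp
    ultimately show ?thesis by (simp only:)
  qed
  have tau: "\<tau> > 0" using dom by simp
  define a b aa ab bb where "a = epd_P g \<sigma> r \<tau>" and "b = epd_Q g \<sigma> r \<tau>" and "aa = epd_PP g \<sigma> r \<tau>"
    and "ab = epd_PQ g \<sigma> r \<tau>" and "bb = epd_QQ g \<sigma> r \<tau>"
  have a: "a = Q * q * gaussD g 1 z" and b: "b = Q * q * F_Q g z" and aa: "aa = q * gaussD g 2 z"
    and ab: "ab = q * F_PQ g z" and bb: "bb = q * F_QQ g z"
    unfolding a_def b_def aa_def ab_def bb_def epd_P_def epd_Q_def epd_PP_def epd_PQ_def epd_QQ_def homog_def
      P_def[symmetric] Q_def[symmetric] z_def[symmetric] q_def[symmetric] q1 by simp_all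
  \<comment> \<open>Euler's relations for \<open>G\<^sub>P\<close> and \<open>G\<^sub>Q\<close>, both homogeneous of degree \<open>-(g + 1)\<close>\<close>
  have e1: "P * aa + Q * ab + (g + 1) * a = 0"
    unfolding a aa ab P F_PQ_def by (simp add: algebra_simps)
  have e2: "P * ab + Q * bb + (g + 1) * b = 0"
    unfolding b ab bb P F_QQ_def by (simp add: algebra_simps)
  have "(Q - P) * ab + g * (a - b) = - Q * q * (z * (1 - z) * gaussD g 2 z
      + (1 - (2 * g + 1) * z) * gaussD g 1 z - g\<^sup>2 * gaussD g 0 z)"
    unfolding a b ab P F_PQ_def F_Q_def by (simp add: algebra_simps power2_eq_square)
  then have e3: "(Q - P) * ab + g * (a - b) = 0"
    using gauss_ode[OF z, of g] by simp
  have "\<tau> * (epd_tt g \<sigma> r \<tau> - epd_rr g \<sigma> r \<tau>) + 2 * g * epd_t g \<sigma> r \<tau> =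
    4 * \<tau> * (P * aa + Q * ab + (g + 1) * a) + 4 * \<tau> * (P * ab + Q * bb + (g + 1) * b)
      - 4 * \<sigma> * ((Q - P) * ab + g * (a - b))"
    unfolding epd_tt_def epd_rr_def epd_t_def a_def[symmetric] b_def[symmetric] aa_def[symmetric]
      ab_def[symmetric] bb_def[symmetric] P_def Q_def coneP_def coneQ_def
    by (simp add: algebra_simps power2_eq_square)
  then have "\<tau> * (epd_tt g \<sigma> r \<tau> - epd_rr g \<sigma> r \<tau>) + 2 * g * epd_t g \<sigma> r \<tau> = 0"
    unfolding e1 e2 e3 by simp
  then show ?thesis using tau by (simp add: field_simps)
qed

end

text \<open>On the characteristic \<open>r = \<tau> - \<sigma>\<close> one has \<open>P = 0\<close>, so only the constant terms of the series survive.
  The second equation is the derivative of the first along the characteristic.\<close>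
lemma epd_boundary:
  assumes "0 < \<sigma>" "\<sigma> \<le> \<tau>"
  shows "epd g \<sigma> (\<tau> - \<sigma>) \<tau> = (4 * \<tau> * \<sigma>) powr (- g)"
    and "epd_t g \<sigma> (\<tau> - \<sigma>) \<tau> + epd_r g \<sigma> (\<tau> - \<sigma>) \<tau> = - g / \<tau> * (4 * \<tau> * \<sigma>) powr (- g)"
proof -
  have P: "coneP \<sigma> (\<tau> - \<sigma>) \<tau> = 0" and Q: "coneQ \<sigma> (\<tau> - \<sigma>) \<tau> = 4 * \<tau> * \<sigma>"
    by (simp_all add: coneP_def coneQ_def power2_eq_square algebra_simps)
  show "epd g \<sigma> (\<tau> - \<sigma>) \<tau> = (4 * \<tau> * \<sigma>) powr (- g)"
    unfolding epd_def homog_def P Q by (simp add: gaussD_0_0)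
  have pos: "4 * \<tau> * \<sigma> > 0" using assms by simp
  have pw: "(4 * \<tau> * \<sigma>) powr (- g) = (4 * \<tau> * \<sigma>) * (4 * \<tau> * \<sigma>) powr (- (g + 1))"
  proof -
    have "(4 * \<tau> * \<sigma>) powr (1 + (- (g + 1))) = (4 * \<tau> * \<sigma>) * (4 * \<tau> * \<sigma>) powr (- (g + 1))"
      using pos unfolding powr_add by simp
    moreover have "1 + (- (g + 1)) = - g" by simp
    ultimately show ?thesis by (simp only:)
  qed
  have "epd_t g \<sigma> (\<tau> - \<sigma>) \<tau> + epd_r g \<sigma> (\<tau> - \<sigma>) \<tau> = 4 * \<sigma> * epd_Q g \<sigma> (\<tau> - \<sigma>) \<tau>"
    unfolding epd_t_def epd_r_def by (simp add: algebra_simps)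
  also have "\<dots> = 4 * \<sigma> * (- g * (4 * \<tau> * \<sigma>) powr (- (g + 1)))"
    unfolding epd_Q_def homog_def P Q F_Q_def by (simp add: gaussD_0_0)
  also have "\<dots> = - g / \<tau> * (4 * \<tau> * \<sigma>) powr (- g)"
    unfolding pw using assms by simp
  finally show "epd_t g \<sigma> (\<tau> - \<sigma>) \<tau> + epd_r g \<sigma> (\<tau> - \<sigma>) \<tau> = - g / \<tau> * (4 * \<tau> * \<sigma>) powr (- g)" .
qed

lemma continuous_on_homog:
  assumes Phi: "\<And>z. \<bar>z\<bar> < 1 \<Longrightarrow> isCont \<Phi> z"
    and s: "continuous_on A s" and r: "continuous_on A r" and t: "continuous_on A t"
    and dom: "\<And>x. x \<in> A \<Longrightarrow> s x > 0 \<and> \<bar>r x\<bar> < t x"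
  shows "continuous_on A (\<lambda>x. homog a \<Phi> (coneP (s x) (r x) (t x)) (coneQ (s x) (r x) (t x)))"
proof -
  have Q: "continuous_on A (\<lambda>x. coneQ (s x) (r x) (t x))" and P: "continuous_on A (\<lambda>x. coneP (s x) (r x) (t x))"
    unfolding coneP_def coneQ_def by (intro continuous_intros s r t)+
  have ne: "coneQ (s x) (r x) (t x) \<noteq> 0" if "x \<in> A" for x
    using coneQ_pos(1)[of "s x" "r x" "t x"] dom[OF that] by auto
  have c: "continuous_on {-1<..<1} \<Phi>"
    using Phi by (auto intro!: continuous_at_imp_continuous_on)
  have im: "(\<lambda>x. coneP (s x) (r x) (t x) / coneQ (s x) (r x) (t x)) ` A \<subseteq> {-1<..<1}"
  proof (rule image_subsetI)
    fix x assume "x \<in> A"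
    with dom have "s x > 0" "\<bar>r x\<bar> < t x" by auto
    from coneQ_pos(2)[OF this] show "coneP (s x) (r x) (t x) / coneQ (s x) (r x) (t x) \<in> {-1<..<1}"
      unfolding greaterThanLessThan_iff by linarith
  qed
  have "continuous_on A (\<lambda>x. \<Phi> (coneP (s x) (r x) (t x) / coneQ (s x) (r x) (t x)))"
    by (rule continuous_on_compose2[OF c continuous_on_divide[OF P Q] im]) (use ne in blast)
  moreover have "continuous_on A (\<lambda>x. coneQ (s x) (r x) (t x) powr (- a))"
    by (rule continuous_on_powr[OF Q continuous_on_const]) (use ne in blast)
  ultimately show ?thesis
    unfolding homog_def by (intro continuous_on_mult)
qed

lemma isCont_gaussD: "\<bar>z\<bar> < 1 \<Longrightarrow> isCont (gaussD g k) z"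
  using DERIV_isCont gaussD_deriv by blast

lemma continuous_on_epd:
  assumes s: "continuous_on A s" and r: "continuous_on A r" and t: "continuous_on A t"
    and dom: "\<And>x. x \<in> A \<Longrightarrow> s x > 0 \<and> \<bar>r x\<bar> < t x"
  shows "continuous_on A (\<lambda>x. epd g (s x) (r x) (t x))"
    and "continuous_on A (\<lambda>x. epd_t g (s x) (r x) (t x))"
    and "continuous_on A (\<lambda>x. epd_tt g (s x) (r x) (t x))"
    and "continuous_on A (\<lambda>x. epd_r g (s x) (r x) (t x))"
    and "continuous_on A (\<lambda>x. epd_rr g (s x) (r x) (t x))"
proof -
  note h = continuous_on_homog[OF _ s r t dom]
  have cQ: "isCont (F_Q g) z" and cPQ: "isCont (F_PQ g) z" if "\<bar>z\<bar> < 1" for z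
    unfolding F_Q_def[abs_def] F_PQ_def[abs_def] using that by (intro continuous_intros isCont_gaussD; simp)+
  have cQQ: "isCont (F_QQ g) z" if "\<bar>z\<bar> < 1" for z
    unfolding F_QQ_def[abs_def] using that by (intro continuous_intros cQ cPQ)
  show "continuous_on A (\<lambda>x. epd g (s x) (r x) (t x))"
    unfolding epd_def by (rule h[OF isCont_gaussD])
  have P: "continuous_on A (\<lambda>x. epd_P g (s x) (r x) (t x))"
    unfolding epd_P_def by (rule h[OF isCont_gaussD])
  have Q: "continuous_on A (\<lambda>x. epd_Q g (s x) (r x) (t x))"
    unfolding epd_Q_def by (rule h[OF cQ])
  have coneP: "continuous_on A (\<lambda>x. epd_PP g (s x) (r x) (t x))"
    unfolding epd_PP_def by (rule h[OF isCont_gaussD])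
  have PQ: "continuous_on A (\<lambda>x. epd_PQ g (s x) (r x) (t x))"
    unfolding epd_PQ_def by (rule h[OF cPQ])
  have coneQ: "continuous_on A (\<lambda>x. epd_QQ g (s x) (r x) (t x))"
    unfolding epd_QQ_def by (rule h[OF cQQ])
  show "continuous_on A (\<lambda>x. epd_t g (s x) (r x) (t x))"
    "continuous_on A (\<lambda>x. epd_tt g (s x) (r x) (t x))"
    "continuous_on A (\<lambda>x. epd_r g (s x) (r x) (t x))"
    "continuous_on A (\<lambda>x. epd_rr g (s x) (r x) (t x))"
    unfolding epd_t_def epd_tt_def epd_r_def epd_rr_def
    by (intro continuous_intros s r t P Q coneP PQ coneQ)+
qed

section \<open>Integrals with a moving end point\<close>

lemma integral_unit_scale:
  fixes f :: "real \<Rightarrow> 'b::banach"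
  assumes "0 \<le> R"
  shows "integral {0..R} f = R *\<^sub>R integral {0..1} (\<lambda>\<rho>. f (R * \<rho>))"
proof (cases "R = 0")
  case False
  with assms have "R > 0" by simp
  then show ?thesis using integral_stretch_real[of R 0 R f] by simp
qed simp

text \<open>Rescaling to the unit interval replaces the moving end point by a parameter of the integrand.\<close>
lemma continuous_on_moving_integral:
  fixes h :: "'a::topological_space \<Rightarrow> real \<Rightarrow> 'b::banach"
  assumes R: "continuous_on X R" "\<And>p. p \<in> X \<Longrightarrow> 0 \<le> R p"
    and h: "continuous_on (SIGMA p:X. {0..R p}) (\<lambda>(p, r). h p r)"
  shows "continuous_on X (\<lambda>p. integral {0..R p} (h p))"
proof -
  have "continuous_on (X \<times> cbox 0 1) (\<lambda>x. R (fst x))"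
    by (rule continuous_on_compose2[OF R(1)]) (auto intro!: continuous_intros)
  then have m: "continuous_on (X \<times> cbox 0 1) (\<lambda>x. (fst x, R (fst x) * snd x))"
    by (intro continuous_intros)
  have im: "(\<lambda>x. (fst x, R (fst x) * snd x)) ` (X \<times> cbox 0 1) \<subseteq> (SIGMA p:X. {0..R p})"
    using R(2) by (auto simp: mult_left_le)
  have "continuous_on (X \<times> cbox 0 1) (\<lambda>(p, \<rho>). h p (R p * \<rho>))"
    using continuous_on_compose2[OF h m im] by (simp add: case_prod_unfold)
  from integral_continuous_on_param[OF this]
  have "continuous_on X (\<lambda>p. R p *\<^sub>R integral {0..1} (\<lambda>\<rho>. h p (R p * \<rho>)))"
    using R(1) by (intro continuous_intros) simp_all
  then show ?thesis
    by (rule continuous_on_eq) (simp add: integral_unit_scale[OF R(2), of _ "h _"])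
qed

text \<open>The integral is a function of two variables, the parameter and the upper end point, with
  continuous partial derivative in the latter. It is therefore totally differentiable, and the
  claim is the chain rule along the curve \<open>t \<mapsto> (t, R t)\<close>.\<close>
lemma leibniz_moving_endpoint:
  fixes h h' :: "real \<Rightarrow> real \<Rightarrow> 'b::banach"
  assumes d: "0 < d" and h: "continuous_on ({t0-d<..<t0+d} \<times> {0..Y}) (\<lambda>(t, r). h t r)"
    and h': "continuous_on ({t0-d<..<t0+d} \<times> {0..Y}) (\<lambda>(t, r). h' t r)"
    and deriv: "\<And>t r. t \<in> {t0-d<..<t0+d} \<Longrightarrow> r \<in> {0..Y} \<Longrightarrow>
        ((\<lambda>t. h t r) has_vector_derivative h' t r) (at t)"
    and R: "(R has_vector_derivative R') (at t0)" "0 < R t0" "R t0 < Y"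
  shows "((\<lambda>t. integral {0..R t} (h t)) has_vector_derivative
      R' *\<^sub>R h t0 (R t0) + integral {0..R t0} (h' t0)) (at t0)"
proof -
  define X where "X = {t0-d<..<t0+d}"
  define Z where "Z = {0<..<Y}"
  have t0: "t0 \<in> X" and opX: "open X" and opZ: "open Z" and z0: "R t0 \<in> Z" using d R by (auto simp: X_def Z_def)
  have hr: "continuous_on {0..Y} (h t)" if "t \<in> X" for t
  proof -
    have "continuous_on {0..Y} (\<lambda>r. (\<lambda>(t, r). h t r) (t, r))"
    proof (rule continuous_on_compose2[OF h])
      show "continuous_on {0..Y} (\<lambda>r. (t, r))" by (intro continuous_intros)
      show "(\<lambda>r. (t, r)) ` {0..Y} \<subseteq> {t0 - d<..<t0 + d} \<times> {0..Y}"
        using that by (auto simp: X_def)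
    qed
    then show ?thesis by simp
  qed
  have fx: "((\<lambda>t. integral {0..R t0} (h t)) has_derivative (\<lambda>s. s *\<^sub>R integral {0..R t0} (h' t0))) (at t0 within X)"
  proof -
    have "((\<lambda>t. integral (cbox 0 (R t0)) (h t)) has_vector_derivative integral (cbox 0 (R t0)) (h' t0)) (at t0 within X)"
    proof (rule leibniz_rule_vector_derivative)
      show "\<And>t r. t \<in> X \<Longrightarrow> r \<in> cbox 0 (R t0) \<Longrightarrow> ((\<lambda>t. h t r) has_vector_derivative h' t r) (at t within X)"
        by (rule has_vector_derivative_at_within[OF deriv]) (use R in \<open>auto simp: X_def\<close>)
      show "\<And>t. t \<in> X \<Longrightarrow> h t integrable_on cbox 0 (R t0)"
        using R by (auto intro!: integrable_continuous_real continuous_on_subset[OF hr])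
      show "continuous_on (X \<times> cbox 0 (R t0)) (\<lambda>(t, r). h' t r)"
        using R by (intro continuous_on_subset[OF h']) (auto simp: X_def)
    qed (use t0 in \<open>auto simp: X_def\<close>)
    then show ?thesis by (simp add: has_vector_derivative_def)
  qed
  have fy: "((\<lambda>y. integral {0..y} (h t)) has_derivative blinfun_apply (blinfun_scaleR_left (h t y))) (at y within Z)"
    if "t \<in> X" "y \<in> Z" for t y
  proof -
    have "((\<lambda>y. integral {0..y} (h t)) has_vector_derivative h t y) (at y within {0..Y})"
      using that hr by (intro integral_has_vector_derivative) (auto simp: Z_def)
    then have "((\<lambda>y. integral {0..y} (h t)) has_vector_derivative h t y) (at y within Z)"
      by (rule has_vector_derivative_within_subset) (auto simp: Z_def)
    then show ?thesis by (simp add: has_vector_derivative_def)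
  qed
  have "continuous_on (X \<times> Z) (\<lambda>(t, y). blinfun_scaleR_left (h t y))"
  proof -
    have "continuous_on (X \<times> Z) (\<lambda>(t, y). h t y)"
      by (rule continuous_on_subset[OF h]) (auto simp: X_def Z_def)
    from bounded_linear.continuous_on[OF bounded_linear_blinfun_scaleR_left this]
    show ?thesis by (simp add: case_prod_unfold)
  qed
  then have c: "continuous (at (t0, R t0) within X \<times> Z) (\<lambda>(t, y). blinfun_scaleR_left (h t y))"
    using t0 z0 by (auto simp: continuous_on_eq_continuous_within)
  from has_derivative_partialsI[where f = "\<lambda>t y. integral {0..y} (h t)", OF fx fy c z0]
  have "((\<lambda>(t, y). integral {0..y} (h t)) has_derivative
     (\<lambda>(tx, ty). tx *\<^sub>R integral {0..R t0} (h' t0) + ty *\<^sub>R h t0 (R t0))) (at (t0, R t0) within X \<times> Z)"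
    by (simp add: Z_def)
  then have "((\<lambda>(t, y). integral {0..y} (h t)) has_derivative
     (\<lambda>(tx, ty). tx *\<^sub>R integral {0..R t0} (h' t0) + ty *\<^sub>R h t0 (R t0))) (at (t0, R t0))"
    using t0 z0 opX opZ by (subst (asm) at_within_open) (auto intro: open_Times)
  moreover have "((\<lambda>t. (t, R t)) has_derivative (\<lambda>s. (s, s *\<^sub>R R'))) (at t0)"
    using R(1) unfolding has_vector_derivative_def by (intro has_derivative_Pair has_derivative_ident)
  ultimately have "((\<lambda>t. (\<lambda>(t, y). integral {0..y} (h t)) (t, R t)) has_derivative
     (\<lambda>s. (\<lambda>(tx, ty). tx *\<^sub>R integral {0..R t0} (h' t0) + ty *\<^sub>R h t0 (R t0)) (s, s *\<^sub>R R'))) (at t0)"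
    by (rule has_derivative_compose[rotated])
  then show ?thesis
    by (simp add: has_vector_derivative_def algebra_simps)
qed

section \<open>Kernel averages solve the Euler-Poisson-Darboux equation\<close>

lemma epd_cont:
  assumes "\<sigma> > 0"
  shows "continuous_on {p. \<bar>fst p\<bar> < snd p} (\<lambda>p. epd g \<sigma> (fst p) (snd p))"
    "continuous_on {p. \<bar>fst p\<bar> < snd p} (\<lambda>p. epd_t g \<sigma> (fst p) (snd p))"
    "continuous_on {p. \<bar>fst p\<bar> < snd p} (\<lambda>p. epd_tt g \<sigma> (fst p) (snd p))"
    "continuous_on {p. \<bar>fst p\<bar> < snd p} (\<lambda>p. epd_r g \<sigma> (fst p) (snd p))"
    "continuous_on {p. \<bar>fst p\<bar> < snd p} (\<lambda>p. epd_rr g \<sigma> (fst p) (snd p))"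
  by (rule continuous_on_epd, use assms in \<open>auto intro!: continuous_intros\<close>)+

text \<open>A profile is \<open>C\<^sup>2\<close> up to the end points of \<open>[0, S]\<close> with vanishing slope at \<open>0\<close>. The derivatives are
  required in the open interval only, the continuity on the closed one.\<close>
locale C2_profile =
  fixes k k1 k2 :: "real \<Rightarrow> complex" and S :: real
  assumes k: "continuous_on {0..S} k" and k1: "continuous_on {0..S} k1" and k2: "continuous_on {0..S} k2"
    and deriv1: "\<And>r. 0 < r \<Longrightarrow> r < S \<Longrightarrow> (k has_vector_derivative k1 r) (at r)"
    and deriv2: "\<And>r. 0 < r \<Longrightarrow> r < S \<Longrightarrow> (k1 has_vector_derivative k2 r) (at r)"
    and k1_0: "k1 0 = 0"
begin

text \<open>\<open>epd_mean_t\<close> is the \<open>\<tau>\<close>-derivative of \<open>epd_mean\<close>. The value of the kernel at the moving end point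
  is written as the power from \<open>epd_boundary\<close>, in which form it is differentiated once more.\<close>
definition epd_mean :: "real \<Rightarrow> real \<Rightarrow> real \<Rightarrow> complex" where
  "epd_mean \<sigma> g \<tau> = integral {0..\<tau> - \<sigma>} (\<lambda>r. epd g \<sigma> r \<tau> *\<^sub>R k r)"
definition epd_mean_t :: "real \<Rightarrow> real \<Rightarrow> real \<Rightarrow> complex" where
  "epd_mean_t \<sigma> g \<tau> = (4 * \<tau> * \<sigma>) powr (- g) *\<^sub>R k (\<tau> - \<sigma>)
     + integral {0..\<tau> - \<sigma>} (\<lambda>r. epd_t g \<sigma> r \<tau> *\<^sub>R k r)"

context
  fixes \<sigma> g :: real assumes \<sigma>: "\<sigma> > 0"
begin

lemma kernel_times_profile_continuous:
  fixes K :: "real \<Rightarrow> real \<Rightarrow> real"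
  assumes "continuous_on {0..S} f" "\<tau>0 \<le> S" "continuous_on {p. \<bar>fst p\<bar> < snd p} (\<lambda>p. K (fst p) (snd p))"
  shows "continuous_on ({\<tau>0 - \<sigma> / 2<..<\<tau>0 + \<sigma> / 2} \<times> {0..\<tau>0 - \<sigma> / 2}) (\<lambda>(t, r). K r t *\<^sub>R (f r :: complex))"
proof -
  have "continuous_on ({\<tau>0 - \<sigma> / 2<..<\<tau>0 + \<sigma> / 2} \<times> {0..\<tau>0 - \<sigma> / 2}) (\<lambda>x. K (snd x) (fst x))"
    by (rule continuous_on_compose2[OF assms(3), where f = "\<lambda>x. (snd x, fst x)", simplified fst_conv snd_conv])
      (use \<sigma> in \<open>auto intro!: continuous_intros\<close>)
  moreover have "continuous_on ({\<tau>0 - \<sigma> / 2<..<\<tau>0 + \<sigma> / 2} \<times> {0..\<tau>0 - \<sigma> / 2}) (\<lambda>x. f (snd x))"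
    by (rule continuous_on_compose2[OF assms(1)]) (use \<sigma> assms(2) in \<open>auto intro!: continuous_intros\<close>)
  ultimately show ?thesis unfolding case_prod_unfold by (intro continuous_intros)
qed

text \<open>The margin \<open>\<sigma>/2\<close> is chosen so that \<open>r < \<tau>\<close> for all \<open>r \<le> \<tau>0 - \<sigma>/2\<close> and all \<open>\<tau>\<close> within \<open>\<sigma>/2\<close> of \<open>\<tau>0\<close>. The
  kernel is thus regular on a full rectangle around the moving end point.\<close>
lemma profile_leibniz:
  fixes K K' :: "real \<Rightarrow> real \<Rightarrow> real"
  assumes f: "continuous_on {0..S} f" and t0: "\<sigma> < \<tau>0" "\<tau>0 \<le> S"
    and K: "continuous_on {p. \<bar>fst p\<bar> < snd p} (\<lambda>p. K (fst p) (snd p))"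
    and K': "continuous_on {p. \<bar>fst p\<bar> < snd p} (\<lambda>p. K' (fst p) (snd p))"
    and d: "\<And>\<tau> r. \<bar>r\<bar> < \<tau> \<Longrightarrow> ((\<lambda>\<tau>. K r \<tau>) has_field_derivative K' r \<tau>) (at \<tau>)"
  shows "((\<lambda>\<tau>. integral {0..\<tau> - \<sigma>} (\<lambda>r. K r \<tau> *\<^sub>R (f r :: complex))) has_vector_derivative
     K (\<tau>0 - \<sigma>) \<tau>0 *\<^sub>R f (\<tau>0 - \<sigma>) + integral {0..\<tau>0 - \<sigma>} (\<lambda>r. K' r \<tau>0 *\<^sub>R f r)) (at \<tau>0)"
proof -
  have "((\<lambda>\<tau>. integral {0..\<tau> - \<sigma>} (\<lambda>r. K r \<tau> *\<^sub>R f r)) has_vector_derivative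
     1 *\<^sub>R K (\<tau>0 - \<sigma>) \<tau>0 *\<^sub>R f (\<tau>0 - \<sigma>) + integral {0..\<tau>0 - \<sigma>} (\<lambda>r. K' r \<tau>0 *\<^sub>R f r)) (at \<tau>0)"
  proof (rule leibniz_moving_endpoint[where d = "\<sigma> / 2" and Y = "\<tau>0 - \<sigma> / 2"])
    fix t r assume tr: "t \<in> {\<tau>0 - \<sigma> / 2<..<\<tau>0 + \<sigma> / 2}" "r \<in> {0..\<tau>0 - \<sigma> / 2}"
    then have "\<bar>r\<bar> < t" by auto
    from has_vector_derivative_scaleR[OF d[OF this] has_vector_derivative_const[of "f r"]]
    show "((\<lambda>t. K r t *\<^sub>R f r) has_vector_derivative K' r t *\<^sub>R f r) (at t)"
      by simp
  next
    show "((\<lambda>\<tau>. \<tau> - \<sigma>) has_vector_derivative 1) (at \<tau>0)"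
      by (auto intro!: derivative_eq_intros)
  qed (use \<sigma> t0 in \<open>auto intro!: kernel_times_profile_continuous f K K'\<close>)
  then show ?thesis by simp
qed

lemma epd_mean_deriv:
  assumes t0: "\<sigma> < \<tau>0" "\<tau>0 \<le> S"
  shows "(epd_mean \<sigma> g has_vector_derivative epd_mean_t \<sigma> g \<tau>0) (at \<tau>0)"
  unfolding epd_mean_def[abs_def] epd_mean_t_def epd_boundary(1)[OF \<sigma> less_imp_le[OF t0(1)], symmetric]
  by (rule profile_leibniz[OF k t0 epd_cont(1)[OF \<sigma>] epd_cont(2)[OF \<sigma>] epd_deriv_t[OF \<sigma>]])

text \<open>This is the equation \<open>V'' + (2g/\<tau>) V' = \<integral> E k''\<close> for the average \<open>V\<close>. After differentiation under the
  integral, \<open>E\<^sub>\<tau>\<^sub>\<tau> + (2g/\<tau>) E\<^sub>\<tau>\<close> is replaced by \<open>E\<^sub>r\<^sub>r\<close> and moved to \<open>k\<close>. At \<open>r = 0\<close> the boundary terms vanish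
  since \<open>E\<^sub>r = 0 = k'\<close>. At \<open>r = \<tau> - \<sigma>\<close> they cancel against the Leibniz terms: the terms in \<open>k'\<close> directly,
  and those in \<open>k\<close> because \<open>E\<^sub>\<tau> + E\<^sub>r = -(g/\<tau>) E\<close> there.\<close>
lemma epd_mean_t_deriv:
  assumes t0: "\<sigma> < \<tau>0" "\<tau>0 \<le> S"
  shows "(epd_mean_t \<sigma> g has_vector_derivative
     integral {0..\<tau>0 - \<sigma>} (\<lambda>r. epd g \<sigma> r \<tau>0 *\<^sub>R k2 r) - (2 * g / \<tau>0) *\<^sub>R epd_mean_t \<sigma> g \<tau>0) (at \<tau>0)"
proof -
  define b where "b = (4 * \<tau>0 * \<sigma>) powr (- g)"
  have pos: "\<tau>0 > 0" "4 * \<tau>0 * \<sigma> > 0" using t0 \<sigma> by auto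
  define I1 where "I1 = integral {0..\<tau>0 - \<sigma>} (\<lambda>r. epd_t g \<sigma> r \<tau>0 *\<^sub>R k r)"
  define I2 where "I2 = integral {0..\<tau>0 - \<sigma>} (\<lambda>r. epd_tt g \<sigma> r \<tau>0 *\<^sub>R k r)"
  define J where "J = integral {0..\<tau>0 - \<sigma>} (\<lambda>r. epd g \<sigma> r \<tau>0 *\<^sub>R k2 r)"
  let ?c = "\<tau>0 - \<sigma>"
  have sub: "{0..?c} \<subseteq> {0..S}" using t0 \<sigma> by auto
  have i: "continuous_on {0..?c} (\<lambda>r. K r \<tau>0 *\<^sub>R f r)" if "continuous_on {0..S} f" and
     K: "continuous_on {p. \<bar>fst p\<bar> < snd p} (\<lambda>p. K (fst p) (snd p))"
   for K :: "real \<Rightarrow> real \<Rightarrow> real" and f :: "real \<Rightarrow> complex"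
  proof (rule continuous_on_scaleR)
    show "continuous_on {0..?c} (\<lambda>r. K r \<tau>0)"
      by (rule continuous_on_compose2[OF K, where f = "\<lambda>r. (r, \<tau>0)", simplified fst_conv snd_conv])
        (use \<sigma> in \<open>auto intro!: continuous_intros\<close>)
  qed (rule continuous_on_subset[OF that(1) sub])
  have pw: "((\<lambda>\<tau>. (4 * \<tau> * \<sigma>) powr (- g)) has_field_derivative - g / \<tau>0 * b) (at \<tau>0)"
  proof -
    have "((\<lambda>\<tau>. 4 * \<tau> * \<sigma>) has_field_derivative 4 * \<sigma>) (at \<tau>0)"
      by (auto intro!: derivative_eq_intros)
    from DERIV_chain2[OF has_real_derivative_powr[OF pos(2), of "- g"] this]
    show ?thesis
      by (rule DERIV_cong) (use pos \<sigma> in \<open>simp add: b_def powr_diff\<close>)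
  qed
  have kd: "((\<lambda>\<tau>. k (\<tau> - \<sigma>)) has_vector_derivative k1 ?c) (at \<tau>0)"
  proof -
    have "((\<lambda>\<tau>. \<tau> - \<sigma>) has_vector_derivative 1) (at \<tau>0)"
      by (auto intro!: derivative_eq_intros)
    from vector_diff_chain_at[OF this, of k "k1 ?c"] show ?thesis
      using deriv1[of ?c] t0 \<sigma> by (simp add: o_def)
  qed
  have d1: "((\<lambda>\<tau>. (4 * \<tau> * \<sigma>) powr (- g) *\<^sub>R k (\<tau> - \<sigma>)) has_vector_derivative
      b *\<^sub>R k1 ?c + (- g / \<tau>0 * b) *\<^sub>R k ?c) (at \<tau>0)"
    using has_vector_derivative_scaleR[OF pw kd] by (simp add: b_def)
  have d2: "((\<lambda>\<tau>. integral {0..\<tau> - \<sigma>} (\<lambda>r. epd_t g \<sigma> r \<tau> *\<^sub>R k r)) has_vector_derivative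
      epd_t g \<sigma> ?c \<tau>0 *\<^sub>R k ?c + I2) (at \<tau>0)"
    unfolding I2_def
    by (rule profile_leibniz[OF k t0 epd_cont(2)[OF \<sigma>] epd_cont(3)[OF \<sigma>] epd_deriv_tt[OF \<sigma>]])
  have epd_mean_t: "(epd_mean_t \<sigma> g has_vector_derivative (b *\<^sub>R k1 ?c + (- g / \<tau>0 * b) *\<^sub>R k ?c)
      + (epd_t g \<sigma> ?c \<tau>0 *\<^sub>R k ?c + I2)) (at \<tau>0)"
    using has_vector_derivative_add[OF d1 d2] unfolding epd_mean_t_def[abs_def] .
  \<comment> \<open>Green's formula in \<open>r\<close>: both integrations by parts at once\<close>
  have green: "((\<lambda>r. epd_rr g \<sigma> r \<tau>0 *\<^sub>R k r - epd g \<sigma> r \<tau>0 *\<^sub>R k2 r) has_integral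
      (epd_r g \<sigma> ?c \<tau>0 *\<^sub>R k ?c - epd g \<sigma> ?c \<tau>0 *\<^sub>R k1 ?c) - (epd_r g \<sigma> 0 \<tau>0 *\<^sub>R k 0 - epd g \<sigma> 0 \<tau>0 *\<^sub>R k1 0)) {0..?c}"
  proof (rule fundamental_theorem_of_calculus_interior)
    show "continuous_on {0..?c} (\<lambda>r. epd_r g \<sigma> r \<tau>0 *\<^sub>R k r - epd g \<sigma> r \<tau>0 *\<^sub>R k1 r)"
      by (intro continuous_on_diff i k k1 epd_cont \<sigma>)
    fix r assume r: "r \<in> {0<..<?c}"
    then have r': "\<bar>r\<bar> < \<tau>0" "0 < r" "r < S" using \<sigma> t0 by auto
    have "((\<lambda>r. epd_r g \<sigma> r \<tau>0 *\<^sub>R k r - epd g \<sigma> r \<tau>0 *\<^sub>R k1 r) has_vector_derivative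
       (epd_r g \<sigma> r \<tau>0 *\<^sub>R k1 r + epd_rr g \<sigma> r \<tau>0 *\<^sub>R k r) - (epd g \<sigma> r \<tau>0 *\<^sub>R k2 r + epd_r g \<sigma> r \<tau>0 *\<^sub>R k1 r)) (at r)"
      by (intro has_vector_derivative_diff has_vector_derivative_scaleR epd_deriv_rr epd_deriv_r \<sigma> deriv1 deriv2 r')
    then show "((\<lambda>r. epd_r g \<sigma> r \<tau>0 *\<^sub>R k r - epd g \<sigma> r \<tau>0 *\<^sub>R k1 r) has_vector_derivative
       epd_rr g \<sigma> r \<tau>0 *\<^sub>R k r - epd g \<sigma> r \<tau>0 *\<^sub>R k2 r) (at r)" by simp
  qed (use t0 in auto)
  have "((\<lambda>r. epd_rr g \<sigma> r \<tau>0 *\<^sub>R k r) has_integral (I2 + (2 * g / \<tau>0) *\<^sub>R I1)) {0..?c}"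
  proof -
    have "((\<lambda>r. epd_tt g \<sigma> r \<tau>0 *\<^sub>R k r + (2 * g / \<tau>0) *\<^sub>R (epd_t g \<sigma> r \<tau>0 *\<^sub>R k r)) has_integral
       (I2 + (2 * g / \<tau>0) *\<^sub>R I1)) {0..?c}"
      unfolding I1_def I2_def
      by (intro has_integral_add has_integral_cmul integrable_integral integrable_continuous_real i k epd_cont \<sigma>)
    then show ?thesis
    proof (rule has_integral_eq[rotated])
      fix r assume "r \<in> {0..?c}"
      then have "\<bar>r\<bar> < \<tau>0" using \<sigma> by auto
      from epd_equation[OF \<sigma> this, of g]
      show "epd_tt g \<sigma> r \<tau>0 *\<^sub>R k r + (2 * g / \<tau>0) *\<^sub>R (epd_t g \<sigma> r \<tau>0 *\<^sub>R k r) = epd_rr g \<sigma> r \<tau>0 *\<^sub>R k r"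
        by (simp add: scaleR_add_left[symmetric])
    qed
  qed
  moreover have "((\<lambda>r. epd g \<sigma> r \<tau>0 *\<^sub>R k2 r) has_integral J) {0..?c}"
    unfolding J_def by (intro integrable_integral integrable_continuous_real i k2 epd_cont \<sigma>)
  ultimately have "((\<lambda>r. epd_rr g \<sigma> r \<tau>0 *\<^sub>R k r - epd g \<sigma> r \<tau>0 *\<^sub>R k2 r) has_integral
      (I2 + (2 * g / \<tau>0) *\<^sub>R I1) - J) {0..?c}"
    by (rule has_integral_diff)
  from has_integral_unique[OF this green]
  have "I2 = J - (2 * g / \<tau>0) *\<^sub>R I1 + epd_r g \<sigma> ?c \<tau>0 *\<^sub>R k ?c - b *\<^sub>R k1 ?c"
    using epd_boundary(1)[OF \<sigma> less_imp_le[OF t0(1)], of g] by (simp add: k1_0 epd_r_def b_def algebra_simps)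
  then have "(b *\<^sub>R k1 ?c + (- g / \<tau>0 * b) *\<^sub>R k ?c) + (epd_t g \<sigma> ?c \<tau>0 *\<^sub>R k ?c + I2)
    = (- g / \<tau>0 * b) *\<^sub>R k ?c + (epd_t g \<sigma> ?c \<tau>0 + epd_r g \<sigma> ?c \<tau>0) *\<^sub>R k ?c + J - (2 * g / \<tau>0) *\<^sub>R I1"
    by (simp add: algebra_simps)
  also have "\<dots> = J - (2 * g / \<tau>0) *\<^sub>R (b *\<^sub>R k ?c + I1)"
    unfolding epd_boundary(2)[OF \<sigma> less_imp_le[OF t0(1)], of g] b_def[symmetric]
    by (simp add: scaleR_conv_of_real algebra_simps add_divide_distrib)
  also have "b *\<^sub>R k ?c + I1 = epd_mean_t \<sigma> g \<tau>0" by (simp add: epd_mean_t_def b_def I1_def)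
  finally show ?thesis using epd_mean_t unfolding J_def by simp
qed

lemma continuous_on_epd_mean:
  assumes "A \<subseteq> {\<sigma>..S}"
  shows "continuous_on A (epd_mean \<sigma> g)" "continuous_on A (epd_mean_t \<sigma> g)"
proof -
  have i: "continuous_on (SIGMA p:A. {0..p - \<sigma>}) (\<lambda>(p, r). K r p *\<^sub>R k r)" if 
     K: "continuous_on {p. \<bar>fst p\<bar> < snd p} (\<lambda>p. K (fst p) (snd p))"
   for K :: "real \<Rightarrow> real \<Rightarrow> real"
    unfolding case_prod_unfold
  proof (rule continuous_on_scaleR)
    show "continuous_on (SIGMA p:A. {0..p - \<sigma>}) (\<lambda>x. K (snd x) (fst x))"
      by (rule continuous_on_compose2[OF K, where f = "\<lambda>x. (snd x, fst x)", simplified fst_conv snd_conv])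
        (use \<sigma> in \<open>auto intro!: continuous_intros\<close>)
    show "continuous_on (SIGMA p:A. {0..p - \<sigma>}) (\<lambda>x. k (snd x))"
      by (rule continuous_on_compose2[OF k]) (use \<sigma> assms in \<open>force intro!: continuous_intros\<close>)+
  qed
  have "continuous_on A (\<lambda>p. integral {0..p - \<sigma>} (\<lambda>r. epd g \<sigma> r p *\<^sub>R k r))"
       "continuous_on A (\<lambda>p. integral {0..p - \<sigma>} (\<lambda>r. epd_t g \<sigma> r p *\<^sub>R k r))"
    by (rule continuous_on_moving_integral[OF _ _ i[OF epd_cont(1)[OF \<sigma>]]], 
       use assms in \<open>auto intro!: continuous_intros\<close>)
     (rule continuous_on_moving_integral[OF _ _ i[OF epd_cont(2)[OF \<sigma>]]], 
       use assms in \<open>auto intro!: continuous_intros\<close>)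
  moreover have "continuous_on A (\<lambda>p. (4 * p * \<sigma>) powr (- g) *\<^sub>R k (p - \<sigma>))"
    by (intro continuous_on_scaleR continuous_on_powr continuous_on_compose2[OF k] continuous_intros)
      (use \<sigma> assms in force)+
  ultimately show "continuous_on A (epd_mean \<sigma> g)" "continuous_on A (epd_mean_t \<sigma> g)"
    unfolding epd_mean_def[abs_def] epd_mean_t_def[abs_def] by (auto intro!: continuous_on_add)
qed

end
end

section \<open>The kernel averages in the original time variable\<close>

lemma phi_0 [simp]: "phi l 0 = 0"
  by (simp add: phi_def)

lemma phi_pos: "l > -2 \<Longrightarrow> t > 0 \<Longrightarrow> phi l t > 0"
  by (simp add: phi_def)

lemma phi_strict_mono: "l > -2 \<Longrightarrow> 0 \<le> s \<Longrightarrow> s < t \<Longrightarrow> phi l s < phi l t"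
  unfolding phi_def by (intro mult_strict_left_mono powr_less_mono2) auto

lemma phi_mono: "l > -2 \<Longrightarrow> 0 \<le> s \<Longrightarrow> s \<le> t \<Longrightarrow> phi l s \<le> phi l t"
  using phi_strict_mono[of l s t] by (cases "s = t") auto

lemma phi_deriv:
  assumes "l > -2" "t > 0"
  shows "(phi l has_field_derivative t powr (l / 2)) (at t)"
proof -
  have e: "(l + 2) / 2 - 1 = l / 2" by (simp add: field_simps)
  have "((\<lambda>t. 2 / (l + 2) * t powr ((l + 2) / 2)) has_field_derivative
      2 / (l + 2) * ((l + 2) / 2 * t powr ((l + 2) / 2 - 1))) (at t)"
    by (intro DERIV_cmult has_real_derivative_powr assms)
  then show ?thesis
    unfolding phi_def[abs_def] e by (rule DERIV_cong) (use assms in simp)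
qed

lemma continuous_on_phi:
  assumes "l > -2"
  shows "continuous_on {0..} (phi l)"
  unfolding phi_def[abs_def]
  by (intro continuous_intros continuous_on_powr') (use assms in auto)

lemma kernel_eq_epd: "kernel l t b r = epd (gam l) (phi l b) r (phi l t)"
  by (simp add: kernel_def epd_def homog_def coneP_def coneQ_def gauss_F_eq_gaussD)

text \<open>The constant \<open>c\<^sub>l\<close> is fixed by the requirement that the average of a profile \<open>k\<close> has the initial
  velocity \<open>k 0\<close> at \<open>t = b\<close>: \<open>b\<^bsup>l/2\<^esup>\<close> is \<open>\<phi>'(b)\<close>, and the last factor is the value of the kernel at
  \<open>\<tau> = \<sigma>\<close>, \<open>r = 0\<close>.\<close>
lemma c_const_normalises:
  assumes "l > -2" "b > 0"
  shows "c_const l * b powr (l / 2) * (4 * phi l b * phi l b) powr (- gam l) = 1"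
proof -
  define L where "L = (l + 2) / 4"
  have L: "L > 0" using assms by (simp add: L_def)
  have phi: "phi l b = inverse (2 * L) * b powr (2 * L)"
  proof -
    have "(l + 2) / 2 = 2 * L" "2 / (l + 2) = inverse (2 * L)"
      using assms by (simp_all add: L_def field_simps)
    then show ?thesis unfolding phi_def by (simp only:)
  qed
  have "4 * phi l b * phi l b = (inverse L * b powr (2 * L)) powr 2"
    using L assms by (simp add: phi power2_eq_square field_simps)
  then have "(4 * phi l b * phi l b) powr (- gam l) = (inverse L * b powr (2 * L)) powr (2 * - gam l)"
    by (simp only: powr_powr)
  also have "2 * - gam l = - l / (4 * L)"
    using assms by (simp add: gam_def L_def field_simps)
  also have "(inverse L * b powr (2 * L)) powr (- l / (4 * L))
      = inverse L powr (- l / (4 * L)) * b powr (2 * L * (- l / (4 * L)))"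
    using L by (simp add: powr_mult powr_powr)
  also have "2 * L * (- l / (4 * L)) = - (l / 2)"
    using L by (simp add: field_simps)
  also have "inverse L powr (- l / (4 * L)) = L powr (l / (4 * L))"
    using L by (simp add: powr_minus inverse_powr)
  finally have e: "(4 * phi l b * phi l b) powr (- gam l) = L powr (l / (4 * L)) * b powr (- (l / 2))" .
  have "c_const l = L powr (- (l / (4 * L)))"
  proof -
    have "4 * L = l + 2" by (simp add: L_def)
    then show ?thesis unfolding c_const_def L_def[symmetric] by simp
  qed
  then show ?thesis unfolding e using L assms by (simp add: powr_minus field_simps)
qed

text \<open>The inner integral of the solution formula, including the constant \<open>c\<^sub>l\<close>, for a profile \<open>k\<close>.\<close>
definition kmean :: "real \<Rightarrow> real \<Rightarrow> real \<Rightarrow> (real \<Rightarrow> complex) \<Rightarrow> complex" where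
  "kmean l t b k = c_const l *\<^sub>R integral {0..phi l t - phi l b} (\<lambda>r. kernel l t b r *\<^sub>R k r)"

text \<open>The initial value problem \<open>v'' = t\<^sup>l K(k'')\<close>, \<open>v(b) = 0\<close>, \<open>v'(b) = k(0)\<close> in integrated form. Since
  \<open>\<tau>\<^bsup>2g\<^esup>\<close> is a multiple of \<open>t\<^bsup>l/2\<^esup> = \<phi>'(t)\<close>, the first-order term of the Euler-Poisson-Darboux equation
  is exactly absorbed by the substitution \<open>\<tau> = \<phi>(t)\<close>. The derivatives are taken for \<open>s > b\<close> only; at
  \<open>s = b\<close> continuity of \<open>v\<close> and \<open>v'\<close> is enough.\<close>
theorem (in C2_profile) kmean_taylor:
  assumes l: "l > -2" and S: "S = phi l T" and t: "0 < b" "b \<le> t" "t \<le> T"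
  shows "((\<lambda>s. ((t - s) * s powr l) *\<^sub>R kmean l s b k2) has_integral
     kmean l t b k - (t - b) *\<^sub>R k 0) {b..t}"
proof -
  define g \<sigma> c where "g = gam l" and "\<sigma> = phi l b" and "c = c_const l"
  have \<sigma>: "\<sigma> > 0" using l t by (simp add: \<sigma>_def phi_pos)
  have bS: "\<sigma> \<le> S" unfolding S \<sigma>_def using l t by (intro phi_mono) auto
  define v where "v = (\<lambda>s. c *\<^sub>R epd_mean \<sigma> g (phi l s))"
  define v1 where "v1 = (\<lambda>s. (c * s powr (l / 2)) *\<^sub>R epd_mean_t \<sigma> g (phi l s))"
  have v: "v s = kmean l s b k" for s
    by (simp add: v_def kmean_def epd_mean_def kernel_eq_epd g_def c_def \<sigma>_def)
  have im: "phi l ` {b..t} \<subseteq> {\<sigma>..S}"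
    unfolding S \<sigma>_def using l t by (auto intro!: phi_mono)
  have cphi: "continuous_on {b..t} (phi l)"
    using t by (intro continuous_on_subset[OF continuous_on_phi[OF l]]) auto
  have cv: "continuous_on {b..t} v"
    unfolding v_def
    by (intro continuous_on_scaleR continuous_on_const
        continuous_on_compose2[OF continuous_on_epd_mean(1)[OF \<sigma> order_refl] cphi im])
  have cv1: "continuous_on {b..t} v1"
    unfolding v1_def using t
    by (intro continuous_on_scaleR continuous_on_mult continuous_on_const continuous_on_powr continuous_on_id
        continuous_on_compose2[OF continuous_on_epd_mean(2)[OF \<sigma> order_refl] cphi im]) auto
  have dv: "(v has_vector_derivative v1 s) (at s)"
    and dv1: "(v1 has_vector_derivative s powr l *\<^sub>R kmean l s b k2) (at s)" if s: "b < s" "s < t" for s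
  proof -
    have s0: "s > 0" using s t by simp
    have ps: "\<sigma> < phi l s" "phi l s \<le> S" "phi l s > 0"
      unfolding S \<sigma>_def using l s t by (auto intro!: phi_mono phi_strict_mono phi_pos)
    have pd: "(phi l has_vector_derivative s powr (l / 2)) (at s)"
      using phi_deriv[OF l s0] by (simp add: has_real_derivative_iff_has_vector_derivative)
    have dV: "((\<lambda>s. epd_mean \<sigma> g (phi l s)) has_vector_derivative s powr (l / 2) *\<^sub>R epd_mean_t \<sigma> g (phi l s)) (at s)"
      using vector_diff_chain_at[OF pd epd_mean_deriv[OF \<sigma> ps(1,2)]] by (simp add: o_def)
    show "(v has_vector_derivative v1 s) (at s)"
      using has_vector_derivative_scaleR[OF DERIV_const[of c] dV] unfolding v_def v1_def by simp
    define J where "J = integral {0..phi l s - \<sigma>} (\<lambda>r. epd g \<sigma> r (phi l s) *\<^sub>R k2 r)"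
    have dV1: "((\<lambda>s. epd_mean_t \<sigma> g (phi l s)) has_vector_derivative
        s powr (l / 2) *\<^sub>R (J - (2 * g / phi l s) *\<^sub>R epd_mean_t \<sigma> g (phi l s))) (at s)"
      using vector_diff_chain_at[OF pd epd_mean_t_deriv[OF \<sigma> ps(1,2)]] by (simp add: o_def J_def)
    have "((\<lambda>s. c * s powr (l / 2)) has_field_derivative c * (l / 2 * s powr (l / 2 - 1))) (at s)"
      by (intro DERIV_cmult has_real_derivative_powr s0)
    from has_vector_derivative_scaleR[OF this dV1]
    have "(v1 has_vector_derivative (c * s powr (l / 2)) *\<^sub>R
        (s powr (l / 2) *\<^sub>R (J - (2 * g / phi l s) *\<^sub>R epd_mean_t \<sigma> g (phi l s)))
        + (c * (l / 2 * s powr (l / 2 - 1))) *\<^sub>R epd_mean_t \<sigma> g (phi l s)) (at s)"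
      unfolding v1_def .
    moreover have "(c * s powr (l / 2)) *\<^sub>R
        (s powr (l / 2) *\<^sub>R (J - (2 * g / phi l s) *\<^sub>R epd_mean_t \<sigma> g (phi l s)))
        + (c * (l / 2 * s powr (l / 2 - 1))) *\<^sub>R epd_mean_t \<sigma> g (phi l s) = s powr l *\<^sub>R (c *\<^sub>R J)"
    proof -
      have p1: "s powr (l / 2) * s powr (l / 2) = s powr l"
        by (simp add: powr_add[symmetric])
      have "l / 2 * s powr (l / 2 - 1) * phi l s = l / (l + 2) * (s powr (l / 2 - 1) * s powr ((l + 2) / 2))"
        by (simp add: phi_def)
      also have "s powr (l / 2 - 1) * s powr ((l + 2) / 2) = s powr l"
        by (simp add: powr_add[symmetric] field_simps)
      also have "l / (l + 2) = 2 * g" using l by (simp add: g_def gam_def divide_simps)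
      finally have p2: "l / 2 * s powr (l / 2 - 1) = 2 * g / phi l s * s powr l"
        using ps(3) by (simp add: field_simps)
      show ?thesis unfolding p2 p1[symmetric] by (simp add: scaleR_conv_of_real algebra_simps)
    qed
    moreover have "c *\<^sub>R J = kmean l s b k2"
      by (simp add: J_def kmean_def kernel_eq_epd g_def c_def \<sigma>_def)
    ultimately show "(v1 has_vector_derivative s powr l *\<^sub>R kmean l s b k2) (at s)"
      by simp
  qed
  \<comment> \<open>\<open>v + (t - s) v'\<close> is an antiderivative of \<open>(t - s) v''\<close>; its values at \<open>s = t\<close> and \<open>s = b\<close> are \<open>v(t)\<close> and \<open>(t - b) k(0)\<close>\<close>
  have "((\<lambda>s. ((t - s) * s powr l) *\<^sub>R kmean l s b k2) has_integral
     (v t + (t - t) *\<^sub>R v1 t) - (v b + (t - b) *\<^sub>R v1 b)) {b..t}"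
  proof (rule fundamental_theorem_of_calculus_interior)
    show "continuous_on {b..t} (\<lambda>s. v s + (t - s) *\<^sub>R v1 s)"
      by (intro continuous_intros cv cv1)
    fix s assume "s \<in> {b<..<t}"
    then have s: "b < s" "s < t" by auto
    have "((\<lambda>s. t - s) has_field_derivative - 1) (at s)"
      by (auto intro!: derivative_eq_intros)
    from has_vector_derivative_add[OF dv[OF s] has_vector_derivative_scaleR[OF this dv1[OF s]]]
    show "((\<lambda>s. v s + (t - s) *\<^sub>R v1 s) has_vector_derivative ((t - s) * s powr l) *\<^sub>R kmean l s b k2) (at s)"
      by simp
  qed (use t in auto)
  moreover have "v b = 0" by (simp add: v kmean_def)
  moreover have "v1 b = k 0"
    using c_const_normalises[OF l t(1)]
    by (simp add: v1_def epd_mean_t_def c_def g_def \<sigma>_def del: mult_cancel_right1)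
  ultimately show ?thesis by (simp add: v)
qed

lemma kernel_nonneg:
  assumes l: "l > -2" and b: "0 < b" "b \<le> t" and r: "0 \<le> r" "r \<le> phi l t - phi l b"
  shows "0 \<le> kernel l t b r"
proof -
  have pb: "phi l b > 0" using l b phi_pos by auto
  then have rt: "\<bar>r\<bar> < phi l t" using r by auto
  have "r\<^sup>2 \<le> (phi l t - phi l b)\<^sup>2" using r by (intro power_mono) auto
  then have "0 \<le> coneP (phi l b) r (phi l t)" by (simp add: coneP_def)
  then show ?thesis
    using coneQ_pos[OF pb rt] by (simp add: kernel_eq_epd epd_def homog_def gaussD_nonneg)
qed

lemma continuous_on_kernel:
  assumes l: "l > -2" and b: "continuous_on A b" and t: "continuous_on A t" and r: "continuous_on A r"
    and dom: "\<And>x. x \<in> A \<Longrightarrow> 0 < b x \<and> b x \<le> t x \<and> 0 \<le> r x \<and> r x \<le> phi l (t x) - phi l (b x)"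
  shows "continuous_on A (\<lambda>x. kernel l (t x) (b x) (r x))"
  unfolding kernel_eq_epd
proof (rule continuous_on_epd)
  have "b ` A \<subseteq> {0..}" "t ` A \<subseteq> {0..}" using dom by force+
  then show "continuous_on A (\<lambda>x. phi l (b x))" "continuous_on A (\<lambda>x. phi l (t x))"
    using continuous_on_compose2[OF continuous_on_phi[OF l]] b t by blast+
  fix x assume "x \<in> A"
  with dom[of x] phi_pos[OF l, of "b x"] show "phi l (b x) > 0 \<and> \<bar>r x\<bar> < phi l (t x)" by auto
qed (rule r)

text \<open>The constant profile \<open>1\<close> has second derivative \<open>0\<close>, so the total mass of the kernel can be read
  off from \<open>kmean_taylor\<close>.\<close>
lemma kmean_one:
  assumes l: "l > -2" and t: "0 < b" "b \<le> t"
  shows "c_const l * integral {0..phi l t - phi l b} (kernel l t b) = t - b"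
proof -
  interpret C2_profile "\<lambda>_. 1" "\<lambda>_. 0" "\<lambda>_. 0" "phi l t"
    by standard (auto intro!: derivative_eq_intros)
  have "((\<lambda>s. ((t - s) * s powr l) *\<^sub>R kmean l s b (\<lambda>_. 0)) has_integral
     kmean l t b (\<lambda>_. 1) - (t - b) *\<^sub>R 1) {b..t}"
    by (rule kmean_taylor[OF l refl t order_refl])
  then have "kmean l t b (\<lambda>_. 1) - (t - b) *\<^sub>R 1 = 0"
    by (simp add: kmean_def has_integral_0_eq)
  moreover have "kernel l t b integrable_on {0..phi l t - phi l b}"
    using t by (intro integrable_continuous_real continuous_on_kernel l) (auto intro!: continuous_intros)
  from has_integral_scaleR_left[OF integrable_integral[OF this], of "1 :: complex"]
  have "integral {0..phi l t - phi l b} (\<lambda>r. kernel l t b r *\<^sub>R (1 :: complex))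
    = integral {0..phi l t - phi l b} (kernel l t b) *\<^sub>R 1"
    by (rule integral_unique)
  ultimately have "complex_of_real (c_const l * integral {0..phi l t - phi l b} (kernel l t b)) = complex_of_real (t - b)"
    by (simp add: kmean_def scaleR_conv_of_real)
  then show ?thesis by (simp only: of_real_eq_iff)
qed

lemma c_const_pos: "l > -2 \<Longrightarrow> c_const l > 0"
  by (simp add: c_const_def)

text \<open>The kernel is nonnegative with total mass \<open>t - b\<close>. The bound stays uniform as \<open>b \<rightarrow> 0\<close>, although
  the kernel does not.\<close>
lemma kmean_bound:
  assumes l: "l > -2" and t: "0 < b" "b \<le> t"
    and k: "continuous_on {0..phi l t - phi l b} k"
    and M: "\<And>r. 0 \<le> r \<Longrightarrow> r \<le> phi l t - phi l b \<Longrightarrow> norm (k r) \<le> M"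
  shows "norm (kmean l t b k) \<le> (t - b) * M"
proof -
  have c: "continuous_on {0..phi l t - phi l b} (kernel l t b)"
    using t by (intro continuous_on_kernel l) (auto intro!: continuous_intros)
  have "norm (integral {0..phi l t - phi l b} (\<lambda>r. kernel l t b r *\<^sub>R k r))
     \<le> integral {0..phi l t - phi l b} (\<lambda>r. kernel l t b r * M)"
    using kernel_nonneg[OF l t] M
    by (intro integral_norm_bound_integral integrable_continuous_real continuous_intros c k)
      (auto simp: abs_mult intro!: mult_left_mono)
  also have "\<dots> = integral {0..phi l t - phi l b} (kernel l t b) * M"
    by simp
  finally have "c_const l * norm (integral {0..phi l t - phi l b} (\<lambda>r. kernel l t b r *\<^sub>R k r))
     \<le> c_const l * (integral {0..phi l t - phi l b} (kernel l t b) * M)"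
    using c_const_pos[OF l] by (intro mult_left_mono) auto
  then show ?thesis
    using c_const_pos[OF l] kmean_one[OF l t] by (simp add: kmean_def mult.assoc[symmetric])
qed

section \<open>The transform of a family of profiles\<close>

lemma LINT_Ioc_Icc:
  fixes f :: "real \<Rightarrow> 'b::{banach, second_countable_topology}"
  shows "(LINT b:{0<..t}|lborel. f b) = (LINT b:{0..t}|lborel. f b)"
    and "set_integrable lborel {0<..t} f \<longleftrightarrow> set_integrable lborel {0..t} f"
proof -
  have eq: "indicator {0<..t} x *\<^sub>R f x = indicator {0..t} x *\<^sub>R f x" if "x \<notin> {0}" for x
    using that by (auto simp: indicator_def)
  show "(LINT b:{0<..t}|lborel. f b) = (LINT b:{0..t}|lborel. f b)"
    unfolding set_lebesgue_integral_def
    by (rule integral_discrete_difference[where X = "{0}"]) (use eq in auto)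
  show "set_integrable lborel {0<..t} f \<longleftrightarrow> set_integrable lborel {0..t} f"
    unfolding set_integrable_def
    by (rule integrable_discrete_difference[where X = "{0}"]) (use eq in auto)
qed

lemma bounded_continuous_Ioc:
  fixes f :: "real \<Rightarrow> 'b::{banach, second_countable_topology}"
  assumes f: "continuous_on {0<..t} f" and M: "\<And>b. 0 < b \<Longrightarrow> b \<le> t \<Longrightarrow> norm (f b) \<le> M" and t: "0 \<le> t"
  shows "set_integrable lborel {0<..t} f" "norm (LINT b:{0<..t}|lborel. f b) \<le> t * M"
proof -
  have im: "integrable lborel (\<lambda>b. indicator {0<..t} b *\<^sub>R M)"
    by (intro integrable_scaleR_left integrable_indicator) (simp_all add: t)
  have le: "norm (indicator {0<..t} b *\<^sub>R f b) \<le> indicator {0<..t} b *\<^sub>R M" for b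
    using M[of b] by (simp add: indicator_def)
  show i: "set_integrable lborel {0<..t} f"
    unfolding set_integrable_def
  proof (rule Bochner_Integration.integrable_bound[OF im])
    show "(\<lambda>b. indicator {0<..t} b *\<^sub>R f b) \<in> borel_measurable lborel"
      using borel_measurable_continuous_on_indicator[OF _ f] by simp
    show "AE b in lborel. norm (indicator {0<..t} b *\<^sub>R f b) \<le> norm (indicator {0<..t} b *\<^sub>R M)"
      by (rule AE_I2) (rule order_trans[OF le], simp add: real_norm_def)
  qed
  have "norm (LINT b:{0<..t}|lborel. f b) \<le> (\<integral>b. norm (indicator {0<..t} b *\<^sub>R f b) \<partial>lborel)"
    unfolding set_lebesgue_integral_def by (rule integral_norm_bound)
  also have "\<dots> \<le> (\<integral>b. indicator {0<..t} b *\<^sub>R M \<partial>lborel)"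
    using i le by (intro integral_mono im integrable_norm) (auto simp: set_integrable_def)
  also have "\<dots> = t * M" using t by simp
  finally show "norm (LINT b:{0<..t}|lborel. f b) \<le> t * M" .
qed

text \<open>The whole transform for a family of profiles \<open>k(\<cdot>, b)\<close>. The half-open interval leaves out the point
  \<open>b = 0\<close>, at which the kernel degenerates.\<close>
definition hmean :: "real \<Rightarrow> (real \<Rightarrow> real \<Rightarrow> complex) \<Rightarrow> real \<Rightarrow> complex" where
  "hmean l k t = (LINT b:{0<..t}|lborel. kmean l t b (\<lambda>r. k r b))"

locale hyp_time =
  fixes l T :: real
  assumes l: "l > -2" and T: "T > 0"
begin

text \<open>The arguments \<open>(r, b)\<close> of the profiles that enter the transform up to time \<open>T\<close>.\<close>
definition slab :: "(real \<times> real) set" where "slab = {0..phi l T} \<times> {0..T}"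

lemma compact_slab: "compact slab"
  unfolding slab_def by (intro compact_Times compact_Icc)

lemma bounded_on_slab:
  fixes k :: "real \<Rightarrow> real \<Rightarrow> complex"
  assumes "continuous_on slab (\<lambda>(r, b). k r b)"
  obtains B where "0 \<le> B" "\<And>r b. (r, b) \<in> slab \<Longrightarrow> norm (k r b) \<le> B"
proof -
  have "bounded ((\<lambda>(r, b). k r b) ` slab)"
    by (intro compact_imp_bounded compact_continuous_image assms compact_slab)
  then obtain B where B: "\<And>r b. (r, b) \<in> slab \<Longrightarrow> norm (k r b) \<le> B"
    by (force simp: bounded_iff)
  show ?thesis
    by (rule that[of "max 0 B"]) (use B in \<open>force simp: le_max_iff_disj\<close>)+
qed

lemma profile_sub:
  assumes "0 < b" "b \<le> t" "t \<le> T"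
  shows "{0..phi l t - phi l b} \<subseteq> {0..phi l T}"
  using phi_mono[OF l, of t T] phi_pos[OF l, of b] assms by auto

lemma profile_cont:
  fixes k :: "real \<Rightarrow> real \<Rightarrow> complex"
  assumes k: "continuous_on slab (\<lambda>(r, b). k r b)" and b: "0 \<le> b" "b \<le> T"
  shows "continuous_on {0..phi l T} (\<lambda>r. k r b)"
proof -
  have "continuous_on {0..phi l T} (\<lambda>r. (\<lambda>(r, b). k r b) (r, b))"
    by (rule continuous_on_compose2[OF k]) (use b in \<open>auto simp: slab_def intro!: continuous_intros\<close>)
  then show ?thesis by simp
qed

lemma kmean_cont:
  assumes k: "continuous_on slab (\<lambda>(r, b). k r b)"
  shows "continuous_on {(s, b). 0 < b \<and> b \<le> s \<and> s \<le> T} (\<lambda>(s, b). kmean l s b (\<lambda>r. k r b))"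
proof -
  define X where "X = {(s, b). 0 < b \<and> b \<le> s \<and> s \<le> T}"
  let ?R = "\<lambda>p. phi l (fst p) - phi l (snd p)"
  let ?h = "\<lambda>p r. kernel l (fst p) (snd p) r *\<^sub>R k r (snd p)"
  have "continuous_on X (\<lambda>p. integral {0..?R p} (?h p))"
  proof (rule continuous_on_moving_integral[where R = ?R and h = ?h])
    have "fst ` X \<subseteq> {0..}" "snd ` X \<subseteq> {0..}" by (auto simp: X_def)
    then show "continuous_on X ?R"
      by (intro continuous_on_diff continuous_on_compose2[OF continuous_on_phi[OF l]] continuous_intros)
    show "0 \<le> ?R p" if "p \<in> X" for p
      using that phi_mono[OF l, of "snd p" "fst p"] by (auto simp: X_def)
    show "continuous_on (SIGMA p:X. {0..?R p}) (\<lambda>(p, r). ?h p r)"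
      unfolding case_prod_unfold
    proof (rule continuous_on_scaleR)
      show "continuous_on (SIGMA p:X. {0..?R p}) (\<lambda>x. kernel l (fst (fst x)) (snd (fst x)) (snd x))"
        by (rule continuous_on_kernel[OF l]) (auto simp: X_def intro!: continuous_intros)
      have "continuous_on (SIGMA p:X. {0..?R p}) (\<lambda>x. (\<lambda>(r, b). k r b) (snd x, snd (fst x)))"
      proof (rule continuous_on_compose2[OF k])
        show "continuous_on (SIGMA p:X. {0..?R p}) (\<lambda>x. (snd x, snd (fst x)))"
          by (intro continuous_intros)
        show "(\<lambda>x. (snd x, snd (fst x))) ` (SIGMA p:X. {0..?R p}) \<subseteq> slab"
        proof (rule image_subsetI)
          fix x assume "x \<in> (SIGMA p:X. {0..?R p})"
          then show "(snd x, snd (fst x)) \<in> slab"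
            using profile_sub[of "snd (fst x)" "fst (fst x)"] by (auto simp: slab_def X_def)
        qed
      qed
      then show "continuous_on (SIGMA p:X. {0..?R p}) (\<lambda>x. k (snd x) (snd (fst x)))" by simp
    qed
  qed
  then have "continuous_on X (\<lambda>(s, b). kmean l s b (\<lambda>r. k r b))"
    unfolding kmean_def case_prod_unfold by (intro continuous_intros)
  then show ?thesis by (simp only: X_def)
qed

lemma kmean_cont_b:
  assumes k: "continuous_on slab (\<lambda>(r, b). k r b)" and t: "t \<le> T"
  shows "continuous_on {0<..t} (\<lambda>b. kmean l t b (\<lambda>r. k r b))"
proof -
  have "continuous_on {0<..t} (\<lambda>b. (\<lambda>(s, b). kmean l s b (\<lambda>r. k r b)) (t, b))"
    by (rule continuous_on_compose2[OF kmean_cont[OF k]]) (use t in \<open>auto intro!: continuous_intros\<close>)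
  then show ?thesis by simp
qed

lemma kmean_cont_s:
  assumes k: "continuous_on slab (\<lambda>(r, b). k r b)" and b: "0 < b" "t \<le> T"
  shows "continuous_on {b..t} (\<lambda>s. kmean l s b (\<lambda>r. k r b))"
proof -
  have "continuous_on {b..t} (\<lambda>s. (\<lambda>(s, b). kmean l s b (\<lambda>r. k r b)) (s, b))"
    by (rule continuous_on_compose2[OF kmean_cont[OF k]]) (use b in \<open>auto intro!: continuous_intros\<close>)
  then show ?thesis by simp
qed

lemma kmean_le:
  assumes k: "continuous_on slab (\<lambda>(r, b). k r b)" and M: "\<And>r b. (r, b) \<in> slab \<Longrightarrow> norm (k r b) \<le> M"
    and b: "0 < b" "b \<le> t" "t \<le> T"
  shows "norm (kmean l t b (\<lambda>r. k r b)) \<le> t * M"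
proof -
  have "norm (kmean l t b (\<lambda>r. k r b)) \<le> (t - b) * M"
  proof (rule kmean_bound[OF l b(1,2)])
    show "continuous_on {0..phi l t - phi l b} (\<lambda>r. k r b)"
      by (rule continuous_on_subset[OF profile_cont[OF k] profile_sub]) (use b in auto)
    show "norm (k r b) \<le> M" if "0 \<le> r" "r \<le> phi l t - phi l b" for r
      by (rule M) (use that b profile_sub[OF b] in \<open>auto simp: slab_def\<close>)
  qed
  also have "0 \<le> M"
    using order_trans[OF norm_ge_zero M[of 0 0]] T phi_pos[OF l T] by (simp add: slab_def)
  then have "(t - b) * M \<le> t * M" using b by (intro mult_right_mono) auto
  finally show ?thesis .
qed

text \<open>The second part makes the transform, for fixed \<open>t\<close>, a bounded functional on the continuous
  functions on the slab. The factor \<open>t\<^sup>2\<close> is what controls the limit \<open>t \<rightarrow> 0\<close>.\<close>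
lemma hmean_props:
  assumes k: "continuous_on slab (\<lambda>(r, b). k r b)" and t: "0 \<le> t" "t \<le> T"
  shows hmean_integrable: "set_integrable lborel {0<..t} (\<lambda>b. kmean l t b (\<lambda>r. k r b))"
    and hmean_bound: "(\<And>r b. (r, b) \<in> slab \<Longrightarrow> norm (k r b) \<le> M) \<Longrightarrow> norm (hmean l k t) \<le> t * (t * M)"
proof -
  obtain B where B: "\<And>r b. (r, b) \<in> slab \<Longrightarrow> norm (k r b) \<le> B"
    using bounded_on_slab[OF k] by blast
  show "set_integrable lborel {0<..t} (\<lambda>b. kmean l t b (\<lambda>r. k r b))"
    by (rule bounded_continuous_Ioc(1)[OF kmean_cont_b[OF k t(2)] kmean_le[OF k B]]) (use t in auto)
  show "norm (hmean l k t) \<le> t * (t * M)" if "\<And>r b. (r, b) \<in> slab \<Longrightarrow> norm (k r b) \<le> M"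
    unfolding hmean_def
    by (rule bounded_continuous_Ioc(2)[OF kmean_cont_b[OF k t(2)] kmean_le[OF k that]]) (use t in auto)
qed

lemma kernel_profile_integrable:
  fixes k :: "real \<Rightarrow> real \<Rightarrow> complex"
  assumes k: "continuous_on slab (\<lambda>(r, b). k r b)" and b: "0 < b" "b \<le> t" "t \<le> T"
  shows "continuous_on {0..phi l t - phi l b} (\<lambda>r. kernel l t b r *\<^sub>R k r b)"
proof (rule continuous_on_scaleR)
  show "continuous_on {0..phi l t - phi l b} (kernel l t b)"
    using b by (intro continuous_on_kernel l) (auto intro!: continuous_intros)
  show "continuous_on {0..phi l t - phi l b} (\<lambda>r. k r b)"
    by (rule continuous_on_subset[OF profile_cont[OF k] profile_sub]) (use b in auto)
qed

lemma hmean_sum: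
  assumes I: "finite I" and k: "\<And>i. i \<in> I \<Longrightarrow> continuous_on slab (\<lambda>(r, b). k i r b)" and t: "0 \<le> t" "t \<le> T"
  shows "hmean l (\<lambda>r b. \<Sum>i\<in>I. c i * k i r b) t = (\<Sum>i\<in>I. c i * hmean l (k i) t)"
proof -
  have km: "kmean l t b (\<lambda>r. \<Sum>i\<in>I. c i * k i r b) = (\<Sum>i\<in>I. c i * kmean l t b (\<lambda>r. k i r b))"
    if b: "0 < b" "b \<le> t" for b
  proof -
    have i: "(\<lambda>r. kernel l t b r *\<^sub>R k i r b) integrable_on {0..phi l t - phi l b}" if "i \<in> I" for i
      by (rule integrable_continuous_real kernel_profile_integrable)+ (use that k b t in auto)
    have "integral {0..phi l t - phi l b} (\<lambda>r. kernel l t b r *\<^sub>R (\<Sum>i\<in>I. c i * k i r b))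
      = integral {0..phi l t - phi l b} (\<lambda>r. \<Sum>i\<in>I. c i * (kernel l t b r *\<^sub>R k i r b))"
      by (simp add: scaleR_sum_right)
    also have "\<dots> = (\<Sum>i\<in>I. integral {0..phi l t - phi l b} (\<lambda>r. c i * (kernel l t b r *\<^sub>R k i r b)))"
      by (rule integral_sum[OF I]) (intro integrable_on_mult_right i)
    also have "\<dots> = (\<Sum>i\<in>I. c i * integral {0..phi l t - phi l b} (\<lambda>r. kernel l t b r *\<^sub>R k i r b))"
      by (intro sum.cong refl integral_mult_right)
    finally show ?thesis by (simp add: kmean_def scaleR_sum_right)
  qed
  have "hmean l (\<lambda>r b. \<Sum>i\<in>I. c i * k i r b) t
     = (LINT b:{0<..t}|lborel. \<Sum>i\<in>I. c i * kmean l t b (\<lambda>r. k i r b))"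
    unfolding hmean_def by (rule set_lebesgue_integral_cong) (use km in auto)
  also have "\<dots> = (\<Sum>i\<in>I. LINT b:{0<..t}|lborel. c i * kmean l t b (\<lambda>r. k i r b))"
  proof -
    have "set_integrable lborel {0<..t} (\<lambda>b. c i * kmean l t b (\<lambda>r. k i r b))" if "i \<in> I" for i
      using that by (intro set_integrable_mult_right hmean_integrable k t)
    then show ?thesis
      unfolding set_lebesgue_integral_def scaleR_sum_right set_integrable_def
      by (rule Bochner_Integration.integral_sum)
  qed
  finally show ?thesis by (simp add: hmean_def)
qed

lemma hmean_diff:
  assumes "continuous_on slab (\<lambda>(r, b). k r b)" "continuous_on slab (\<lambda>(r, b). k' r b)" "0 \<le> t" "t \<le> T"
  shows "hmean l (\<lambda>r b. k r b - k' r b) t = hmean l k t - hmean l k' t"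
  using hmean_sum[of "{True, False}" "\<lambda>i. if i then k else k'" t "\<lambda>i. if i then 1 else -1"] assms
  by simp

lemma hmean_cmult:
  assumes "continuous_on slab (\<lambda>(r, b). k r b)" "0 \<le> t" "t \<le> T"
  shows "hmean l (\<lambda>r b. c * k r b) t = c * hmean l k t"
  using hmean_sum[of "{()}" "\<lambda>_. k" t "\<lambda>_. c"] assms by simp

text \<open>Dominated convergence: for each \<open>b \<noteq> t\<close> the integrand, extended by \<open>0\<close> to \<open>b > t\<close>, depends
  continuously on \<open>t\<close>, and it is dominated by the constant from \<open>kmean_le\<close>.\<close>
lemma continuous_on_hmean:
  assumes k: "continuous_on slab (\<lambda>(r, b). k r b)"
  shows "continuous_on {0..T} (hmean l k)"
  unfolding continuous_on_sequentially
proof (intro allI ballI impI, elim conjE)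
  fix x :: "nat \<Rightarrow> real" and a assume a: "a \<in> {0..T}" and x: "\<forall>n. x n \<in> {0..T}" and lim: "x \<longlonglongrightarrow> a"
  obtain B where B0: "0 \<le> B" and B: "\<And>r b. (r, b) \<in> slab \<Longrightarrow> norm (k r b) \<le> B"
    using bounded_on_slab[OF k] by blast
  define f where "f s b = indicator {0<..s} b *\<^sub>R kmean l s b (\<lambda>r. k r b)" for s b
  have m: "f s \<in> borel_measurable lborel" if "s \<le> T" for s
    unfolding f_def using borel_measurable_continuous_on_indicator[OF _ kmean_cont_b[OF k that]] by simp
  have "(\<lambda>n. integral\<^sup>L lborel (f (x n))) \<longlonglongrightarrow> integral\<^sup>L lborel (f a)"
  proof (rule integral_dominated_convergence[where w = "\<lambda>b. indicator {0..T} b *\<^sub>R (T * B)"])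
    show "f a \<in> borel_measurable lborel" "\<And>n. f (x n) \<in> borel_measurable lborel"
      using m a x by auto
    show "integrable lborel (\<lambda>b. indicator {0..T} b *\<^sub>R (T * B))"
      by (intro integrable_scaleR_left integrable_indicator) (use T in simp_all)
    show "AE b in lborel. norm (f (x n) b) \<le> indicator {0..T} b *\<^sub>R (T * B)" for n
    proof (rule AE_I2)
      fix b
      have xT: "0 \<le> x n" "x n \<le> T" using x by auto
      show "norm (f (x n) b) \<le> indicator {0..T} b *\<^sub>R (T * B)"
      proof (cases "0 < b \<and> b \<le> x n")
        case True
        then have "norm (kmean l (x n) b (\<lambda>r. k r b)) \<le> x n * B"
          using xT by (intro kmean_le k B) auto
        also have "\<dots> \<le> T * B" using xT B0 by (intro mult_right_mono)
        finally show ?thesis using True xT by (simp add: f_def indicator_def)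
      next
        case False
        then show ?thesis using T B0 by (auto simp: f_def indicator_def)
      qed
    qed
    have "AE b in lborel. b \<noteq> a" using AE_lborel_singleton by blast
    then show "AE b in lborel. (\<lambda>n. f (x n) b) \<longlonglongrightarrow> f a b"
    proof eventually_elim
      case (elim b)
      consider "b \<le> 0" | "0 < b" "b < a" | "0 < b" "a < b" using elim by linarith
      then show ?case
      proof cases
        case 1
        then show ?thesis by (simp add: f_def)
      next
        case 2
        have ev: "eventually (\<lambda>n. b < x n) sequentially" using lim 2 by (simp add: order_tendstoD)
        then have ev': "eventually (\<lambda>n. b \<le> x n) sequentially" by eventually_elim simp
        have "((\<lambda>s. kmean l s b (\<lambda>r. k r b)) \<longlongrightarrow> kmean l a b (\<lambda>r. k r b)) (at a within {b..T})"
          using kmean_cont_s[OF k 2(1) order_refl] 2 a by (simp add: continuous_on_def)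
        then have "(\<lambda>n. kmean l (x n) b (\<lambda>r. k r b)) \<longlonglongrightarrow> kmean l a b (\<lambda>r. k r b)"
          using continuous_within_tendsto_compose[of a "{b..T}" "\<lambda>s. kmean l s b (\<lambda>r. k r b)" x sequentially]
            ev' lim x by (simp add: continuous_within)
        moreover have "eventually (\<lambda>n. kmean l (x n) b (\<lambda>r. k r b) = f (x n) b) sequentially"
          using ev by eventually_elim (use 2 in \<open>simp add: f_def\<close>)
        ultimately have "(\<lambda>n. f (x n) b) \<longlonglongrightarrow> kmean l a b (\<lambda>r. k r b)"
          by (rule Lim_transform_eventually)
        then show ?thesis using 2 by (simp add: f_def)
      next
        case 3
        have "eventually (\<lambda>n. x n < b) sequentially" using lim 3 by (simp add: order_tendstoD)
        then have "eventually (\<lambda>n. 0 = f (x n) b) sequentially"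
          by eventually_elim (simp add: f_def)
        then have "(\<lambda>n. f (x n) b) \<longlonglongrightarrow> 0"
          by (rule Lim_transform_eventually[OF tendsto_const])
        then show ?thesis using 3 by (simp add: f_def)
      qed
    qed
  qed
  moreover have "hmean l k s = integral\<^sup>L lborel (f s)" for s
    unfolding hmean_def set_lebesgue_integral_def
    by (rule Bochner_Integration.integral_cong) (simp_all add: f_def)
  ultimately show "(hmean l k \<circ> x) \<longlonglongrightarrow> hmean l k a"
    by (simp add: o_def)
qed

end

context hyp_time begin

lemma slice_cont:
  assumes h: "continuous_on (U \<times> slab) (\<lambda>(x, r, b). h x r b)" and x: "x \<in> U"
  shows "continuous_on slab (\<lambda>(r, b). h x r b)"
proof -
  have "continuous_on slab (\<lambda>p. (\<lambda>(x, r, b). h x r b) (x, p))"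
    by (rule continuous_on_compose2[OF h]) (use x in \<open>auto intro!: continuous_intros\<close>)
  then show ?thesis by (simp add: case_prod_unfold)
qed

text \<open>On the compact slab a jointly continuous \<open>h\<close> depends on \<open>x\<close> uniformly in \<open>(r, b)\<close>; the bound for the
  transform carries this uniformity over.\<close>
lemma hmean_close:
  fixes h :: "'a::topological_space \<Rightarrow> real \<Rightarrow> real \<Rightarrow> complex"
  assumes h: "continuous_on (U \<times> slab) (\<lambda>(x, r, b). h x r b)" and x: "x0 \<in> U" and e: "e > 0"
  obtains X0 where "open X0" "x0 \<in> X0"
    "\<And>x r b. x \<in> X0 \<inter> U \<Longrightarrow> (r, b) \<in> slab \<Longrightarrow> norm (h x r b - h x0 r b) \<le> e"
    "\<And>x t. x \<in> X0 \<inter> U \<Longrightarrow> t \<in> {0..T} \<Longrightarrow> norm (hmean l (h x) t - hmean l (h x0) t) \<le> t * (t * e)"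
proof -
  obtain X0 where X0: "x0 \<in> X0" "open X0"
    "\<forall>x\<in>X0 \<inter> U. \<forall>p\<in>slab. dist ((\<lambda>(x, r, b). h x r b) (x, p)) ((\<lambda>(x, r, b). h x r b) (x0, p)) \<le> e"
    by (rule continuous_on_prod_compactE[OF h compact_slab x e])
  have le: "norm (h x r b - h x0 r b) \<le> e" if "x \<in> X0 \<inter> U" "(r, b) \<in> slab" for x r b
    using X0(3) that by (force simp: dist_norm)
  have "norm (hmean l (h x) t - hmean l (h x0) t) \<le> t * (t * e)" if "x \<in> X0 \<inter> U" "t \<in> {0..T}" for x t
  proof -
    have c: "continuous_on slab (\<lambda>(r, b). h x r b)" "continuous_on slab (\<lambda>(r, b). h x0 r b)"
      using that x by (auto intro: slice_cont[OF h])
    have "continuous_on slab (\<lambda>(r, b). h x r b - h x0 r b)"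
      using continuous_on_diff[OF c] by (simp add: case_prod_unfold)
    from hmean_bound[OF this, of t e] le that
    have "norm (hmean l (\<lambda>r b. h x r b - h x0 r b) t) \<le> t * (t * e)" by auto
    then show ?thesis using hmean_diff[OF c, of t] that by simp
  qed
  with X0 le that show thesis by blast
qed

theorem hmean_joint_cont:
  fixes h :: "'a::metric_space \<Rightarrow> real \<Rightarrow> real \<Rightarrow> complex"
  assumes h: "continuous_on (U \<times> slab) (\<lambda>(x, r, b). h x r b)"
  shows "continuous_on (U \<times> {0..T}) (\<lambda>(x, t). hmean l (h x) t)"
  unfolding continuous_on_sequentially
proof (intro allI ballI impI, elim conjE)
  fix p :: "nat \<Rightarrow> 'a \<times> real" and q assume q: "q \<in> U \<times> {0..T}" and p: "\<forall>n. p n \<in> U \<times> {0..T}" and lim: "p \<longlonglongrightarrow> q"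
  obtain x0 t0 where q': "q = (x0, t0)" by (cases q)
  have x0: "x0 \<in> U" and t0: "t0 \<in> {0..T}" using q q' by auto
  have pU: "fst (p n) \<in> U" "snd (p n) \<in> {0..T}" for n using p[rule_format, of n] by (auto simp: mem_Times_iff)
  have lx: "(\<lambda>n. fst (p n)) \<longlonglongrightarrow> x0" and lt: "(\<lambda>n. snd (p n)) \<longlonglongrightarrow> t0"
    using tendsto_fst[OF lim] tendsto_snd[OF lim] q' by auto
  have "(\<lambda>n. hmean l (h (fst (p n))) (snd (p n)) - hmean l (h x0) (snd (p n))) \<longlonglongrightarrow> 0"
  proof (rule tendstoI)
    fix e :: real assume e: "e > 0"
    define e' where "e' = e / (2 * (T * T))"
    have e': "e' > 0" using e T by (simp add: e'_def)
    obtain X0 where X0: "open X0" "x0 \<in> X0"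
      "\<And>x t. x \<in> X0 \<inter> U \<Longrightarrow> t \<in> {0..T} \<Longrightarrow> norm (hmean l (h x) t - hmean l (h x0) t) \<le> t * (t * e')"
      using hmean_close[OF h x0 e'] by metis
    have "eventually (\<lambda>n. fst (p n) \<in> X0) sequentially"
      by (rule topological_tendstoD[OF lx X0(1,2)])
    then show "eventually (\<lambda>n. dist (hmean l (h (fst (p n))) (snd (p n)) - hmean l (h x0) (snd (p n))) 0 < e) sequentially"
    proof eventually_elim
      case (elim n)
      have t: "0 \<le> snd (p n)" "snd (p n) \<le> T" using pU(2)[of n] by auto
      have "norm (hmean l (h (fst (p n))) (snd (p n)) - hmean l (h x0) (snd (p n))) \<le> snd (p n) * (snd (p n) * e')"
        using X0(3) elim pU by blast
      also have "\<dots> \<le> T * (T * e')" using t e' T by (intro mult_mono) auto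
      also have "\<dots> < e" using e T by (simp add: e'_def)
      finally show ?case by simp
    qed
  qed
  moreover have "(\<lambda>n. hmean l (h x0) (snd (p n))) \<longlonglongrightarrow> hmean l (h x0) t0"
    using continuous_on_tendsto_compose[OF continuous_on_hmean[OF slice_cont[OF h x0]] lt t0] pU(2)
    by simp
  ultimately have "(\<lambda>n. (hmean l (h (fst (p n))) (snd (p n)) - hmean l (h x0) (snd (p n)))
      + hmean l (h x0) (snd (p n))) \<longlonglongrightarrow> 0 + hmean l (h x0) t0"
    by (rule tendsto_add)
  then show "((\<lambda>(x, t). hmean l (h x) t) \<circ> p) \<longlonglongrightarrow> (\<lambda>(x, t). hmean l (h x) t) q"
    by (simp add: o_def case_prod_unfold q')
qed

text \<open>For \<open>l < 0\<close> the weight \<open>t\<^sup>l\<close> is unbounded at \<open>t = 0\<close>. The transform is of order \<open>t\<^sup>2\<close> locally uniformly in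
  \<open>x\<close>, so the product is \<open>O(t\<^bsup>l+2\<^esup>)\<close> and tends to \<open>0\<close>, which is also its value at \<open>t = 0\<close> in view of
  \<open>0 powr l = 0\<close>.\<close>
theorem source_joint_cont:
  fixes h :: "'a::metric_space \<Rightarrow> real \<Rightarrow> real \<Rightarrow> complex"
  assumes h: "continuous_on (U \<times> slab) (\<lambda>(x, r, b). h x r b)"
  shows "continuous_on (U \<times> {0..T}) (\<lambda>(x, t). t powr l *\<^sub>R hmean l (h x) t)"
  unfolding continuous_on_sequentially
proof (intro allI ballI impI, elim conjE)
  fix p :: "nat \<Rightarrow> 'a \<times> real" and q assume q: "q \<in> U \<times> {0..T}" and p: "\<forall>n. p n \<in> U \<times> {0..T}" and lim: "p \<longlonglongrightarrow> q"
  obtain x0 t0 where q': "q = (x0, t0)" by (cases q)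
  have x0: "x0 \<in> U" and t0: "t0 \<in> {0..T}" using q q' by auto
  have pU: "fst (p n) \<in> U" "snd (p n) \<in> {0..T}" for n using p[rule_format, of n] by (auto simp: mem_Times_iff)
  have lx: "(\<lambda>n. fst (p n)) \<longlonglongrightarrow> x0" and lt: "(\<lambda>n. snd (p n)) \<longlonglongrightarrow> t0"
    using tendsto_fst[OF lim] tendsto_snd[OF lim] q' by auto
  show "((\<lambda>(x, t). t powr l *\<^sub>R hmean l (h x) t) \<circ> p) \<longlonglongrightarrow> (\<lambda>(x, t). t powr l *\<^sub>R hmean l (h x) t) q"
  proof (cases "t0 = 0")
    case False
    have "(\<lambda>n. (\<lambda>(x, t). hmean l (h x) t) (p n)) \<longlonglongrightarrow> (\<lambda>(x, t). hmean l (h x) t) q"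
      by (rule continuous_on_tendsto_compose[OF hmean_joint_cont[OF h] lim q]) (use p in auto)
    then have "(\<lambda>n. hmean l (h (fst (p n))) (snd (p n))) \<longlonglongrightarrow> hmean l (h x0) t0"
      by (simp add: case_prod_unfold q')
    from tendsto_scaleR[OF tendsto_powr[OF lt tendsto_const[of l] False] this]
    show ?thesis by (simp add: o_def case_prod_unfold q')
  next
    case True
    obtain B where B: "0 \<le> B" "\<And>r b. (r, b) \<in> slab \<Longrightarrow> norm (h x0 r b) \<le> B"
      using bounded_on_slab[OF slice_cont[OF h x0]] by blast
    obtain X0 where X0: "open X0" "x0 \<in> X0"
      "\<And>x r b. x \<in> X0 \<inter> U \<Longrightarrow> (r, b) \<in> slab \<Longrightarrow> norm (h x r b - h x0 r b) \<le> 1"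
      using hmean_close[OF h x0 zero_less_one] by metis
    have "eventually (\<lambda>n. fst (p n) \<in> X0) sequentially"
      by (rule topological_tendstoD[OF lx X0(1,2)])
    then have le: "eventually (\<lambda>n. norm (snd (p n) powr l *\<^sub>R hmean l (h (fst (p n))) (snd (p n)))
        \<le> snd (p n) powr (l + 2) * (B + 1)) sequentially"
    proof eventually_elim
      case (elim n)
      define x t where "x = fst (p n)" and "t = snd (p n)"
      have t: "0 \<le> t" "t \<le> T" and x: "x \<in> X0 \<inter> U" using pU[of n] elim by (auto simp: x_def t_def)
      have le: "norm (h x r b) \<le> B + 1" if "(r, b) \<in> slab" for r b
        using norm_triangle_ineq[of "h x r b - h x0 r b" "h x0 r b"] X0(3)[OF x that] B(2)[OF that] by simp
      have "norm (t powr l *\<^sub>R hmean l (h x) t) \<le> t powr l * (t * (t * (B + 1)))"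
        using hmean_bound[OF slice_cont[OF h] t le] x by (auto intro!: mult_left_mono)
      also have "\<dots> = t powr (l + 2) * (B + 1)"
        using t by (cases "t = 0") (simp_all add: powr_add power2_eq_square)
      finally show ?case by (simp add: x_def t_def)
    qed
    have "(\<lambda>n. snd (p n) powr (l + 2)) \<longlonglongrightarrow> 0 powr (l + 2)"
      by (rule tendsto_powr'[OF lt[unfolded True] tendsto_const]) (use l pU in auto)
    then have "(\<lambda>n. snd (p n) powr (l + 2) * (B + 1)) \<longlonglongrightarrow> 0"
      by (auto intro: tendsto_mult_left_zero)
    from Lim_null_comparison[OF le this] show ?thesis
      by (simp add: o_def case_prod_unfold q' True)
  qed
qed

lemma continuous_on_source:
  assumes k: "continuous_on slab (\<lambda>(r, b). k r b)"
  shows "continuous_on {0..T} (\<lambda>s. s powr l *\<^sub>R hmean l k s)"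
proof -
  have "continuous_on ({0 :: real} \<times> slab) (\<lambda>x. (\<lambda>(r, b). k r b) (snd x))"
    by (rule continuous_on_compose2[OF k]) (auto intro!: continuous_intros)
  then have "continuous_on ({0 :: real} \<times> slab) (\<lambda>(x, r, b). k r b)"
    by (simp add: case_prod_unfold)
  from source_joint_cont[OF this]
  have c: "continuous_on ({0 :: real} \<times> {0..T}) (\<lambda>(x, t). t powr l *\<^sub>R hmean l k t)" .
  have "continuous_on {0..T} (\<lambda>s. (\<lambda>(x, t). t powr l *\<^sub>R hmean l k t) (0 :: real, s))"
    by (rule continuous_on_compose2[OF c]) (auto intro!: continuous_intros)
  then show ?thesis by simp
qed

text \<open>Integrate \<open>kmean_taylor\<close> over \<open>b\<close> and exchange the integrals over the triangle \<open>0 < b \<le> s \<le> t\<close>; the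
  inner integral over \<open>b\<close> is then the transform of \<open>k2\<close> at time \<open>s\<close>. Absolute integrability on the
  triangle comes from \<open>s\<^sup>l \<bar>K k2(s)\<bar> \<le> B s\<^bsup>l+1\<^esup>\<close>, whose integral over \<open>0 < b \<le> s\<close> is \<open>B s\<^bsup>l+2\<^esup>\<close>.\<close>
theorem hmean_duhamel:
  assumes k: "continuous_on slab (\<lambda>(r, b). k r b)" and k2: "continuous_on slab (\<lambda>(r, b). k2 r b)"
    and profile: "\<And>b. 0 < b \<Longrightarrow> b \<le> T \<Longrightarrow> C2_profile (\<lambda>r. k r b) (k1 b) (\<lambda>r. k2 r b) (phi l T)"
    and t: "0 \<le> t" "t \<le> T"
  shows "hmean l k t = integral {0..t} (\<lambda>s. (t - s) *\<^sub>R (k 0 s + s powr l *\<^sub>R hmean l k2 s))"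
proof -
  define g where "g s b = ((t - s) * s powr l) *\<^sub>R kmean l s b (\<lambda>r. k2 r b)" for s b
  define W where "W = {(s, b). 0 < b \<and> b \<le> s \<and> s \<le> t}"
  define H where "H = (\<lambda>(s, b). indicator W (s, b) *\<^sub>R g s b)"
  obtain B where B: "0 \<le> B" "\<And>r b. (r, b) \<in> slab \<Longrightarrow> norm (k2 r b) \<le> B"
    using bounded_on_slab[OF k2] by blast
  have "W = {x. 0 < snd x} \<inter> {x. snd x \<le> fst x} \<inter> {x. fst x \<le> t}"
    by (auto simp: W_def)
  also have "\<dots> \<in> sets borel"
    by (intro sets.Int borel_open borel_closed open_Collect_less closed_Collect_le continuous_intros)
  finally have W: "W \<in> sets borel" .
  have contg: "continuous_on W (\<lambda>(s, b). g s b)"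
    unfolding g_def case_prod_unfold
  proof (intro continuous_on_scaleR continuous_on_mult continuous_on_diff continuous_on_const continuous_on_powr
      continuous_on_fst continuous_on_id)
    show "\<forall>x\<in>W. fst x \<noteq> 0" by (auto simp: W_def)
    have "continuous_on W (\<lambda>x. (\<lambda>(s, b). kmean l s b (\<lambda>r. k2 r b)) x)"
      by (rule continuous_on_subset[OF kmean_cont[OF k2]]) (use t in \<open>auto simp: W_def\<close>)
    then show "continuous_on W (\<lambda>x. kmean l (fst x) (snd x) (\<lambda>r. k2 r (snd x)))"
      by (simp add: case_prod_unfold)
  qed
  have Hm: "H \<in> borel_measurable (lborel \<Otimes>\<^sub>M lborel)"
    using borel_measurable_continuous_on_indicator[OF W contg]
    by (simp add: H_def case_prod_unfold lborel_prod)
  have Hle: "norm (H (s, b)) \<le> indicator {0<..s} b *\<^sub>R (t * (s powr (l + 1) * B))" for s b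
  proof (cases "(s, b) \<in> W")
    case True
    then have s: "0 < s" "s \<le> t" "0 < b" "b \<le> s" by (auto simp: W_def)
    have "norm (H (s, b)) = (t - s) * s powr l * norm (kmean l s b (\<lambda>r. k2 r b))"
      using True s by (simp add: H_def g_def)
    also have "\<dots> \<le> t * s powr l * (s * B)"
      using s t kmean_le[OF k2 B(2) s(3,4)] by (intro mult_mono) auto
    also have "\<dots> = t * (s powr (l + 1) * B)" using s by (simp add: powr_add)
    finally show ?thesis using s by simp
  qed (use t B in \<open>auto simp: H_def indicator_def\<close>)
  have Hs: "(\<lambda>b. H (s, b)) = (\<lambda>b. indicator {0<..s} b *\<^sub>R (indicator {..t} s *\<^sub>R g s b))" for s
    by (auto simp: H_def W_def indicator_def)
  have Hi: "integrable lborel (\<lambda>b. H (s, b))" for s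
  proof (cases "0 < s \<and> s \<le> t")
    case True
    have "set_integrable lborel {0<..s} (\<lambda>b. g s b)"
      unfolding g_def using True t by (intro set_integrable_scaleR_right hmean_integrable k2) auto
    then show ?thesis using True unfolding Hs set_integrable_def by simp
  next
    case False
    then have "(\<lambda>b. H (s, b)) = (\<lambda>b. 0)" by (auto simp: H_def W_def)
    then show ?thesis by simp
  qed
  have Hint: "(\<integral>b. H (s, b) \<partial>lborel) = indicator {0<..t} s *\<^sub>R (((t - s) * s powr l) *\<^sub>R hmean l k2 s)" for s
  proof (cases "0 < s \<and> s \<le> t")
    case True
    then have "(\<integral>b. H (s, b) \<partial>lborel) = (LINT b:{0<..s}|lborel. g s b)"
      unfolding Hs by (simp add: set_lebesgue_integral_def)
    then show ?thesis using True by (simp add: g_def hmean_def)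
  next
    case False
    then have "(\<lambda>b. H (s, b)) = (\<lambda>b. 0)" by (auto simp: H_def W_def)
    then show ?thesis using False by (auto simp: indicator_def)
  qed
  have HI: "integrable (lborel \<Otimes>\<^sub>M lborel) H"
  proof (rule lborel_pair.Fubini_integrable[OF Hm])
    show "AE s in lborel. integrable lborel (\<lambda>b. H (s, b))" using Hi by simp
    have meas: "(\<lambda>s. \<integral>b. norm (H (s, b)) \<partial>lborel) \<in> borel_measurable lborel"
    proof -
      have "(\<lambda>p. norm (H p)) \<in> borel_measurable (lborel \<Otimes>\<^sub>M lborel)" using Hm by measurable
      then have "(\<lambda>(s, b). norm (H (s, b))) \<in> borel_measurable (lborel \<Otimes>\<^sub>M lborel)" by simp
      from lborel.borel_measurable_lebesgue_integral[OF this] show ?thesis .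
    qed
    show "integrable lborel (\<lambda>s. \<integral>b. norm (H (s, b)) \<partial>lborel)"
    proof (rule Bochner_Integration.integrable_bound[OF _ meas])
      show "integrable lborel (\<lambda>s. indicator {0..t} s *\<^sub>R (t * (t powr (l + 2) * B)))"
        by (intro integrable_scaleR_left integrable_indicator) (use t in simp_all)
      have "norm (\<integral>b. norm (H (s, b)) \<partial>lborel) \<le> indicator {0..t} s *\<^sub>R (t * (t powr (l + 2) * B))" for s
      proof (cases "0 < s \<and> s \<le> t")
        case True
        have "(\<integral>b. norm (H (s, b)) \<partial>lborel) \<le> (\<integral>b. indicator {0<..s} b *\<^sub>R (t * (s powr (l + 1) * B)) \<partial>lborel)"
          by (intro integral_mono integrable_norm Hi Hle integrable_scaleR_left integrable_indicator)
            (use True in simp_all)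
        also have "\<dots> = t * (s powr (l + 2) * B)"
          using True powr_add[of s 1 "l + 1"] by (simp add: algebra_simps)
        also have "\<dots> \<le> t * (t powr (l + 2) * B)"
          using True t B l by (intro mult_left_mono mult_right_mono powr_mono2) auto
        finally show ?thesis using True by simp
      next
        case False
        then have "H (s, b) = 0" for b by (auto simp: H_def W_def)
        then show ?thesis using t B by simp
      qed
      then show "AE s in lborel. norm (\<integral>b. norm (H (s, b)) \<partial>lborel)
          \<le> norm (indicator {0..t} s *\<^sub>R (t * (t powr (l + 2) * B)))"
        by (intro AE_I2) (metis abs_ge_self order_trans real_norm_def)
    qed
  qed
  have k0: "continuous_on {0..T} (\<lambda>s. k 0 s)"
  proof -
    have "continuous_on {0..T} (\<lambda>s. (\<lambda>(r, b). k r b) (0, s))"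
      by (rule continuous_on_compose2[OF k])
        (use phi_pos[OF l T] in \<open>auto simp: slab_def intro!: continuous_intros\<close>)
    then show ?thesis by simp
  qed
  have "kmean l t b (\<lambda>r. k r b) = (t - b) *\<^sub>R k 0 b + (\<integral>s. H (s, b) \<partial>lborel)" if b: "0 < b" "b \<le> t" for b
  proof -
    interpret P: C2_profile "\<lambda>r. k r b" "k1 b" "\<lambda>r. k2 r b" "phi l T"
      using profile b t by simp
    have "continuous_on {b..t} (\<lambda>s. g s b)"
      unfolding g_def using b t
      by (intro continuous_on_scaleR continuous_intros kmean_cont_s[OF k2]) auto
    then have i: "set_integrable lborel {b..t} (\<lambda>s. g s b)"
      by (rule borel_integrable_atLeastAtMost')
    have "(\<lambda>s. H (s, b)) = (\<lambda>s. indicator {b..t} s *\<^sub>R g s b)"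
      using b by (auto simp: H_def W_def indicator_def)
    then have "(\<integral>s. H (s, b) \<partial>lborel) = (LINT s:{b..t}|lborel. g s b)"
      by (simp add: set_lebesgue_integral_def)
    also have "\<dots> = integral {b..t} (\<lambda>s. g s b)"
      by (rule set_borel_integral_eq_integral(2)[OF i])
    also have "\<dots> = kmean l t b (\<lambda>r. k r b) - (t - b) *\<^sub>R k 0 b"
      unfolding g_def by (rule integral_unique) (rule P.kmean_taylor[OF l refl b t(2)])
    finally show ?thesis by simp
  qed
  then have "hmean l k t = (LINT b:{0<..t}|lborel. (t - b) *\<^sub>R k 0 b + (\<integral>s. H (s, b) \<partial>lborel))"
    unfolding hmean_def by (intro set_lebesgue_integral_cong) auto
  also have "\<dots> = (\<integral>b. indicator {0<..t} b *\<^sub>R ((t - b) *\<^sub>R k 0 b) + (\<integral>s. H (s, b) \<partial>lborel) \<partial>lborel)"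
  proof -
    have "(\<integral>s. H (s, b) \<partial>lborel) = 0" if "b \<notin> {0<..t}" for b
    proof -
      have "(\<lambda>s. H (s, b)) = (\<lambda>s. 0)" using that by (auto simp: H_def W_def)
      then show ?thesis by simp
    qed
    then have "indicator {0<..t} b *\<^sub>R ((t - b) *\<^sub>R k 0 b + (\<integral>s. H (s, b) \<partial>lborel))
      = indicator {0<..t} b *\<^sub>R ((t - b) *\<^sub>R k 0 b) + (\<integral>s. H (s, b) \<partial>lborel)" for b
      by (cases "b \<in> {0<..t}") simp_all
    then show ?thesis unfolding set_lebesgue_integral_def by simp
  qed
  also have "\<dots> = (LINT b:{0<..t}|lborel. (t - b) *\<^sub>R k 0 b) + (\<integral>b. (\<integral>s. H (s, b) \<partial>lborel) \<partial>lborel)"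
  proof -
    have "set_integrable lborel {0<..t} (\<lambda>b. (t - b) *\<^sub>R k 0 b)"
      unfolding LINT_Ioc_Icc(2) using t
      by (intro borel_integrable_atLeastAtMost' continuous_intros continuous_on_subset[OF k0]) auto
    moreover have "integrable lborel (\<lambda>b. \<integral>s. H (s, b) \<partial>lborel)"
      using lborel_pair.integrable_snd[of "\<lambda>s b. H (s, b)"] HI by simp
    ultimately show ?thesis
      unfolding set_lebesgue_integral_def set_integrable_def by (rule Bochner_Integration.integral_add)
  qed
  also have "(\<integral>b. (\<integral>s. H (s, b) \<partial>lborel) \<partial>lborel) = (\<integral>s. (\<integral>b. H (s, b) \<partial>lborel) \<partial>lborel)"
    using lborel_pair.Fubini_integral[of "\<lambda>s b. H (s, b)"] HI by simp
  also have "\<dots> = (LINT s:{0<..t}|lborel. (t - s) *\<^sub>R (s powr l *\<^sub>R hmean l k2 s))"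
    unfolding Hint set_lebesgue_integral_def by simp
  also have "(LINT b:{0<..t}|lborel. (t - b) *\<^sub>R k 0 b) + \<dots>
      = integral {0..t} (\<lambda>s. (t - s) *\<^sub>R k 0 s) + integral {0..t} (\<lambda>s. (t - s) *\<^sub>R (s powr l *\<^sub>R hmean l k2 s))"
    unfolding LINT_Ioc_Icc(1) using t
    by (intro arg_cong2[where f = "(+)"] set_borel_integral_eq_integral borel_integrable_atLeastAtMost'
        continuous_intros continuous_on_subset[OF k0] continuous_on_subset[OF continuous_on_source[OF k2]]) auto
  also have "\<dots> = integral {0..t} (\<lambda>s. (t - s) *\<^sub>R k 0 s + (t - s) *\<^sub>R (s powr l *\<^sub>R hmean l k2 s))"
    using t
    by (intro integral_add[symmetric] integrable_continuous_real
        continuous_intros continuous_on_subset[OF k0] continuous_on_subset[OF continuous_on_source[OF k2]]) auto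
  finally show ?thesis by (simp add: scaleR_add_right)
qed

end

section \<open>Dependence of the transform on time and space\<close>

lemma double_primitive_deriv:
  fixes J :: "real \<Rightarrow> complex"
  assumes J: "continuous_on {0..T} J" and t: "t \<in> {0..T}"
  shows "((\<lambda>t. integral {0..t} (\<lambda>s. (t - s) *\<^sub>R J s)) has_vector_derivative integral {0..t} J) (at t within {0..T})"
proof -
  have split: "integral {0..t} (\<lambda>s. (t - s) *\<^sub>R J s)
      = t *\<^sub>R integral {0..t} J - integral {0..t} (\<lambda>s. s *\<^sub>R J s)" if "t \<in> {0..T}" for t
  proof -
    have c: "continuous_on {0..t} J" using that by (intro continuous_on_subset[OF J]) auto
    have "integral {0..t} (\<lambda>s. (t - s) *\<^sub>R J s) = integral {0..t} (\<lambda>s. t *\<^sub>R J s - s *\<^sub>R J s)"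
      by (simp add: scaleR_diff_left)
    also have "\<dots> = integral {0..t} (\<lambda>s. t *\<^sub>R J s) - integral {0..t} (\<lambda>s. s *\<^sub>R J s)"
      by (intro integral_diff integrable_continuous_real continuous_intros c)
    finally show ?thesis by simp
  qed
  have d1: "((\<lambda>t. integral {0..t} J) has_vector_derivative J t) (at t within {0..T})"
    by (rule integral_has_vector_derivative[OF J t])
  have d2: "((\<lambda>t. integral {0..t} (\<lambda>s. s *\<^sub>R J s)) has_vector_derivative t *\<^sub>R J t) (at t within {0..T})"
    by (rule integral_has_vector_derivative[OF _ t]) (intro continuous_intros J)
  have "((\<lambda>t. t *\<^sub>R integral {0..t} J - integral {0..t} (\<lambda>s. s *\<^sub>R J s)) has_vector_derivative
      (t *\<^sub>R J t + 1 *\<^sub>R integral {0..t} J) - t *\<^sub>R J t) (at t within {0..T})"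
    by (intro has_vector_derivative_diff has_vector_derivative_scaleR d1 d2 DERIV_ident)
  then have "((\<lambda>t. t *\<^sub>R integral {0..t} J - integral {0..t} (\<lambda>s. s *\<^sub>R J s)) has_vector_derivative
      integral {0..t} J) (at t within {0..T})" by simp
  then show ?thesis
    by (rule has_vector_derivative_transform[OF t split, rotated])
qed

context hyp_time begin

lemma inner_integral_kmean:
  fixes w :: "real^'n \<Rightarrow> real \<Rightarrow> real \<Rightarrow> complex"
  assumes w: "continuous_on slab (\<lambda>(r, b). w x r b)" and b: "0 < b" "b \<le> t" "t \<le> T"
  shows "set_integrable lborel {0..\<bar>phi l t - phi l b\<bar>} (\<lambda>r. complex_of_real (kernel l t b r) * w x r b)"
    and "c_const l *\<^sub>R inner_integral l w x t b = kmean l t b (\<lambda>r. w x r b)"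
proof -
  have abs: "\<bar>phi l t - phi l b\<bar> = phi l t - phi l b" using phi_mono[OF l, of b t] b by simp
  show i: "set_integrable lborel {0..\<bar>phi l t - phi l b\<bar>} (\<lambda>r. complex_of_real (kernel l t b r) * w x r b)"
    unfolding abs scaleR_conv_of_real[symmetric]
    by (rule borel_integrable_atLeastAtMost'[OF kernel_profile_integrable[OF w b]])
  show "c_const l *\<^sub>R inner_integral l w x t b = kmean l t b (\<lambda>r. w x r b)"
    using set_borel_integral_eq_integral(2)[OF i]
    by (simp add: inner_integral_def kmean_def abs scaleR_conv_of_real)
qed

lemma transform_hmean:
  fixes w :: "real^'n \<Rightarrow> real \<Rightarrow> real \<Rightarrow> complex"
  assumes w: "continuous_on slab (\<lambda>(r, b). w x r b)" and t: "0 \<le> t" "t \<le> T"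
  shows "transform_converges l w (x, t)" "transform l w (x, t) = hmean l (w x) t"
proof -
  have c: "c_const l \<noteq> 0" using c_const_pos[OF l] by simp
  have "set_integrable lborel {0<..t} (\<lambda>b. c_const l *\<^sub>R inner_integral l w x t b)
    \<longleftrightarrow> set_integrable lborel {0<..t} (\<lambda>b. kmean l t b (\<lambda>r. w x r b))"
    by (rule set_integrable_cong) (use inner_integral_kmean(2)[where w=w, OF w] t in auto)
  then have "set_integrable lborel {0<..t} (\<lambda>b. c_const l *\<^sub>R inner_integral l w x t b)"
    using hmean_integrable[OF w t] by simp
  from set_integrable_scaleR_right[OF this, of "inverse (c_const l)"]
  have "set_integrable lborel {0<..t} (inner_integral l w x t)" using c by simp
  then show "transform_converges l w (x, t)"
    unfolding transform_converges_def LINT_Ioc_Icc(2)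
    using inner_integral_kmean(1)[where w=w, OF w] t by auto
  have "transform l w (x, t) = (LINT b:{0<..t}|lborel. c_const l *\<^sub>R inner_integral l w x t b)"
    by (simp add: transform_def LINT_Ioc_Icc(1) scaleR_conv_of_real)
  also have "\<dots> = hmean l (w x) t"
    unfolding hmean_def
    by (rule set_lebesgue_integral_cong) (use inner_integral_kmean(2)[where w=w, OF w] t in auto)
  finally show "transform l w (x, t) = hmean l (w x) t" .
qed

text \<open>By the mean value theorem the difference quotients of \<open>h\<close> in the direction \<open>v\<close> converge to \<open>h'\<close>
  uniformly on the compact slab. A bounded linear functional preserves this convergence.\<close>
theorem hmean_dir_deriv:
  fixes h h' :: "'a::real_normed_vector \<Rightarrow> real \<Rightarrow> real \<Rightarrow> complex"
  assumes U: "open U" and h: "continuous_on (U \<times> slab) (\<lambda>(x, r, b). h x r b)"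
    and h': "continuous_on (U \<times> slab) (\<lambda>(x, r, b). h' x r b)"
    and deriv: "\<And>x r b. x \<in> U \<Longrightarrow> (r, b) \<in> slab \<Longrightarrow>
        ((\<lambda>s. h (x + s *\<^sub>R v) r b) has_vector_derivative h' x r b) (at 0)"
    and x: "x \<in> U" and t: "t \<in> {0..T}"
  shows "((\<lambda>s. hmean l (h (x + s *\<^sub>R v)) t) has_vector_derivative hmean l (h' x) t) (at 0)"
  unfolding has_vector_derivative_def has_derivative_at_alt
proof (intro conjI allI impI bounded_linear_scaleR_left)
  fix e :: real assume e: "e > 0"
  define e' where "e' = e / (T * T)"
  have e': "e' > 0" using e T by (simp add: e'_def)
  obtain X0 where X0: "open X0" "x \<in> X0"
    "\<And>y r b. y \<in> X0 \<inter> U \<Longrightarrow> (r, b) \<in> slab \<Longrightarrow> norm (h' y r b - h' x r b) \<le> e'"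
    using hmean_close[OF h' x e'] by metis
  have "open ((\<lambda>s. x + s *\<^sub>R v) -` (X0 \<inter> U))"
    by (intro open_vimage open_Int X0 U continuous_intros)
  moreover have "0 \<in> (\<lambda>s. x + s *\<^sub>R v) -` (X0 \<inter> U)" using X0 x by simp
  ultimately obtain d where d: "d > 0" "ball 0 d \<subseteq> (\<lambda>s. x + s *\<^sub>R v) -` (X0 \<inter> U)"
    using openE by blast
  show "\<exists>d>0. \<forall>s. norm (s - 0) < d \<longrightarrow> norm (hmean l (h (x + s *\<^sub>R v)) t - hmean l (h (x + 0 *\<^sub>R v)) t
      - (s - 0) *\<^sub>R hmean l (h' x) t) \<le> e * norm (s - 0)"
  proof (intro exI[of _ d] conjI allI impI d(1))
    fix s :: real assume "norm (s - 0) < d"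
    then have s: "s \<in> ball 0 d" by simp
    have inU: "x + \<sigma> *\<^sub>R v \<in> X0 \<inter> U" if "\<sigma> \<in> ball 0 d" for \<sigma> using d(2) that by auto
    have lin: "norm (h (x + s *\<^sub>R v) r b - h x r b - complex_of_real s * h' x r b) \<le> \<bar>s\<bar> * e'"
      if rb: "(r, b) \<in> slab" for r b
    proof -
      have "norm (h (x + s *\<^sub>R v) r b - h (x + 0 *\<^sub>R v) r b - (s - 0) *\<^sub>R h' (x + 0 *\<^sub>R v) r b) \<le> norm (s - 0) * e'"
      proof (rule vector_differentiable_bound_linearization[where S = "ball 0 d" and f' = "\<lambda>\<sigma>. h' (x + \<sigma> *\<^sub>R v) r b"])
        fix \<sigma> assume \<sigma>: "\<sigma> \<in> ball (0::real) d"
        have "((\<lambda>s. h (x + \<sigma> *\<^sub>R v + s *\<^sub>R v) r b) has_vector_derivative h' (x + \<sigma> *\<^sub>R v) r b) (at (\<sigma> - \<sigma>))"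
          using deriv[of "x + \<sigma> *\<^sub>R v"] inU[OF \<sigma>] rb by simp
        moreover have "((\<lambda>s. s - \<sigma>) has_vector_derivative 1) (at \<sigma>)"
          by (auto intro!: derivative_eq_intros)
        ultimately have "((\<lambda>s. h (x + \<sigma> *\<^sub>R v + (s - \<sigma>) *\<^sub>R v) r b) has_vector_derivative 1 *\<^sub>R h' (x + \<sigma> *\<^sub>R v) r b) (at \<sigma>)"
          using vector_diff_chain_at[of "\<lambda>s. s - \<sigma>" 1 \<sigma>] by (fastforce simp: o_def)
        moreover have "x + \<sigma> *\<^sub>R v + (s - \<sigma>) *\<^sub>R v = x + s *\<^sub>R v" for s
          by (simp add: algebra_simps)
        ultimately show "((\<lambda>s. h (x + s *\<^sub>R v) r b) has_vector_derivative h' (x + \<sigma> *\<^sub>R v) r b) (at \<sigma> within ball 0 d)"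
          by (simp add: has_vector_derivative_at_within)
        show "norm (h' (x + \<sigma> *\<^sub>R v) r b - h' (x + 0 *\<^sub>R v) r b) \<le> e'"
          using X0(3)[OF inU[OF \<sigma>] rb] by simp
      next
        show "closed_segment 0 s \<subseteq> ball 0 d"
          by (intro closed_segment_subset s convex_ball) (use d in auto)
      qed (use d in auto)
      then show ?thesis by (simp add: scaleR_conv_of_real)
    qed
    have xs: "x + s *\<^sub>R v \<in> U" using inU[OF s] by simp
    have c: "continuous_on slab (\<lambda>(r, b). h (x + s *\<^sub>R v) r b)" "continuous_on slab (\<lambda>(r, b). h x r b)"
      "continuous_on slab (\<lambda>(r, b). h' x r b)"
      using x xs by (auto intro: slice_cont[OF h] slice_cont[OF h'])
    have c1: "continuous_on slab (\<lambda>(r, b). h (x + s *\<^sub>R v) r b - h x r b)"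
      using continuous_on_diff[OF c(1,2)] by (simp add: case_prod_unfold)
    have c2: "continuous_on slab (\<lambda>(r, b). complex_of_real s * h' x r b)"
      using continuous_on_mult_left[OF c(3)] by (simp add: case_prod_unfold)
    have c3: "continuous_on slab (\<lambda>(r, b). h (x + s *\<^sub>R v) r b - h x r b - complex_of_real s * h' x r b)"
      using continuous_on_diff[OF c1 c2] by (simp add: case_prod_unfold)
    have t': "0 \<le> t" "t \<le> T" using t by auto
    have "hmean l (h (x + s *\<^sub>R v)) t - hmean l (h x) t - complex_of_real s * hmean l (h' x) t
      = hmean l (\<lambda>r b. h (x + s *\<^sub>R v) r b - h x r b - complex_of_real s * h' x r b) t"
      using hmean_diff[OF c1 c2 t'] hmean_diff[OF c(1,2) t'] hmean_cmult[OF c(3) t'] by simp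
    also have "norm \<dots> \<le> t * (t * (\<bar>s\<bar> * e'))"
      by (rule hmean_bound[OF c3 t' lin])
    also have "\<dots> \<le> T * (T * (\<bar>s\<bar> * e'))"
      using t' e' T by (intro mult_mono) auto
    also have "\<dots> = e * \<bar>s\<bar>" using T by (simp add: e'_def)
    finally show "norm (hmean l (h (x + s *\<^sub>R v)) t - hmean l (h (x + 0 *\<^sub>R v)) t
      - (s - 0) *\<^sub>R hmean l (h' x) t) \<le> e * norm (s - 0)"
      by (simp add: scaleR_conv_of_real)
  qed
qed

end

section \<open>Iterated directional derivatives\<close>

text \<open>\<open>Ck_on\<close> with the coordinate directions replaced by an arbitrary set \<open>B\<close> of directions. The solution
  has different regularity in space and in time, so the two groups of directions are treated
  separately.\<close>
definition Ck_dir :: "'a::real_normed_vector set \<Rightarrow> nat \<Rightarrow> 'a set \<Rightarrow> ('a \<Rightarrow> 'b::real_normed_vector) \<Rightarrow> bool" where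
  "Ck_dir B k S g \<longleftrightarrow>
     (\<forall>vs. set vs \<subseteq> B \<longrightarrow> length vs \<le> k \<longrightarrow> continuous_on S (dir_derivs vs g)) \<and>
     (\<forall>vs. set vs \<subseteq> B \<longrightarrow> length vs < k \<longrightarrow>
        (\<forall>v\<in>B. \<forall>p\<in>S. (\<lambda>s. dir_derivs vs g (p + s *\<^sub>R v)) differentiable (at 0)))"

lemma Ck_on_eq_Ck_dir: "Ck_on k S g = Ck_dir Basis k S g"
  by (simp add: Ck_on_def Ck_dir_def)

lemma Ck_dir_mono: "Ck_dir B k S g \<Longrightarrow> B' \<subseteq> B \<Longrightarrow> k' \<le> k \<Longrightarrow> S' \<subseteq> S \<Longrightarrow> Ck_dir B' k' S' g"
  unfolding Ck_dir_def
  by (intro conjI allI impI ballI)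
    (meson continuous_on_subset le_trans subset_trans, meson less_le_trans subset_trans subsetD)

lemma dir_derivs_append: "dir_derivs (vs @ ws) g = dir_derivs vs (dir_derivs ws g)"
  by (induction vs) simp_all

lemma Ck_dir_derivs:
  assumes "Ck_dir B (length vs + k) S g" "set vs \<subseteq> B"
  shows "Ck_dir B k S (dir_derivs vs g)"
  using assms unfolding Ck_dir_def dir_derivs_append[symmetric] by simp

lemma dir_deriv_has:
  "(\<lambda>s. g (p + s *\<^sub>R v)) differentiable (at 0) \<Longrightarrow>
     ((\<lambda>s. g (p + s *\<^sub>R v)) has_vector_derivative dir_deriv v g p) (at 0)"
  unfolding dir_deriv_def by (simp add: vector_derivative_works)

lemma dir_deriv_eqI:
  "((\<lambda>s. g (p + s *\<^sub>R v)) has_vector_derivative d) (at 0) \<Longrightarrow> dir_deriv v g p = d"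
  unfolding dir_deriv_def by (rule vector_derivative_at)

lemma eventually_line_in_open:
  fixes p v :: "'a::real_normed_vector"
  assumes "open S" "p \<in> S"
  shows "eventually (\<lambda>s. p + s *\<^sub>R v \<in> S) (nhds (0::real))"
proof -
  have "open ((\<lambda>s::real. p + s *\<^sub>R v) -` S)"
    by (intro open_vimage assms continuous_intros)
  then show ?thesis
    using assms eventually_nhds_in_open[of "(\<lambda>s::real. p + s *\<^sub>R v) -` S" 0] by simp
qed

lemma line_derivative_cong:
  fixes g h :: "'a::real_normed_vector \<Rightarrow> 'b::real_normed_vector"
  assumes "open S" "p \<in> S" "\<And>q. q \<in> S \<Longrightarrow> g q = h q"
  shows "((\<lambda>s. g (p + s *\<^sub>R v)) has_vector_derivative d) (at 0)
     \<longleftrightarrow> ((\<lambda>s. h (p + s *\<^sub>R v)) has_vector_derivative d) (at 0)"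
  by (rule has_vector_derivative_cong_ev)
    (use assms eventually_mono[OF eventually_line_in_open[OF assms(1,2), of v]] in auto)

lemma dir_deriv_cong:
  fixes g h :: "'a::real_normed_vector \<Rightarrow> 'b::real_normed_vector"
  assumes "open S" "p \<in> S" "\<And>q. q \<in> S \<Longrightarrow> g q = h q"
  shows "dir_deriv v g p = dir_deriv v h p"
  unfolding dir_deriv_def vector_derivative_def
  by (rule arg_cong[where f = Eps], rule ext) (rule line_derivative_cong[OF assms])

lemma dir_derivs_cong:
  fixes g h :: "'a::real_normed_vector \<Rightarrow> 'b::real_normed_vector"
  assumes "open S" "\<And>q. q \<in> S \<Longrightarrow> g q = h q" "p \<in> S"
  shows "dir_derivs vs g p = dir_derivs vs h p"
  using assms(3)
proof (induction vs arbitrary: p)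
  case (Cons v vs)
  show ?case
    unfolding dir_derivs.simps by (rule dir_deriv_cong[OF assms(1) Cons.prems Cons.IH])
qed (use assms in simp)

lemma line_differentiable_cong:
  fixes g h :: "'a::real_normed_vector \<Rightarrow> 'b::real_normed_vector"
  assumes "open S" "p \<in> S" "\<And>q. q \<in> S \<Longrightarrow> g q = h q"
  shows "(\<lambda>s. g (p + s *\<^sub>R v)) differentiable (at 0) \<longleftrightarrow> (\<lambda>s. h (p + s *\<^sub>R v)) differentiable (at (0::real))"
proof -
  have iff: "f differentiable (at 0) \<longleftrightarrow> (\<exists>d. (f has_vector_derivative d) (at 0))" for f :: "real \<Rightarrow> 'b"
    using vector_derivative_works[of f "at 0"] differentiableI_vector[of f _ "at 0"] by blast
  have "((\<lambda>s. g (p + s *\<^sub>R v)) has_vector_derivative d) (at 0)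
     \<longleftrightarrow> ((\<lambda>s. h (p + s *\<^sub>R v)) has_vector_derivative d) (at 0)" for d
    by (rule line_derivative_cong[OF assms(1,2)]) (rule assms(3))
  then show ?thesis unfolding iff by simp
qed

lemma Ck_dir_cong:
  assumes "open S" "\<And>q. q \<in> S \<Longrightarrow> g q = h q"
  shows "Ck_dir B k S g \<longleftrightarrow> Ck_dir B k S h"
proof -
  have e: "dir_derivs vs g q = dir_derivs vs h q" if "q \<in> S" for vs q
    by (rule dir_derivs_cong[OF assms that])
  have "continuous_on S (dir_derivs vs g) \<longleftrightarrow> continuous_on S (dir_derivs vs h)" for vs
    by (rule continuous_on_cong) (use e in auto)
  moreover have "(\<lambda>s. dir_derivs vs g (p + s *\<^sub>R v)) differentiable (at 0) \<longleftrightarrow>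
     (\<lambda>s. dir_derivs vs h (p + s *\<^sub>R v)) differentiable (at 0)" if "p \<in> S" for vs v p
    by (rule line_differentiable_cong[OF assms(1) that e])
  ultimately show ?thesis unfolding Ck_dir_def by simp
qed

lemma Ck_dir_0: "Ck_dir B 0 S g \<longleftrightarrow> continuous_on S g"
  by (simp add: Ck_dir_def)

text \<open>The definition adds derivatives at the head of the word, outermost; splitting off the last
  letter instead, the innermost derivative, gives the recursion on which inductions rest.\<close>
lemma Ck_dir_Suc:
  "Ck_dir B (Suc k) S g \<longleftrightarrow> continuous_on S g
     \<and> (\<forall>v\<in>B. \<forall>p\<in>S. (\<lambda>s. g (p + s *\<^sub>R v)) differentiable (at 0))
     \<and> (\<forall>v\<in>B. Ck_dir B k S (dir_deriv v g))" (is "?L \<longleftrightarrow> ?R")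
proof
  assume L: ?L
  have "continuous_on S (dir_derivs [] g)"
    "\<forall>v\<in>B. \<forall>p\<in>S. (\<lambda>s. dir_derivs [] g (p + s *\<^sub>R v)) differentiable (at 0)"
    using L unfolding Ck_dir_def by (metis bot_least le0 list.set(1) list.size(3) zero_less_Suc)+
  moreover have "Ck_dir B k S (dir_derivs [v] g)" if "v \<in> B" for v
    by (rule Ck_dir_derivs) (use L that in simp_all)
  ultimately show ?R by simp
next
  assume R: ?R
  show ?L
    unfolding Ck_dir_def
  proof (intro conjI allI impI)
    fix vs assume vs: "set vs \<subseteq> B" "length vs \<le> Suc k"
    show "continuous_on S (dir_derivs vs g)"
    proof (cases vs rule: rev_cases)
      case (snoc ws v)
      then show ?thesis using R vs by (simp add: dir_derivs_append Ck_dir_def)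
    qed (use R in simp)
  next
    fix vs assume vs: "set vs \<subseteq> B" "length vs < Suc k"
    show "\<forall>v\<in>B. \<forall>p\<in>S. (\<lambda>s. dir_derivs vs g (p + s *\<^sub>R v)) differentiable (at 0)"
    proof (cases vs rule: rev_cases)
      case (snoc ws v)
      then show ?thesis using R vs by (simp add: dir_derivs_append Ck_dir_def)
    qed (use R in simp)
  qed
qed

lemma Ck_dir_SucI:
  assumes S: "open S" and c: "continuous_on S g"
    and d: "\<And>v p. v \<in> B \<Longrightarrow> p \<in> S \<Longrightarrow> ((\<lambda>s. g (p + s *\<^sub>R v)) has_vector_derivative g' v p) (at 0)"
    and g': "\<And>v. v \<in> B \<Longrightarrow> Ck_dir B k S (g' v)"
  shows "Ck_dir B (Suc k) S g"
  unfolding Ck_dir_Suc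
proof (intro conjI ballI c)
  show "(\<lambda>s. g (p + s *\<^sub>R v)) differentiable (at 0)" if "v \<in> B" "p \<in> S" for v p
    using d[OF that] by (rule differentiableI_vector)
  show "Ck_dir B k S (dir_deriv v g)" if v: "v \<in> B" for v
  proof -
    have "dir_deriv v g q = g' v q" if "q \<in> S" for q
      by (rule dir_deriv_eqI[OF d[OF v that]])
    then have "Ck_dir B k S (dir_deriv v g) \<longleftrightarrow> Ck_dir B k S (g' v)"
      by (intro Ck_dir_cong S)
    then show ?thesis using g'[OF v] by simp
  qed
qed

lemma Ck_dir_SucD:
  assumes "Ck_dir B (Suc k) S g"
  shows "continuous_on S g"
    and "\<And>v p. v \<in> B \<Longrightarrow> p \<in> S \<Longrightarrow> ((\<lambda>s. g (p + s *\<^sub>R v)) has_vector_derivative dir_deriv v g p) (at 0)"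
    and "\<And>v. v \<in> B \<Longrightarrow> Ck_dir B k S (dir_deriv v g)"
  using assms unfolding Ck_dir_Suc by (auto intro: dir_deriv_has)

lemma Ck_dir_zero: "open S \<Longrightarrow> Ck_dir B k S (\<lambda>_. 0 :: 'b::real_normed_vector)"
proof (induction k)
  case (Suc k)
  then show ?case by (intro Ck_dir_SucI[where g' = "\<lambda>_ _. 0"]) auto
qed (simp add: Ck_dir_0)

lemma Ck_dir_invariant:
  fixes g :: "'a::real_normed_vector \<Rightarrow> 'b::real_normed_vector"
  assumes S: "open S" and c: "continuous_on S g" and inv: "\<And>v p s. v \<in> B \<Longrightarrow> g (p + s *\<^sub>R v) = g p"
  shows "Ck_dir B k S g"
proof (cases k)
  case (Suc j)
  show ?thesis unfolding Suc
    by (rule Ck_dir_SucI[where g' = "\<lambda>_ _. 0"]) (use assms Ck_dir_zero in auto)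
qed (use c in \<open>simp add: Ck_dir_0\<close>)

lemma Ck_dir_add:
  assumes S: "open S" and "Ck_dir B k S f" "Ck_dir B k S g"
  shows "Ck_dir B k S (\<lambda>p. f p + g p)"
  using assms(2,3)
proof (induction k arbitrary: f g)
  case (Suc k)
  show ?case
    by (rule Ck_dir_SucI[where g' = "\<lambda>v p. dir_deriv v f p + dir_deriv v g p", OF S])
      (intro continuous_on_add has_vector_derivative_add Suc.IH Ck_dir_SucD[OF Suc.prems(1)] Ck_dir_SucD[OF Suc.prems(2)]; assumption)+
qed (simp add: Ck_dir_0 continuous_on_add)

lemma Ck_dir_mult:
  fixes f g :: "'a::real_normed_vector \<Rightarrow> 'b::real_normed_algebra"
  assumes S: "open S" and "Ck_dir B k S f" "Ck_dir B k S g"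
  shows "Ck_dir B k S (\<lambda>p. f p * g p)"
  using assms(2,3)
proof (induction k arbitrary: f g)
  case (Suc k)
  note f = Ck_dir_SucD[OF Suc.prems(1)] and g = Ck_dir_SucD[OF Suc.prems(2)]
  have f0: "Ck_dir B k S f" and g0: "Ck_dir B k S g"
    by (simp_all add: Ck_dir_mono[OF Suc.prems(1)] Ck_dir_mono[OF Suc.prems(2)])
  show ?case
  proof (rule Ck_dir_SucI[where g' = "\<lambda>v p. f p * dir_deriv v g p + dir_deriv v f p * g p", OF S])
    show "continuous_on S (\<lambda>p. f p * g p)" by (intro continuous_on_mult f g)
  next
    fix v p assume "v \<in> B" "p \<in> S"
    from has_vector_derivative_mult[OF f(2)[OF this] g(2)[OF this]]
    show "((\<lambda>s. f (p + s *\<^sub>R v) * g (p + s *\<^sub>R v)) has_vector_derivative f p * dir_deriv v g p + dir_deriv v f p * g p) (at 0)"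
      by simp
  next
    fix v assume v: "v \<in> B"
    show "Ck_dir B k S (\<lambda>p. f p * dir_deriv v g p + dir_deriv v f p * g p)"
      by (intro Ck_dir_add[OF S] Suc.IH f0 g0 f(3)[OF v] g(3)[OF v])
  qed
qed (simp add: Ck_dir_0 continuous_on_mult)

lemma line_derivative_shift:
  fixes g :: "'a::real_normed_vector \<Rightarrow> 'b::real_normed_vector"
  assumes "((\<lambda>s. g (p + \<sigma> *\<^sub>R v + s *\<^sub>R v)) has_vector_derivative d) (at 0)"
  shows "((\<lambda>s. g (p + s *\<^sub>R v)) has_vector_derivative d) (at \<sigma>)"
proof -
  have "((\<lambda>s. s - \<sigma>) has_vector_derivative 1) (at \<sigma>)"
    by (auto intro!: derivative_eq_intros)
  from vector_diff_chain_at[OF this, of "\<lambda>s. g (p + \<sigma> *\<^sub>R v + s *\<^sub>R v)" d]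
  have "((\<lambda>s. g (p + \<sigma> *\<^sub>R v + (s - \<sigma>) *\<^sub>R v)) has_vector_derivative d) (at \<sigma>)"
    using assms by (simp add: o_def)
  moreover have "p + \<sigma> *\<^sub>R v + (s - \<sigma>) *\<^sub>R v = p + s *\<^sub>R v" for s
    by (simp add: algebra_simps)
  ultimately show ?thesis by simp
qed

text \<open>Two applications of the mean value inequality, first in the direction \<open>v\<close> to \<open>\<partial>\<^sub>w g\<close> and then in the
  direction \<open>w\<close>, compare the second difference of \<open>g\<close> with the mixed derivative.\<close>
lemma mixed_difference_bound:
  fixes g :: "'a::real_normed_vector \<Rightarrow> 'b::real_normed_vector"
  assumes s: "0 \<le> s"
    and in1: "\<And>\<sigma> t. \<sigma> \<in> {0..s} \<Longrightarrow> t \<in> {0..s} \<Longrightarrow> p + \<sigma> *\<^sub>R v + t *\<^sub>R w \<in> S"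
    and dw: "\<And>q. q \<in> S \<Longrightarrow> ((\<lambda>s. g (q + s *\<^sub>R w)) has_vector_derivative gw q) (at 0)"
    and dv: "\<And>q. q \<in> S \<Longrightarrow> ((\<lambda>s. gw (q + s *\<^sub>R v)) has_vector_derivative gvw q) (at 0)"
    and e: "\<And>q. q \<in> S \<Longrightarrow> norm (gvw q - L) \<le> e"
  shows "norm (g (p + s *\<^sub>R v + s *\<^sub>R w) - g (p + s *\<^sub>R v) - g (p + s *\<^sub>R w) + g p - (s * s) *\<^sub>R L) \<le> s * s * e"
proof -
  have lin: "((\<lambda>x. x *\<^sub>R c) has_vector_derivative c) (at x)" for c :: 'b and x
    using has_vector_derivative_scaleR[OF DERIV_ident has_vector_derivative_const] by simp
  have onl: "onorm (\<lambda>x::real. x *\<^sub>R d) \<le> c" if "norm d \<le> c" for d :: 'b and c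
  proof (rule onorm_le)
    fix x :: real
    show "norm (x *\<^sub>R d) \<le> c * norm x"
      using mult_right_mono[OF that abs_ge_zero[of x]] by (simp add: mult.commute)
  qed
  have inner: "norm (gw (p + s *\<^sub>R v + t *\<^sub>R w) - gw (p + t *\<^sub>R w) - s *\<^sub>R L) \<le> s * e" if t: "t \<in> {0..s}" for t
  proof -
    have "norm ((gw (p + t *\<^sub>R w + s *\<^sub>R v) - s *\<^sub>R L) - (gw (p + t *\<^sub>R w + 0 *\<^sub>R v) - 0 *\<^sub>R L)) \<le> e * norm (s - 0)"
    proof (rule differentiable_bound[where S = "{0..s}" and f' = "\<lambda>\<sigma> x. x *\<^sub>R (gvw (p + t *\<^sub>R w + \<sigma> *\<^sub>R v) - L)"])
      fix \<sigma> assume \<sigma>: "\<sigma> \<in> {0..s}"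
      have S: "p + t *\<^sub>R w + \<sigma> *\<^sub>R v \<in> S" using in1[OF \<sigma> t] by (simp add: algebra_simps)
      have "((\<lambda>\<sigma>. gw (p + t *\<^sub>R w + \<sigma> *\<^sub>R v) - \<sigma> *\<^sub>R L) has_vector_derivative
          gvw (p + t *\<^sub>R w + \<sigma> *\<^sub>R v) - L) (at \<sigma>)"
        by (rule has_vector_derivative_diff[OF line_derivative_shift[OF dv[OF S]] lin])
      then show "((\<lambda>\<sigma>. gw (p + t *\<^sub>R w + \<sigma> *\<^sub>R v) - \<sigma> *\<^sub>R L) has_derivative
          (\<lambda>x. x *\<^sub>R (gvw (p + t *\<^sub>R w + \<sigma> *\<^sub>R v) - L))) (at \<sigma> within {0..s})"
        by (simp add: has_vector_derivative_def has_derivative_at_withinI)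
      show "onorm (\<lambda>x. x *\<^sub>R (gvw (p + t *\<^sub>R w + \<sigma> *\<^sub>R v) - L)) \<le> e"
        by (rule onl[OF e[OF S]])
    qed (use s in auto)
    then show ?thesis using s by (simp add: algebra_simps)
  qed
  have "norm ((g (p + s *\<^sub>R v + s *\<^sub>R w) - g (p + s *\<^sub>R w) - s *\<^sub>R s *\<^sub>R L)
     - (g (p + s *\<^sub>R v + 0 *\<^sub>R w) - g (p + 0 *\<^sub>R w) - 0 *\<^sub>R s *\<^sub>R L)) \<le> (s * e) * norm (s - 0)"
  proof (rule differentiable_bound[where S = "{0..s}"
        and f' = "\<lambda>t x. x *\<^sub>R (gw (p + s *\<^sub>R v + t *\<^sub>R w) - gw (p + t *\<^sub>R w) - s *\<^sub>R L)"])
    fix t assume t: "t \<in> {0..s}"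
    have S: "p + s *\<^sub>R v + t *\<^sub>R w \<in> S" "p + t *\<^sub>R w \<in> S"
      using in1[OF _ t, of s] in1[OF _ t, of 0] s by auto
    have "((\<lambda>t. g (p + s *\<^sub>R v + t *\<^sub>R w) - g (p + t *\<^sub>R w) - t *\<^sub>R s *\<^sub>R L) has_vector_derivative
        gw (p + s *\<^sub>R v + t *\<^sub>R w) - gw (p + t *\<^sub>R w) - s *\<^sub>R L) (at t)"
      by (rule has_vector_derivative_diff[OF has_vector_derivative_diff[OF
            line_derivative_shift[OF dw[OF S(1)]] line_derivative_shift[OF dw[OF S(2)]]] lin])
    then show "((\<lambda>t. g (p + s *\<^sub>R v + t *\<^sub>R w) - g (p + t *\<^sub>R w) - t *\<^sub>R s *\<^sub>R L) has_derivative
        (\<lambda>x. x *\<^sub>R (gw (p + s *\<^sub>R v + t *\<^sub>R w) - gw (p + t *\<^sub>R w) - s *\<^sub>R L))) (at t within {0..s})"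
      by (simp add: has_vector_derivative_def has_derivative_at_withinI)
    show "onorm (\<lambda>x. x *\<^sub>R (gw (p + s *\<^sub>R v + t *\<^sub>R w) - gw (p + t *\<^sub>R w) - s *\<^sub>R L)) \<le> s * e"
      by (rule onl[OF inner[OF t]])
  qed (use s in auto)
  then show ?thesis using s by (simp add: algebra_simps)
qed

text \<open>Schwarz's theorem. The second difference is symmetric in \<open>v\<close> and \<open>w\<close>, hence \<open>mixed_difference_bound\<close>
  applies with both orders of differentiation and forces the two limits to agree.\<close>
theorem dir_deriv_commute:
  fixes g :: "'a::real_normed_vector \<Rightarrow> 'b::real_normed_vector"
  assumes S: "open S" and g: "Ck_dir B 2 S g" and v: "v \<in> B" and w: "w \<in> B" and p: "p \<in> S"
  shows "dir_deriv v (dir_deriv w g) p = dir_deriv w (dir_deriv v g) p"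
proof (rule ccontr)
  define Lvw Lwv where "Lvw = dir_deriv v (dir_deriv w g)" and "Lwv = dir_deriv w (dir_deriv v g)"
  assume "dir_deriv v (dir_deriv w g) p \<noteq> dir_deriv w (dir_deriv v g) p"
  then have ne: "norm (Lvw p - Lwv p) > 0" by (simp add: Lvw_def Lwv_def)
  \<comment> \<open>two errors of size \<open>e\<close> have to add up to less than the gap\<close>
  define e where "e = norm (Lvw p - Lwv p) / 3"
  have e: "e > 0" using ne by (simp add: e_def)
  have g': "Ck_dir B (Suc (Suc 0)) S g" using g by (simp add: numeral_2_eq_2)
  note gD = Ck_dir_SucD[OF g']
  note vD = Ck_dir_SucD[OF gD(3)[OF v]] and wD = Ck_dir_SucD[OF gD(3)[OF w]]
  have c: "continuous_on S Lvw" "continuous_on S Lwv"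
    using wD(3)[OF v] vD(3)[OF w] by (simp_all add: Lvw_def Lwv_def Ck_dir_0)
  define N where "N = {q \<in> S. dist (Lvw q) (Lvw p) < e \<and> dist (Lwv q) (Lwv p) < e}"
  have "N = (S \<inter> Lvw -` ball (Lvw p) e) \<inter> (S \<inter> Lwv -` ball (Lwv p) e)"
    by (auto simp: N_def dist_commute)
  then have "open N"
    using continuous_open_preimage[OF c(1) S] continuous_open_preimage[OF c(2) S] by (simp add: open_Int)
  moreover have "p \<in> N" using p e by (simp add: N_def)
  ultimately obtain d where d: "d > 0" "ball p d \<subseteq> N" using openE by blast
  define s where "s = d / (2 * (norm v + norm w + 1))"
  have nn: "norm v + norm w + 1 > 0" by (simp add: add_nonneg_pos)
  have s: "s > 0" using d nn by (simp add: s_def)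
  have inN: "p + \<sigma> *\<^sub>R v + t *\<^sub>R w \<in> N" if "\<sigma> \<in> {0..s}" "t \<in> {0..s}" for \<sigma> t
  proof -
    have "norm (\<sigma> *\<^sub>R v + t *\<^sub>R w) \<le> \<sigma> * norm v + t * norm w"
      using norm_triangle_ineq[of "\<sigma> *\<^sub>R v" "t *\<^sub>R w"] that by simp
    also have "\<dots> \<le> s * norm v + s * norm w"
      using that by (intro add_mono mult_right_mono) auto
    also have "\<dots> < s * (norm v + norm w + 1) * 2"
    proof -
      have "0 \<le> s * norm v" "0 \<le> s * norm w" using s by simp_all
      then show ?thesis using s by (simp add: algebra_simps add_nonneg_pos)
    qed
    also have "\<dots> = d"
    proof -
      have "d / (2 * n) * n * 2 = d" if "n > 0" for n using that by simp
      from this[OF nn] show ?thesis by (simp only: s_def)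
    qed
    finally have "dist p (p + \<sigma> *\<^sub>R v + t *\<^sub>R w) < d"
      by (simp add: dist_norm norm_minus_commute algebra_simps)
    then show ?thesis using d by auto
  qed
  have NS: "N \<subseteq> S" by (auto simp: N_def)
  define D where "D = g (p + s *\<^sub>R v + s *\<^sub>R w) - g (p + s *\<^sub>R v) - g (p + s *\<^sub>R w) + g p"
  have "norm (g (p + s *\<^sub>R v + s *\<^sub>R w) - g (p + s *\<^sub>R v) - g (p + s *\<^sub>R w) + g p - (s * s) *\<^sub>R Lvw p) \<le> s * s * e"
    by (rule mixed_difference_bound[where S = N and gw = "dir_deriv w g" and gvw = Lvw])
      (use s inN NS w v gD(2) wD(2) in \<open>auto simp: Lvw_def N_def dist_norm less_imp_le\<close>)
  then have 1: "norm (D - (s * s) *\<^sub>R Lvw p) \<le> s * s * e" by (simp add: D_def)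
  have "norm (g (p + s *\<^sub>R w + s *\<^sub>R v) - g (p + s *\<^sub>R w) - g (p + s *\<^sub>R v) + g p - (s * s) *\<^sub>R Lwv p) \<le> s * s * e"
  proof (rule mixed_difference_bound[where S = N and gw = "dir_deriv v g" and gvw = Lwv])
    show "p + \<sigma> *\<^sub>R w + t *\<^sub>R v \<in> N" if "\<sigma> \<in> {0..s}" "t \<in> {0..s}" for \<sigma> t
      using inN[OF that(2,1)] by (simp add: algebra_simps)
  qed (use s NS w v gD(2) vD(2) in \<open>auto simp: Lwv_def N_def dist_norm less_imp_le\<close>)
  then have 2: "norm (D - (s * s) *\<^sub>R Lwv p) \<le> s * s * e" by (simp add: D_def algebra_simps)
  have "s * s * norm (Lvw p - Lwv p) = norm ((D - (s * s) *\<^sub>R Lwv p) - (D - (s * s) *\<^sub>R Lvw p))"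
    using s by (simp add: scaleR_diff_right[symmetric])
  also have "\<dots> \<le> s * s * e + s * s * e"
    using norm_triangle_ineq4[of "D - (s * s) *\<^sub>R Lwv p" "D - (s * s) *\<^sub>R Lvw p"] 1 2 by linarith
  also have "\<dots> = s * s * (2 * e)" by simp
  finally have "norm (Lvw p - Lwv p) \<le> 2 * e"
    using s by simp
  then show False using ne by (simp add: e_def)
qed

lemma dir_derivs_move_to_end:
  fixes g :: "'a::real_normed_vector \<Rightarrow> 'b::real_normed_vector"
  assumes S: "open S" and g: "Ck_dir B k S g" and v: "v \<in> B"
    and vs: "set vs \<subseteq> B" "Suc (length vs) \<le> k" and p: "p \<in> S"
  shows "dir_derivs (v # vs) g p = dir_derivs (vs @ [v]) g p"
  using vs p
proof (induction vs arbitrary: p)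
  case (Cons x vs)
  have "Ck_dir B 2 S (dir_derivs vs g)"
    by (rule Ck_dir_derivs) (use Cons.prems in \<open>auto intro: Ck_dir_mono[OF g]\<close>)
  from dir_deriv_commute[OF S this v, of x] Cons.prems
  have "dir_derivs (v # x # vs) g p = dir_deriv x (dir_derivs (v # vs) g) p" by simp
  also have "\<dots> = dir_deriv x (dir_derivs (vs @ [v]) g) p"
    by (rule dir_deriv_cong[OF S Cons.prems(3)]) (use Cons in auto)
  finally show ?case by simp
qed simp

text \<open>Reversal is the only permutation of derivatives that occurs below: integration by parts
  produces it.\<close>
theorem dir_derivs_rev:
  fixes g :: "'a::real_normed_vector \<Rightarrow> 'b::real_normed_vector"
  assumes S: "open S" and g: "Ck_dir B k S g"
    and vs: "set vs \<subseteq> B" "length vs \<le> k" and p: "p \<in> S"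
  shows "dir_derivs (rev vs) g p = dir_derivs vs g p"
  using g vs
proof (induction vs arbitrary: g k)
  case (Cons v vs)
  then obtain j where k: "k = Suc j" by (cases k) auto
  have "Ck_dir B j S (dir_deriv v g)" using Cons.prems unfolding k by (auto dest: Ck_dir_SucD(3))
  then have "dir_derivs (rev vs) (dir_deriv v g) p = dir_derivs vs (dir_deriv v g) p"
    using Cons.prems k by (intro Cons.IH) auto
  then have "dir_derivs (rev (v # vs)) g p = dir_derivs (vs @ [v]) g p"
    by (simp add: dir_derivs_append)
  also have "\<dots> = dir_derivs (v # vs) g p"
    using dir_derivs_move_to_end[OF S Cons.prems(1), of v vs p] Cons.prems p by simp
  finally show ?case .
qed simp

section \<open>Integration by parts\<close>

lemma compactly_supported_set_integrable:
  fixes g :: "'a::euclidean_space \<Rightarrow> complex"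
  assumes K: "compact K" "K \<subseteq> W" and g: "continuous_on W g" and zero: "\<And>p. p \<in> W - K \<Longrightarrow> g p = 0"
  shows "set_integrable lborel W g"
proof -
  have "indicator W p *\<^sub>R g p = indicator K p *\<^sub>R g p" for p
    using K zero by (cases "p \<in> W"; cases "p \<in> K") auto
  then show ?thesis
    using borel_integrable_compact[OF K(1) continuous_on_subset[OF g K(2)]]
    unfolding set_integrable_def by (simp only:)
qed

text \<open>Lebesgue measure is translation invariant, so every difference quotient of \<open>F\<close> in the direction
  \<open>v\<close> has integral \<open>0\<close>. By the mean value inequality the quotients are bounded, and they vanish
  outside a fixed ball; dominated convergence gives the claim.\<close>
lemma integral_directional_derivative_eq_0:
  fixes F F' :: "'a::euclidean_space \<Rightarrow> complex"
  assumes K: "compact K" and F: "continuous_on UNIV F" and F': "continuous_on UNIV F'"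
    and deriv: "\<And>p. ((\<lambda>s. F (p + s *\<^sub>R v)) has_vector_derivative F' p) (at 0)"
    and zero: "\<And>p. p \<notin> K \<Longrightarrow> F p = 0" "\<And>p. p \<notin> K \<Longrightarrow> F' p = 0"
  shows "(\<integral>p. F' p \<partial>lborel) = 0"
proof -
  obtain R where R: "\<And>p. p \<in> K \<Longrightarrow> norm p \<le> R"
    using compact_imp_bounded[OF K] by (auto simp: bounded_iff)
  obtain M0 where M0: "\<And>p. p \<in> K \<Longrightarrow> norm (F' p) \<le> M0"
    using compact_imp_bounded[OF compact_continuous_image[OF continuous_on_subset[OF F'] K]]
    by (auto simp: bounded_iff)
  define M where "M = max 0 M0"
  have M: "norm (F' p) \<le> M" for p
    using M0[of p] zero(2)[of p] by (cases "p \<in> K") (auto simp: M_def)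
  have M_nonneg: "0 \<le> M" by (simp add: M_def)
  have iF: "integrable lborel F"
  proof -
    have "indicator K p *\<^sub>R F p = F p" for p using zero(1)[of p] by (cases "p \<in> K") auto
    then show ?thesis using borel_integrable_compact[OF K continuous_on_subset[OF F]] by simp
  qed
  define e where "e n = inverse (real (Suc n))" for n
  have e: "0 < e n" "e n \<le> 1" for n by (simp_all add: e_def inverse_le_1_iff)
  define q where "q n p = inverse (e n) *\<^sub>R (F (p + e n *\<^sub>R v) - F p)" for n p
  have shift: "(\<integral>p. F (p + c) \<partial>lborel) = (\<integral>p. F p \<partial>lborel)" and ishift: "integrable lborel (\<lambda>p. F (p + c))" for c
  proof -
    have mF: "F \<in> borel_measurable borel" using F by (rule borel_measurable_continuous_onI)
    have "(\<integral>p. F p \<partial>lborel) = (\<integral>p. F p \<partial>distr lborel borel ((+) c))"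
      by (simp only: lborel_distr_plus)
    also have "\<dots> = (\<integral>p. F (c + p) \<partial>lborel)"
      by (rule integral_distr) (use mF in simp_all)
    finally show "(\<integral>p. F (p + c) \<partial>lborel) = (\<integral>p. F p \<partial>lborel)" by (simp add: add.commute)
    have "integrable (distr lborel borel ((+) c)) F" using iF by (simp only: lborel_distr_plus)
    then have "integrable lborel (\<lambda>p. F (c + p))"
      by (subst (asm) integrable_distr_eq) (use mF in simp_all)
    then show "integrable lborel (\<lambda>p. F (p + c))" by (simp add: add.commute)
  qed
  have q0: "(\<integral>p. q n p \<partial>lborel) = 0" for n
    unfolding q_def using shift ishift iF by simp
  have mvt: "norm (F (p + s *\<^sub>R v) - F p) \<le> M * s" if "0 \<le> s" for p s
  proof -
    have "norm (F (p + s *\<^sub>R v) - F (p + 0 *\<^sub>R v)) \<le> M * norm (s - 0)"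
    proof (rule differentiable_bound[where S = "{0..s}" and f' = "\<lambda>\<sigma> x. x *\<^sub>R F' (p + \<sigma> *\<^sub>R v)"])
      fix \<sigma>
      show "((\<lambda>\<sigma>. F (p + \<sigma> *\<^sub>R v)) has_derivative (\<lambda>x. x *\<^sub>R F' (p + \<sigma> *\<^sub>R v))) (at \<sigma> within {0..s})"
        using line_derivative_shift[where g = F, OF deriv[of "p + \<sigma> *\<^sub>R v"]]
        by (simp add: has_vector_derivative_def has_derivative_at_withinI)
      show "onorm (\<lambda>x. x *\<^sub>R F' (p + \<sigma> *\<^sub>R v)) \<le> M"
      proof (rule onorm_le)
        fix x :: real
        show "norm (x *\<^sub>R F' (p + \<sigma> *\<^sub>R v)) \<le> M * norm x"
          using mult_right_mono[OF M abs_ge_zero[of x]] by (simp add: mult.commute)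
      qed
    qed (use that in auto)
    then show ?thesis using that by simp
  qed
  have "(\<lambda>n. \<integral>p. q n p \<partial>lborel) \<longlonglongrightarrow> (\<integral>p. F' p \<partial>lborel)"
  proof (rule integral_dominated_convergence[where w = "\<lambda>p. indicator (cball 0 (R + norm v)) p *\<^sub>R M"])
    show "F' \<in> borel_measurable lborel" "q n \<in> borel_measurable lborel" for n
    proof -
      show "F' \<in> borel_measurable lborel" using borel_measurable_continuous_onI[OF F'] by simp
      have "continuous_on UNIV (\<lambda>p. F (p + e n *\<^sub>R v))"
        by (rule continuous_on_compose2[OF F]) (auto intro!: continuous_intros)
      then have "continuous_on UNIV (q n)"
        unfolding q_def by (intro continuous_intros F)
      then show "q n \<in> borel_measurable lborel" using borel_measurable_continuous_onI by simp
    qed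
    show "integrable lborel (\<lambda>p. indicator (cball 0 (R + norm v)) p *\<^sub>R M)"
      by (intro integrable_scaleR_left integrable_indicator emeasure_bounded_finite) auto
    show "AE p in lborel. norm (q n p) \<le> indicator (cball 0 (R + norm v)) p *\<^sub>R M" for n
    proof (rule AE_I2)
      fix p
      show "norm (q n p) \<le> indicator (cball 0 (R + norm v)) p *\<^sub>R M"
      proof (cases "norm p \<le> R + norm v")
        case True
        have "norm (q n p) = norm (F (p + e n *\<^sub>R v) - F p) / e n"
          using e[of n] by (simp add: q_def divide_inverse mult.commute)
        also have "\<dots> \<le> M"
          using mvt[of "e n" p] e[of n] by (simp add: divide_le_eq)
        finally show ?thesis using True by simp
      next
        case False
        have "norm (e n *\<^sub>R v) \<le> norm v"
          using e[of n] by (simp add: mult_left_le_one_le)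
        then have "norm (p + e n *\<^sub>R v) > R"
          using False norm_triangle_ineq4[of "p + e n *\<^sub>R v" "e n *\<^sub>R v"] by simp
        moreover have "norm p > R" using False norm_ge_zero[of v] by linarith
        ultimately have "F (p + e n *\<^sub>R v) = 0" "F p = 0" using R zero(1) by force+
        then show ?thesis using M_nonneg by (simp add: q_def)
      qed
    qed
    have "(\<lambda>n. q n p) \<longlonglongrightarrow> F' p" for p
    proof -
      have "((\<lambda>s. F (p + s *\<^sub>R v)) has_derivative (\<lambda>x. x *\<^sub>R F' p)) (at 0)"
        using deriv[of p] by (simp add: has_vector_derivative_def)
      then have "((\<lambda>s. norm (F (p + s *\<^sub>R v) - F p - s *\<^sub>R F' p) / norm s) \<longlongrightarrow> 0) (at 0)"
        unfolding has_derivative_at by simp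
      moreover have "filterlim e (at 0) sequentially"
        unfolding filterlim_at using e LIMSEQ_inverse_real_of_nat
        by (auto simp: e_def[abs_def])
      ultimately have "(\<lambda>n. norm (F (p + e n *\<^sub>R v) - F p - e n *\<^sub>R F' p) / norm (e n)) \<longlonglongrightarrow> 0"
        by (rule filterlim_compose)
      moreover have "norm (F (p + e n *\<^sub>R v) - F p - e n *\<^sub>R F' p) / norm (e n) = norm (q n p - F' p)" for n
      proof -
        have "F (p + e n *\<^sub>R v) - F p - e n *\<^sub>R F' p = e n *\<^sub>R (q n p - F' p)"
          using e[of n] by (simp add: q_def scaleR_diff_right)
        then show ?thesis using e[of n] by simp
      qed
      ultimately have "(\<lambda>n. norm (q n p - F' p)) \<longlonglongrightarrow> 0" by simp
      then show ?thesis using tendsto_norm_zero_iff LIM_zero_cancel by blast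
    qed
    then show "AE p in lborel. (\<lambda>n. q n p) \<longlonglongrightarrow> F' p" by simp
  qed
  then have "(\<lambda>n. 0 :: complex) \<longlonglongrightarrow> (\<integral>p. F' p \<partial>lborel)" unfolding q0 .
  then show ?thesis using LIMSEQ_const_iff by metis
qed

lemma dir_derivs_zero: "dir_derivs vs (\<lambda>_. 0) = (\<lambda>_. 0)"
  by (induction vs) (auto simp: dir_deriv_def)

lemma dir_derivs_vanish:
  assumes "open S" "\<And>q. q \<in> S \<Longrightarrow> g q = 0" "p \<in> S"
  shows "dir_derivs vs g p = 0"
  using dir_derivs_cong[OF assms(1), of g "\<lambda>_. 0" p vs] assms by (simp add: dir_derivs_zero)

text \<open>The product of \<open>h\<close> and \<open>\<psi>\<close>, extended by \<open>0\<close>, is continuously differentiable in the direction \<open>v\<close> on the whole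
  space, because \<open>W\<close> and the complement of \<open>K\<close> are two open sets that cover it.\<close>
theorem integration_by_parts_direction:
  fixes h \<psi> :: "'a::euclidean_space \<Rightarrow> complex"
  assumes W: "open W" and K: "compact K" "K \<subseteq> W"
    and h: "Ck_dir B 1 W h" and \<psi>: "Ck_dir B 1 W \<psi>" and zero: "\<And>p. p \<in> W - K \<Longrightarrow> \<psi> p = 0" and v: "v \<in> B"
  shows "(LINT p:W|lborel. h p * dir_deriv v \<psi> p) = - (LINT p:W|lborel. dir_deriv v h p * \<psi> p)"
proof -
  note hD = Ck_dir_SucD[OF h[unfolded One_nat_def]] and \<psi>D = Ck_dir_SucD[OF \<psi>[unfolded One_nat_def]]
  have ch: "continuous_on W (dir_deriv v h)" and c\<psi>: "continuous_on W (dir_deriv v \<psi>)"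
    using hD(3)[OF v] \<psi>D(3)[OF v] by (simp_all add: Ck_dir_0)
  have oK: "open (- K)" using compact_imp_closed[OF K(1)] by (simp add: open_Compl)
  have d0: "dir_deriv v \<psi> p = 0" if "p \<in> W - K" for p
    using dir_derivs_vanish[of "W - K" \<psi> p "[v]"] zero that W compact_imp_closed[OF K(1)] by (simp add: open_Diff)
  define F where "F p = (if p \<in> W then h p * \<psi> p else 0)" for p
  define F' where "F' p = (if p \<in> W then h p * dir_deriv v \<psi> p + dir_deriv v h p * \<psi> p else 0)" for p
  have z: "F p = 0" "F' p = 0" if "p \<notin> K" for p
    using that zero d0 by (auto simp: F_def F'_def)
  have un: "W \<union> - K = UNIV" using K by auto
  have glue: "continuous_on UNIV G" if "continuous_on W G" "\<And>p. p \<notin> K \<Longrightarrow> G p = 0" for G :: "'a \<Rightarrow> complex"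
  proof -
    have "continuous_on (- K) G"
      using continuous_on_cong[of "- K" "- K" G "\<lambda>_. 0"] that(2) by simp
    from continuous_on_open_Un[OF W oK that(1) this] show ?thesis by (simp only: un)
  qed
  have cF: "continuous_on UNIV F"
  proof (rule glue)
    show "continuous_on W F"
      using continuous_on_mult[OF hD(1) \<psi>D(1)] by (rule continuous_on_eq) (simp add: F_def)
  qed (rule z(1))
  have cF': "continuous_on UNIV F'"
  proof (rule glue)
    show "continuous_on W F'"
      using continuous_on_add[OF continuous_on_mult[OF hD(1) c\<psi>] continuous_on_mult[OF ch \<psi>D(1)]]
      by (rule continuous_on_eq) (simp add: F'_def)
  qed (rule z(2))
  have dF: "((\<lambda>s. F (p + s *\<^sub>R v)) has_vector_derivative F' p) (at 0)" for p
  proof (cases "p \<in> W")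
    case True
    have "((\<lambda>s. h (p + s *\<^sub>R v) * \<psi> (p + s *\<^sub>R v)) has_vector_derivative F' p) (at 0)"
      using has_vector_derivative_mult[OF hD(2)[OF v True] \<psi>D(2)[OF v True]] True by (simp add: F'_def)
    then show ?thesis
      by (subst line_derivative_cong[OF W True, of F "\<lambda>p. h p * \<psi> p"]) (simp_all add: F_def)
  next
    case False
    then have p: "p \<in> - K" using K by auto
    have "((\<lambda>s. 0) has_vector_derivative F' p) (at 0)" using z(2)[of p] p by simp
    then show ?thesis
      by (subst line_derivative_cong[OF oK p, of F "\<lambda>p. 0"]) (simp_all add: z(1))
  qed
  have i1: "set_integrable lborel W (\<lambda>p. h p * dir_deriv v \<psi> p)"
    by (rule compactly_supported_set_integrable[OF K continuous_on_mult[OF hD(1) c\<psi>]]) (simp add: d0)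
  have i2: "set_integrable lborel W (\<lambda>p. dir_deriv v h p * \<psi> p)"
    by (rule compactly_supported_set_integrable[OF K continuous_on_mult[OF ch \<psi>D(1)]]) (simp add: zero)
  have "(LINT p:W|lborel. h p * dir_deriv v \<psi> p) + (LINT p:W|lborel. dir_deriv v h p * \<psi> p)
      = (LINT p:W|lborel. h p * dir_deriv v \<psi> p + dir_deriv v h p * \<psi> p)"
    by (rule set_integral_add(2)[OF i1 i2, symmetric])
  also have "\<dots> = (\<integral>p. F' p \<partial>lborel)"
    unfolding set_lebesgue_integral_def
    by (rule Bochner_Integration.integral_cong) (auto simp: F'_def)
  also have "\<dots> = 0"
    by (rule integral_directional_derivative_eq_0[OF K(1) cF cF' dF z])
  finally show ?thesis by (simp add: eq_neg_iff_add_eq_0)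
qed

text \<open>Moving the derivatives one by one reverses their order, which \<open>dir_derivs_rev\<close> undoes.\<close>
theorem integration_by_parts_word:
  fixes h \<psi> :: "'a::euclidean_space \<Rightarrow> complex"
  assumes W: "open W" and K: "compact K" "K \<subseteq> W"
    and h: "Ck_dir B k W h" and \<psi>: "Ck_dir B k W \<psi>" and zero: "\<And>p. p \<in> W - K \<Longrightarrow> \<psi> p = 0"
    and vs: "set vs \<subseteq> B" "length vs \<le> k"
  shows "(LINT p:W|lborel. h p * dir_derivs vs \<psi> p)
     = (-1) ^ length vs * (LINT p:W|lborel. dir_derivs vs h p * \<psi> p)"
proof -
  have "(LINT p:W|lborel. h p * dir_derivs vs \<psi> p)
     = (-1) ^ length vs * (LINT p:W|lborel. dir_derivs (rev vs) h p * \<psi> p)"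
    using vs Ck_dir_mono[OF h order_refl vs(2) order_refl]
  proof (induction vs arbitrary: h)
    case (Cons v vs)
    have v: "v \<in> B" and len: "Suc (length vs) \<le> k" using Cons.prems by auto
    have \<psi>1: "Ck_dir B 1 W (dir_derivs vs \<psi>)"
      by (rule Ck_dir_derivs) (use Cons.prems in \<open>simp_all add: Ck_dir_mono[OF \<psi>]\<close>)
    have z: "dir_derivs vs \<psi> p = 0" if "p \<in> W - K" for p
      by (rule dir_derivs_vanish[of "W - K"])
        (use zero that W compact_imp_closed[OF K(1)] in \<open>auto simp: open_Diff\<close>)
    have h1: "Ck_dir B 1 W h" by (rule Ck_dir_mono[OF Cons.prems(3)]) auto
    have h2: "Ck_dir B (length vs) W (dir_deriv v h)"
      using Ck_dir_SucD(3)[of B "length vs" W h v] Cons.prems(3) v by simp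
    have "(LINT p:W|lborel. h p * dir_derivs (v # vs) \<psi> p)
        = - (LINT p:W|lborel. dir_deriv v h p * dir_derivs vs \<psi> p)"
      using integration_by_parts_direction[OF W K h1 \<psi>1 z v] by simp
    also have "\<dots> = - ((-1) ^ length vs * (LINT p:W|lborel. dir_derivs (rev vs) (dir_deriv v h) p * \<psi> p))"
      using Cons.IH[of "dir_deriv v h"] h2 Cons.prems by simp
    finally show ?case by (simp add: dir_derivs_append)
  qed simp
  also have "(LINT p:W|lborel. dir_derivs (rev vs) h p * \<psi> p) = (LINT p:W|lborel. dir_derivs vs h p * \<psi> p)"
    by (rule set_lebesgue_integral_cong) (use W dir_derivs_rev[OF W h vs] in auto)
  finally show ?thesis .
qed

section \<open>Multi-indices\<close>

lemma mi_word_count: "count_list (mi_word \<alpha>) i = \<alpha> i"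
proof -
  define M where "M = (\<Sum>i\<in>UNIV. replicate_mset (\<alpha> i) i)"
  obtain xs where "mset xs = M" using ex_mset by blast
  then have "\<forall>i. count_list xs i = \<alpha> i"
    by (auto simp: count_mset[symmetric] M_def count_sum if_distrib cong: if_cong)
  then have "\<forall>i. count_list (mi_word \<alpha>) i = \<alpha> i"
    unfolding mi_word_def by (rule someI[where P = "\<lambda>xs. \<forall>i. count_list xs i = \<alpha> i"])
  then show ?thesis by simp
qed

lemma length_mi_word: "length (mi_word \<alpha>) = mi_size \<alpha>"
proof -
  have "sum (count_list (mi_word \<alpha>)) UNIV = length (mi_word \<alpha>)"
    by (rule sum_count_set) auto
  then show ?thesis by (simp add: mi_size_def mi_word_count)
qed

lemma finite_multi_indices: "finite {\<alpha> :: 'n::finite \<Rightarrow> nat. mi_size \<alpha> \<le> m}"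
proof (rule finite_subset)
  show "{\<alpha> :: 'n \<Rightarrow> nat. mi_size \<alpha> \<le> m} \<subseteq> PiE UNIV (\<lambda>_. {..m})"
  proof
    fix \<alpha> :: "'n \<Rightarrow> nat" assume "\<alpha> \<in> {\<alpha>. mi_size \<alpha> \<le> m}"
    then have "\<alpha> i \<le> m" for i
      using member_le_sum[of i UNIV \<alpha>] by (simp add: mi_size_def)
    then show "\<alpha> \<in> PiE UNIV (\<lambda>_. {..m})" by auto
  qed
qed (simp add: finite_PiE)

definition mi_dirs :: "('n::finite \<Rightarrow> nat) \<Rightarrow> (real^'n) list" where
  "mi_dirs \<alpha> = map (\<lambda>i. axis i 1) (mi_word \<alpha>)"

lemma mi_dirs: "set (mi_dirs \<alpha>) \<subseteq> Basis" "length (mi_dirs \<alpha>) = mi_size \<alpha>"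
  by (auto simp: mi_dirs_def length_mi_word axis_in_Basis_iff)

section \<open>The solution formula on the domain\<close>

lemma closure_upper_half_space:
  "closure (upper_half_space :: ((real^'n) \<times> real) set) \<subseteq> {p. 0 \<le> snd p}"
  by (rule closure_minimal) (auto simp: upper_half_space_def intro!: closed_Collect_le continuous_intros)

locale hyp_problem =
  fixes l :: real and m :: nat
    and \<Omega> :: "((real^'n) \<times> real) set"
    and a :: "('n \<Rightarrow> nat) \<Rightarrow> real^'n \<Rightarrow> complex"
    and f :: "(real^'n) \<times> real \<Rightarrow> complex"
    and w :: "real^'n \<Rightarrow> real \<Rightarrow> real \<Rightarrow> complex"
    and u :: "(real^'n) \<times> real \<Rightarrow> complex"
  assumes l: "l > -2"
    and domain: "half_space_domain \<Omega>" "backward_time_connected \<Omega>"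
    and coeffs: "\<And>\<alpha>. mi_size \<alpha> \<le> m \<Longrightarrow> Cinf_on (fst ` \<Omega>) (a \<alpha>)"
    and w_reg: "\<And>x0 t0. (x0, t0) \<in> \<Omega> \<Longrightarrow> t0 > 0 \<Longrightarrow>
          \<exists>U. open U \<and> x0 \<in> U \<and> Cm20_on m U (phi l t0) t0 w"
    and w_eq: "\<And>x r b. (x, r) \<in> phi_image l \<Omega> \<Longrightarrow> (x, b) \<in> \<Omega> \<Longrightarrow>
          deriv_within {0..} 2 (\<lambda>\<rho>. w x \<rho> b) r - pdo m a (\<lambda>y. w y r b) x = 0"
    and w_init0: "\<And>x b. (x, b) \<in> \<Omega> \<Longrightarrow> w x 0 b = f (x, b)"
    and w_init1: "\<And>x b. (x, b) \<in> \<Omega> \<Longrightarrow> deriv_within {0..} 1 (\<lambda>\<rho>. w x \<rho> b) 0 = 0"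
    and u: "\<And>x t. (x, t) \<in> \<Omega> \<Longrightarrow> u (x, t) = transform l w (x, t)"
begin

text \<open>A box on which the one-point theory applies uniformly: below its top \<open>T\<close> it lies in \<open>\<Omega>\<close>, and \<open>w\<close> is
  regular on all of it. The bottom \<open>t = 0\<close> need not belong to \<open>\<Omega>\<close>.\<close>
definition chart :: "(real^'n) set \<Rightarrow> real \<Rightarrow> bool" where
  "chart U T \<longleftrightarrow> 0 < T \<and> open U \<and> U \<times> {0<..T} \<subseteq> \<Omega> \<and> Cm20_on m U (phi l T) T w"

text \<open>The second \<open>r\<close>-derivative of \<open>w\<close>, expressed by the equation for \<open>w\<close>. In contrast to the one-sided
  derivatives relative to \<open>[0, R]\<close> this form is independent of the box.\<close>
definition Aw :: "real^'n \<Rightarrow> real \<Rightarrow> real \<Rightarrow> complex" where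
  "Aw x r b = pdo m a (\<lambda>y. w y r b) x"

definition Dw :: "(real^'n) list \<Rightarrow> real^'n \<Rightarrow> real \<Rightarrow> real \<Rightarrow> complex" where
  "Dw vs x r b = dir_derivs vs (\<lambda>y. w y r b) x"

text \<open>By Duhamel's formula the candidates for the time derivatives of \<open>u\<close>: they are given by global
  formulas, so that it suffices to verify them in one box around each point.\<close>
definition utt :: "(real^'n) \<times> real \<Rightarrow> complex" where
  "utt = (\<lambda>(x, t). w x 0 t + t powr l *\<^sub>R transform l Aw (x, t))"

definition ut :: "(real^'n) \<times> real \<Rightarrow> complex" where
  "ut = (\<lambda>(x, t). integral {0..t} (\<lambda>s. utt (x, s)))"

lemma Omega_nonneg: "(x, t) \<in> \<Omega> \<Longrightarrow> 0 \<le> t"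
  using domain(1) closure_upper_half_space unfolding half_space_domain_def openin_open by auto

text \<open>\<open>\<Omega>\<close> is relatively open, so it contains a point \<open>(x0, T)\<close> strictly above \<open>(x0, t0)\<close> and, near it, the
  points \<open>(x, T)\<close>; backward connectedness adds everything below. This works for \<open>t0 = 0\<close> as well.\<close>
lemma chart_exists:
  assumes p: "(x0, t0) \<in> \<Omega>"
  obtains U T where "chart U T" "x0 \<in> U" "t0 < T"
proof -
  obtain V where V: "open V" "\<Omega> = closure upper_half_space \<inter> V"
    using domain(1) unfolding half_space_domain_def openin_open by auto
  then obtain A B where AB: "open A" "open B" "(x0, t0) \<in> A \<times> B" "A \<times> B \<subseteq> V"
    using p open_prod_elim[OF V(1), of "(x0, t0)"] by auto
  obtain e where e: "e > 0" "ball t0 e \<subseteq> B" using AB openE by blast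
  define T where "T = t0 + e / 2"
  have t0: "0 \<le> t0" using Omega_nonneg[OF p] .
  have T: "0 < T" "t0 < T" "T \<in> B" using e t0 by (auto simp: T_def dist_norm)
  have AT: "(x, T) \<in> \<Omega>" if "x \<in> A" for x
  proof -
    have "(x, T) \<in> V" using AB(4) that T by auto
    moreover have "(x, T) \<in> closure upper_half_space"
      using T by (intro subsetD[OF closure_subset]) (simp add: upper_half_space_def)
    ultimately show ?thesis using V by simp
  qed
  have xA: "x0 \<in> A" using AB by auto
  obtain U where U: "open U" "x0 \<in> U" "Cm20_on m U (phi l T) T w"
    using w_reg[OF AT[OF xA] T(1)] by blast
  have "(A \<inter> U) \<times> {0<..T} \<subseteq> \<Omega>"
    using AT domain(2) unfolding backward_time_connected_def by fastforce
  moreover have "Cm20_on m (A \<inter> U) (phi l T) T w"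
  proof -
    have s1: "continuous_on ((A \<inter> U) \<times> X) g" if "continuous_on (U \<times> X) g"
      for X :: "(real \<times> real) set" and g :: "(real^'n) \<times> real \<times> real \<Rightarrow> complex"
      using that by (rule continuous_on_subset) auto
    have s2: "Ck_on m (A \<inter> U) g" if "Ck_on m U g" for g :: "real^'n \<Rightarrow> complex"
      using that unfolding Ck_on_eq_Ck_dir by (rule Ck_dir_mono) auto
    show ?thesis using U(3) unfolding Cm20_on_def by (auto intro: s1 s2)
  qed
  ultimately have "chart (A \<inter> U) T" using T AB U by (auto simp: chart_def)
  then show thesis by (rule that) (use xA U T in auto)
qed

context
  fixes U T assumes chart: "chart U T"
begin

interpretation hyp_time l T
  using chart l by unfold_locales (simp_all add: chart_def)

lemma chart_facts:
  shows U_open: "open U" and chart_sub: "\<And>x t. x \<in> U \<Longrightarrow> 0 < t \<Longrightarrow> t \<le> T \<Longrightarrow> (x, t) \<in> \<Omega>"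
    and chart_reg: "Cm20_on m U (phi l T) T w"
  using chart by (auto simp: chart_def)

lemma Dw_cont:
  assumes "set vs \<subseteq> Basis" "length vs \<le> m"
  shows "continuous_on (U \<times> slab) (\<lambda>(x, r, b). Dw vs x r b)"
  using chart_reg assms unfolding Cm20_on_def Dw_def slab_def by blast

lemma w_cont: "continuous_on (U \<times> slab) (\<lambda>(x, r, b). w x r b)"
  using Dw_cont[of "[]"] by (simp add: Dw_def)

lemma Aw_eq_sum: "Aw x r b = (\<Sum>\<alpha> | mi_size \<alpha> \<le> m. a \<alpha> x * Dw (mi_dirs \<alpha>) x r b)"
  by (simp add: Aw_def pdo_def mi_deriv_def Dw_def mi_dirs_def)

lemma a_cont:
  assumes "mi_size \<alpha> \<le> m" shows "continuous_on U (a \<alpha>)"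
proof -
  have "continuous_on (fst ` \<Omega>) (a \<alpha>)"
    using coeffs[OF assms] unfolding Cinf_on_def Ck_on_eq_Ck_dir using Ck_dir_0 by blast
  moreover have "U \<subseteq> fst ` \<Omega>" using chart_sub T by force
  ultimately show ?thesis by (rule continuous_on_subset)
qed

lemma Aw_cont: "continuous_on (U \<times> slab) (\<lambda>(x, r, b). Aw x r b)"
proof -
  have "continuous_on (U \<times> slab) (\<lambda>p. a \<alpha> (fst p) * (\<lambda>(x, r, b). Dw (mi_dirs \<alpha>) x r b) p)" if "mi_size \<alpha> \<le> m" for \<alpha>
    by (intro continuous_on_mult continuous_on_compose2[OF a_cont[OF that]] Dw_cont mi_dirs continuous_intros)
      (use that in \<open>auto simp: mi_dirs(2)\<close>)
  then show ?thesis unfolding Aw_eq_sum case_prod_unfold by (intro continuous_on_sum) auto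
qed

text \<open>The regularity of \<open>w\<close> refers to derivatives relative to \<open>[0, R]\<close>, the equation and the condition at
  \<open>r = 0\<close> to derivatives relative to \<open>[0, \<infinity>)\<close>. Both agree for \<open>0 < r < R\<close>, since they are then
  two-sided, and for first derivatives at \<open>r = 0\<close>.\<close>
lemma w_profile:
  assumes x: "x \<in> U" and b: "0 < b" "b \<le> T"
  shows "C2_profile (\<lambda>r. w x r b) (deriv_within {0..phi l T} 1 (\<lambda>r. w x r b)) (\<lambda>r. Aw x r b) (phi l T)"
proof -
  define R where "R = phi l T"
  define g where "g = (\<lambda>r. w x r b)"
  have R: "R > 0" using phi_pos[OF l T] by (simp add: R_def)
  have xb: "(x, b) \<in> \<Omega>" and xT: "(x, T) \<in> \<Omega>" using chart_sub x b T by auto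
  have diff: "deriv_within {0..R} j g differentiable (at r within {0..R})" if "j < 2" "r \<in> {0..R}" for j r
    using chart_reg x b that unfolding Cm20_on_def R_def g_def by auto
  have cont: "continuous_on {0..R} (deriv_within {0..R} j g)" if "j \<le> 2" for j
  proof -
    have "continuous_on (U \<times> {0..R} \<times> {0..T}) (\<lambda>(x, r, b). deriv_within {0..R} j (\<lambda>\<rho>. w x \<rho> b) r)"
      using chart_reg that unfolding Cm20_on_def R_def by auto
    then have "continuous_on {0..R} (\<lambda>r. (\<lambda>(x, r, b). deriv_within {0..R} j (\<lambda>\<rho>. w x \<rho> b) r) (x, r, b))"
      by (rule continuous_on_compose2) (use x b in \<open>auto intro!: continuous_intros\<close>)
    then show ?thesis by (simp add: g_def)
  qed
  have int: "at r within {0..R} = at r" "at r within {0..} = at r" if "0 < r" "r < R" for r :: real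
  proof -
    show "at r within {0..R} = at r" using that by (rule at_within_Icc_at)
    show "at r within {0..} = at r" by (rule at_within_nhd[of _ "{0<..}"]) (use that in auto)
  qed
  have hd: "(deriv_within {0..R} j g has_vector_derivative deriv_within {0..R} (Suc j) g r) (at r)"
    if "j < 2" "0 < r" "r < R" for j r
    using diff[of j r] that by (simp add: vector_derivative_works int)
  have d2: "deriv_within {0..R} 2 g r = Aw x r b" if r: "0 < r" "r < R" for r
  proof -
    have "deriv_within {0..} 1 g \<rho> = deriv_within {0..R} 1 g \<rho>" if "0 < \<rho>" "\<rho> < R" for \<rho>
      using that by (simp add: int)
    moreover have "eventually (\<lambda>\<rho>. \<rho> \<in> {0<..<R}) (nhds r)"
      using r by (intro eventually_nhds_in_open) auto
    ultimately have "eventually (\<lambda>\<rho>. deriv_within {0..R} 1 g \<rho> = deriv_within {0..} 1 g \<rho>) (nhds r)"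
      by (auto elim!: eventually_mono)
    then have "vector_derivative (deriv_within {0..R} 1 g) (at r) = vector_derivative (deriv_within {0..} 1 g) (at r)"
      by (intro vector_derivative_cong_eq) auto
    then have "deriv_within {0..R} 2 g r = deriv_within {0..} 2 g r"
      using r by (simp add: numeral_2_eq_2 int)
    moreover have "(x, r) \<in> phi_image l \<Omega>"
      using xT r by (force simp: phi_image_def R_def)
    ultimately show ?thesis using w_eq[OF _ xb] by (simp add: Aw_def g_def)
  qed
  have "at 0 within {0..R} = at (0::real) within {0..}"
    by (rule at_within_nhd[of _ "{..<R}"]) (use R in auto)
  then have d1: "deriv_within {0..R} 1 g 0 = 0"
    using w_init1[OF xb] by (simp add: g_def)
  have cA: "continuous_on {0..R} (\<lambda>r. Aw x r b)"
    unfolding R_def by (rule profile_cont[OF slice_cont[OF Aw_cont x]]) (use b in auto)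
  have "C2_profile g (deriv_within {0..R} 1 g) (\<lambda>r. Aw x r b) R"
  proof
    show "continuous_on {0..R} g" using cont[of 0] by simp
    show "continuous_on {0..R} (deriv_within {0..R} 1 g)" using cont[of 1] by simp
    show "(g has_vector_derivative deriv_within {0..R} 1 g r) (at r)" if "0 < r" "r < R" for r
      using hd[of 0 r] that by simp
    show "(deriv_within {0..R} 1 g has_vector_derivative Aw x r b) (at r)" if "0 < r" "r < R" for r
      using hd[of 1 r] d2 that by (simp add: numeral_2_eq_2)
  qed (fact cA d1)+
  then show ?thesis by (simp add: g_def R_def)
qed

lemma transform_chart:
  assumes "continuous_on (U \<times> slab) (\<lambda>(x, r, b). h x r b)" "x \<in> U" "t \<in> {0..T}"
  shows "transform_converges l h (x, t)" "transform l h (x, t) = hmean l (h x) t"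
  using transform_hmean[of h x t] slice_cont[OF assms(1,2)] assms(3) by auto

lemma transform_cont:
  assumes "continuous_on (U \<times> slab) (\<lambda>(x, r, b). h x r b)"
  shows "continuous_on (U \<times> {0..T}) (transform l h)"
  using hmean_joint_cont[OF assms]
  by (rule continuous_on_eq) (use transform_chart(2)[OF assms] in auto)

lemma transform_w_converges: "x \<in> U \<Longrightarrow> t \<in> {0..T} \<Longrightarrow> transform_converges l w (x, t)"
  by (rule transform_chart(1)[OF w_cont])

lemma Dw_transform_cont:
  assumes "set vs \<subseteq> Basis" "length vs \<le> m"
  shows "continuous_on (U \<times> {0..T}) (transform l (Dw vs))"
  by (rule transform_cont[OF Dw_cont[OF assms]])

text \<open>For a fixed point \<open>x\<close> the coefficients are constants, with which the transform commutes.\<close>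
lemma Aw_transform:
  assumes x: "x \<in> U" and t: "t \<in> {0..T}"
  shows "transform l Aw (x, t) = (\<Sum>\<alpha> | mi_size \<alpha> \<le> m. a \<alpha> x * transform l (Dw (mi_dirs \<alpha>)) (x, t))"
proof -
  have c: "continuous_on (U \<times> slab) (\<lambda>(x, r, b). Dw (mi_dirs \<alpha>) x r b)" if "mi_size \<alpha> \<le> m" for \<alpha>
    using that by (intro Dw_cont) (simp_all add: mi_dirs)
  have "transform l Aw (x, t) = hmean l (Aw x) t" by (rule transform_chart(2)[OF Aw_cont x t])
  also have "\<dots> = hmean l (\<lambda>r b. \<Sum>\<alpha> | mi_size \<alpha> \<le> m. a \<alpha> x * Dw (mi_dirs \<alpha>) x r b) t"
    by (simp add: Aw_eq_sum[abs_def])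
  also have "\<dots> = (\<Sum>\<alpha> | mi_size \<alpha> \<le> m. a \<alpha> x * hmean l (Dw (mi_dirs \<alpha>) x) t)"
    by (rule hmean_sum) (use finite_multi_indices slice_cont[OF c x] t in auto)
  also have "\<dots> = (\<Sum>\<alpha> | mi_size \<alpha> \<le> m. a \<alpha> x * transform l (Dw (mi_dirs \<alpha>)) (x, t))"
    by (intro sum.cong refl) (simp add: transform_chart(2)[OF c x t])
  finally show ?thesis .
qed

lemma transform_Dw_deriv:
  assumes v: "v \<in> Basis" and vs: "set vs \<subseteq> Basis" "length vs < m" and x: "x \<in> U" and t: "t \<in> {0..T}"
  shows "((\<lambda>s. transform l (Dw vs) (x + s *\<^sub>R v, t)) has_vector_derivative transform l (Dw (v # vs)) (x, t)) (at 0)"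
proof -
  have c: "continuous_on (U \<times> slab) (\<lambda>(x, r, b). Dw vs x r b)"
      "continuous_on (U \<times> slab) (\<lambda>(x, r, b). Dw (v # vs) x r b)"
    using v vs by (auto intro!: Dw_cont)
  have "((\<lambda>s. hmean l (Dw vs (x + s *\<^sub>R v)) t) has_vector_derivative hmean l (Dw (v # vs) x) t) (at 0)"
  proof (rule hmean_dir_deriv[OF U_open c _ x t])
    fix y r b assume y: "y \<in> U" "(r, b) \<in> slab"
    then have "Ck_dir Basis m U (\<lambda>x. w x r b)"
      using chart_reg unfolding Cm20_on_def Ck_on_eq_Ck_dir slab_def by auto
    then have "(\<lambda>s. dir_derivs vs (\<lambda>x. w x r b) (y + s *\<^sub>R v)) differentiable (at 0)"
      using v vs y unfolding Ck_dir_def by blast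
    from dir_deriv_has[OF this]
    show "((\<lambda>s. Dw vs (y + s *\<^sub>R v) r b) has_vector_derivative Dw (v # vs) y r b) (at 0)"
      by (simp add: Dw_def)
  qed
  moreover have "((\<lambda>s. hmean l (Dw vs (x + s *\<^sub>R v)) t) has_vector_derivative d) (at 0)
      \<longleftrightarrow> ((\<lambda>s. transform l (Dw vs) (x + s *\<^sub>R v, t)) has_vector_derivative d) (at 0)" for d
    by (rule line_derivative_cong[OF U_open x, where g = "\<lambda>y. hmean l (Dw vs y) t"
        and h = "\<lambda>y. transform l (Dw vs) (y, t)"]) (simp add: transform_chart(2)[OF c(1) _ t])
  ultimately show ?thesis by (simp add: transform_chart(2)[OF c(2) x t])
qed

lemma w0_cont: "continuous_on (U \<times> {0..T}) (\<lambda>(x, t). w x 0 t)"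
proof -
  have "continuous_on (U \<times> {0..T}) (\<lambda>p. (\<lambda>(x, r, b). w x r b) (fst p, 0, snd p))"
    by (rule continuous_on_compose2[OF w_cont])
      (use phi_pos[OF l T] in \<open>auto simp: slab_def intro!: continuous_intros\<close>)
  then show ?thesis by (simp add: case_prod_unfold)
qed

lemma utt_cont: "continuous_on (U \<times> {0..T}) utt"
proof -
  have "continuous_on (U \<times> {0..T}) (\<lambda>p. (\<lambda>(x, t). w x 0 t) p + (\<lambda>(x, t). t powr l *\<^sub>R hmean l (Aw x) t) p)"
    by (intro continuous_on_add w0_cont source_joint_cont Aw_cont)
  then show ?thesis
    by (rule continuous_on_eq) (auto simp: utt_def transform_chart(2)[OF Aw_cont])
qed

lemma utt_slice:
  assumes "x \<in> U" shows "continuous_on {0..T} (\<lambda>s. utt (x, s))"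
  by (rule continuous_on_compose2[OF utt_cont]) (use assms in \<open>auto intro!: continuous_intros\<close>)

lemma ut_cont: "continuous_on (U \<times> {0..T}) ut"
proof -
  have "continuous_on (U \<times> {0..T}) (\<lambda>p. integral {0..snd p} ((\<lambda>p s. utt (fst p, s)) p))"
  proof (rule continuous_on_moving_integral)
    show "continuous_on (SIGMA p:U \<times> {0..T}. {0..snd p}) (\<lambda>(p, s). utt (fst p, s))"
      unfolding case_prod_unfold
      by (rule continuous_on_compose2[OF utt_cont]) (auto intro!: continuous_intros)
  qed (auto intro!: continuous_intros)
  then show ?thesis by (simp add: ut_def case_prod_unfold)
qed

lemma transform_w_duhamel:
  assumes x: "x \<in> U" and t: "t \<in> {0..T}"
  shows "transform l w (x, t) = integral {0..t} (\<lambda>s. (t - s) *\<^sub>R utt (x, s))"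
proof -
  have "transform l w (x, t) = hmean l (w x) t" by (rule transform_chart(2)[OF w_cont x t])
  also have "\<dots> = integral {0..t} (\<lambda>s. (t - s) *\<^sub>R (w x 0 s + s powr l *\<^sub>R hmean l (Aw x) s))"
    by (rule hmean_duhamel[OF slice_cont[OF w_cont x] slice_cont[OF Aw_cont x] w_profile[OF x]]) (use t in auto)
  also have "\<dots> = integral {0..t} (\<lambda>s. (t - s) *\<^sub>R utt (x, s))"
    by (rule integral_cong) (use t in \<open>auto simp: utt_def transform_chart(2)[OF Aw_cont x]\<close>)
  finally show ?thesis .
qed

lemma transform_w_t_deriv:
  assumes x: "x \<in> U" and t: "t \<in> {0..T}"
  shows "((\<lambda>s. transform l w (x, s)) has_vector_derivative ut (x, t)) (at t within {0..T})"
proof -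
  have d: "((\<lambda>t. integral {0..t} (\<lambda>s. (t - s) *\<^sub>R utt (x, s))) has_vector_derivative ut (x, t)) (at t within {0..T})"
    using double_primitive_deriv[OF utt_slice[OF x] t] by (simp add: ut_def)
  show ?thesis
    by (rule has_vector_derivative_transform[OF t _ d]) (rule transform_w_duhamel[OF x])
qed

lemma ut_t_deriv:
  assumes x: "x \<in> U" and t: "t \<in> {0..T}"
  shows "((\<lambda>s. ut (x, s)) has_vector_derivative utt (x, t)) (at t within {0..T})"
  using integral_has_vector_derivative[OF utt_slice[OF x] t] by (simp add: ut_def)

lemma transform_w_cont: "continuous_on (U \<times> {0..T}) (transform l w)"
  by (rule transform_cont[OF w_cont])

end

end

section \<open>Continuity, initial values and the equation\<close>

lemma set_integral_eq_on_open_subset: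
  fixes g :: "'a::euclidean_space \<Rightarrow> complex"
  assumes "W \<subseteq> \<Omega>" "\<And>p. p \<in> \<Omega> - W \<Longrightarrow> g p = 0"
  shows "(LINT p:\<Omega>|lborel. g p) = (LINT p:W|lborel. g p)"
  unfolding set_lebesgue_integral_def
  by (rule Bochner_Integration.integral_cong) (use assms in \<open>auto simp: indicator_def\<close>)

context hyp_problem begin

text \<open>A function on \<open>\<Omega>\<close> given by a formula that is continuous on closed boxes has the value of that
  formula as its limit, also at points \<open>(x0, 0)\<close> outside \<open>\<Omega>\<close>.\<close>
lemma chart_tendsto:
  assumes c: "chart U T" "x0 \<in> U" "t0 < T" "0 \<le> t0"
    and g: "continuous_on (U \<times> {0..T}) g" and h: "\<And>p. p \<in> \<Omega> \<Longrightarrow> h p = g p"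
  shows "(h \<longlongrightarrow> g (x0, t0)) (at (x0, t0) within \<Omega>)"
proof -
  have "(g \<longlongrightarrow> g (x0, t0)) (at (x0, t0) within U \<times> {0..T})"
    using g c by (simp add: continuous_on_def)
  then have "(g \<longlongrightarrow> g (x0, t0)) (at (x0, t0) within \<Omega> \<inter> U \<times> {0..T})"
    by (rule tendsto_within_subset) auto
  moreover have "at (x0, t0) within \<Omega> \<inter> U \<times> {0..T} = at (x0, t0) within \<Omega>"
  proof -
    have "open (U \<times> {..<T})" using c(1) by (auto simp: chart_def intro: open_Times)
    then show ?thesis
      using c Omega_nonneg by (intro at_within_nhd[of _ "U \<times> {..<T}"]) auto
  qed
  ultimately have "(g \<longlongrightarrow> g (x0, t0)) (at (x0, t0) within \<Omega>)" by simp
  moreover have "eventually (\<lambda>p. h p = g p) (at (x0, t0) within \<Omega>)"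
    using h by (simp add: eventually_at_filter)
  ultimately show ?thesis by (simp add: tendsto_cong)
qed

lemma continuous_on_Omega:
  assumes g: "\<And>U T. chart U T \<Longrightarrow> continuous_on (U \<times> {0..T}) g" and h: "\<And>p. p \<in> \<Omega> \<Longrightarrow> h p = g p"
  shows "continuous_on \<Omega> h"
  unfolding continuous_on_def
proof
  fix p assume p: "p \<in> \<Omega>"
  obtain x0 t0 where pe: "p = (x0, t0)" by (cases p)
  obtain U T where c: "chart U T" "x0 \<in> U" "t0 < T" using chart_exists p pe by blast
  have "(h \<longlongrightarrow> g (x0, t0)) (at (x0, t0) within \<Omega>)"
    by (rule chart_tendsto[OF c _ g[OF c(1)] h]) (use Omega_nonneg p pe in auto)
  then show "(h \<longlongrightarrow> h p) (at p within \<Omega>)" using h[OF p] pe by simp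
qed

lemma initial_value_zero:
  assumes x: "x \<in> fst ` \<Omega>" and g: "\<And>U T. chart U T \<Longrightarrow> continuous_on (U \<times> {0..T}) g"
    and h: "\<And>p. p \<in> \<Omega> \<Longrightarrow> h p = g p" and g0: "g (x, 0) = 0"
  shows "has_initial_value h \<Omega> x 0"
proof -
  obtain t where t: "(x, t) \<in> \<Omega>" using x by auto
  obtain U T where c: "chart U T" "x \<in> U" "t < T" using chart_exists t by blast
  have "0 < T" using c(1) by (simp add: chart_def)
  from chart_tendsto[OF c(1,2) this order_refl g[OF c(1)] h] show ?thesis
    using h g0 by (simp add: has_initial_value_def)
qed

lemma transform_w_0: "transform l w (x, 0) = 0"
  using LINT_Ioc_Icc(1)[where t = 0 and f = "inner_integral l w x 0"]
  by (simp add: transform_def set_lebesgue_integral_def)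

lemma ut_0: "ut (x, 0) = 0"
  by (simp add: ut_def)

text \<open>Test functions are supported in this set, on which the time is positive.\<close>
abbreviation W :: "((real^'n) \<times> real) set" where "W \<equiv> interior \<Omega>"

lemma W_chart:
  assumes p: "(x0, t0) \<in> W"
  obtains U T where "chart U T" "x0 \<in> U" "0 < t0" "t0 < T" "U \<times> {0<..<T} \<subseteq> W"
proof -
  have p': "(x0, t0) \<in> \<Omega>" using p interior_subset by auto
  obtain A B where AB: "open A" "open B" "(x0, t0) \<in> A \<times> B" "A \<times> B \<subseteq> W"
    using open_prod_elim[OF open_interior p] by metis
  then obtain e where e: "e > 0" "ball t0 e \<subseteq> B" using openE by blast
  have "(x0, t0 - e / 2) \<in> A \<times> B" using AB e by (auto simp: dist_norm)
  then have "(x0, t0 - e / 2) \<in> \<Omega>" using AB interior_subset by blast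
  then have t0: "0 < t0" using Omega_nonneg e by fastforce
  obtain U T where c: "chart U T" "x0 \<in> U" "t0 < T" using chart_exists p' by blast
  have "U \<times> {0<..<T} \<subseteq> W"
    by (rule interior_maximal) (use c(1) in \<open>auto simp: chart_def intro!: open_Times\<close>)
  then show thesis using that c t0 by blast
qed

lemma continuous_on_W:
  assumes g: "\<And>U T. chart U T \<Longrightarrow> continuous_on (U \<times> {0..T}) g"
  shows "continuous_on W g"
proof -
  have "continuous_on \<Omega> g" by (rule continuous_on_Omega[OF g refl])
  then show ?thesis by (rule continuous_on_subset) (rule interior_subset)
qed

lemma u_W: "p \<in> W \<Longrightarrow> u p = transform l w p"
  using u interior_subset by (cases p) auto

lemma W_has_time_deriv:
  assumes p: "p \<in> W" and eq: "\<And>q. q \<in> W \<Longrightarrow> h q = g q"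
    and d: "\<And>U T x t. chart U T \<Longrightarrow> x \<in> U \<Longrightarrow> t \<in> {0..T} \<Longrightarrow>
       ((\<lambda>s. g (x, s)) has_vector_derivative g' (x, t)) (at t within {0..T})"
  shows "((\<lambda>s. h (p + s *\<^sub>R (0, 1))) has_vector_derivative g' p) (at 0)"
proof -
  obtain x t where pe: "p = (x, t)" by (cases p)
  obtain U T where c: "chart U T" "x \<in> U" "0 < t" "t < T" using W_chart p pe by metis
  have "((\<lambda>s. g (x, s)) has_vector_derivative g' (x, t)) (at t)"
    using d[OF c(1,2), of t] c by (simp add: at_within_Icc_at)
  then have "((\<lambda>s. g (x, s)) has_vector_derivative g' (x, t)) (at (t + 0))" by simp
  moreover have "((\<lambda>s. t + s) has_vector_derivative 1) (at 0)"
    by (auto intro!: derivative_eq_intros)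
  ultimately have "((\<lambda>s. g (x, t + s)) has_vector_derivative g' (x, t)) (at 0)"
    using vector_diff_chain_at[of "\<lambda>s. t + s" 1 0 "\<lambda>s. g (x, s)" "g' (x, t)"] by (simp add: o_def)
  then have "((\<lambda>s. g (p + s *\<^sub>R (0, 1))) has_vector_derivative g' p) (at 0)"
    by (simp add: pe)
  then show ?thesis
    by (subst line_derivative_cong[OF open_interior p eq])
qed

lemma u_time_derivs:
  assumes p: "p \<in> W"
  shows "dir_derivs [(0, 1)] u p = ut p" "dir_derivs [(0, 1), (0, 1)] u p = utt p"
    and "Ck_dir {(0, 1)} 2 W u"
proof -
  have d1: "((\<lambda>s. u (q + s *\<^sub>R (0, 1))) has_vector_derivative ut q) (at 0)" if "q \<in> W" for q
    by (rule W_has_time_deriv[OF that u_W transform_w_t_deriv])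
  have d2: "((\<lambda>s. ut (q + s *\<^sub>R (0, 1))) has_vector_derivative utt q) (at 0)" if "q \<in> W" for q
    by (rule W_has_time_deriv[OF that refl ut_t_deriv])
  have e1: "dir_deriv (0, 1) u q = ut q" if "q \<in> W" for q by (rule dir_deriv_eqI[OF d1[OF that]])
  then show "dir_derivs [(0, 1)] u p = ut p" using p by simp
  have "dir_deriv (0, 1) (dir_deriv (0, 1) u) p = dir_deriv (0, 1) ut p"
    by (rule dir_deriv_cong[OF open_interior p e1])
  also have "\<dots> = utt p" by (rule dir_deriv_eqI[OF d2[OF p]])
  finally show "dir_derivs [(0, 1), (0, 1)] u p = utt p" by simp
  have cu: "continuous_on W u"
    using continuous_on_W[OF transform_w_cont] u_W by (metis (mono_tags, lifting) continuous_on_cong)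
  have cut: "continuous_on W ut" and cJ: "continuous_on W utt"
    by (rule continuous_on_W, rule ut_cont, assumption, rule continuous_on_W, rule utt_cont, assumption)
  have "Ck_dir {(0, 1)} (Suc 0) W ut"
  proof (rule Ck_dir_SucI[where g' = "\<lambda>_. utt", OF open_interior cut])
    show "((\<lambda>s. ut (q + s *\<^sub>R v)) has_vector_derivative utt q) (at 0)" if "v \<in> {(0, 1)}" "q \<in> W" for v q
      using d2[OF that(2)] that(1) by (simp only: singleton_iff)
  qed (simp add: Ck_dir_0 cJ)
  then have "Ck_dir {(0, 1)} (Suc (Suc 0)) W u"
  proof (intro Ck_dir_SucI[where g' = "\<lambda>_. ut", OF open_interior cu])
    show "((\<lambda>s. u (q + s *\<^sub>R v)) has_vector_derivative ut q) (at 0)" if "v \<in> {(0, 1)}" "q \<in> W" for v q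
      using d1[OF that(2)] that(1) by (simp only: singleton_iff)
  qed
  then show "Ck_dir {(0, 1)} 2 W u" by (simp add: numeral_2_eq_2)
qed

definition lift :: "real^'n \<Rightarrow> (real^'n) \<times> real" where "lift v = (v, 0)"

lemma W_has_space_deriv:
  assumes p: "p \<in> W" and v: "v \<in> Basis" and vs: "set vs \<subseteq> Basis" "length vs < m"
  shows "((\<lambda>s. transform l (Dw vs) (p + s *\<^sub>R lift v)) has_vector_derivative transform l (Dw (v # vs)) p) (at 0)"
proof -
  obtain x t where pe: "p = (x, t)" by (cases p)
  obtain U T where c: "chart U T" "x \<in> U" "0 < t" "t < T" using W_chart p pe by metis
  show ?thesis
    using transform_Dw_deriv[OF c(1) v vs c(2), of t] c by (simp add: pe lift_def)
qed

lemma u_space_derivs: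
  assumes vs: "set vs \<subseteq> Basis" "length vs \<le> m" and p: "p \<in> W"
  shows "dir_derivs (map lift vs) u p = transform l (Dw vs) p"
  using vs p
proof (induction vs arbitrary: p)
  case Nil
  have "Dw [] = w" by (intro ext) (simp add: Dw_def)
  then show ?case using u_W Nil by simp
next
  case (Cons v vs)
  have "dir_derivs (map lift (v # vs)) u p = dir_deriv (lift v) (transform l (Dw vs)) p"
    unfolding list.map dir_derivs.simps
    by (rule dir_deriv_cong[OF open_interior Cons.prems(3)]) (use Cons in auto)
  also have "\<dots> = transform l (Dw (v # vs)) p"
    by (rule dir_deriv_eqI[OF W_has_space_deriv]) (use Cons.prems in auto)
  finally show ?case .
qed

lemma words_lift:
  assumes "set ws \<subseteq> lift ` Basis"
  obtains vs where "ws = map lift vs" "set vs \<subseteq> Basis"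
proof
  have "(lift \<circ> fst) v = v" if "v \<in> set ws" for v using assms that by (auto simp: lift_def)
  then have "map (lift \<circ> fst) ws = ws" by (rule map_idI)
  then show "ws = map lift (map fst ws)" by simp
  show "set (map fst ws) \<subseteq> Basis" using assms by (auto simp: lift_def)
qed

lemma u_space_Ck: "Ck_dir (lift ` Basis) m W u"
  unfolding Ck_dir_def
proof (intro conjI allI impI ballI)
  fix ws assume ws: "set ws \<subseteq> lift ` Basis" "length ws \<le> m"
  then obtain vs where vs: "ws = map lift vs" "set vs \<subseteq> Basis" using words_lift by blast
  have "continuous_on W (transform l (Dw vs))"
    by (rule continuous_on_W) (use Dw_transform_cont vs ws in auto)
  then show "continuous_on W (dir_derivs ws u)"
    by (rule continuous_on_eq) (use u_space_derivs vs ws in auto)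
next
  fix ws v p assume ws: "set ws \<subseteq> lift ` Basis" "length ws < m" and v: "v \<in> lift ` Basis" and p: "p \<in> W"
  obtain vs where vs: "ws = map lift vs" "set vs \<subseteq> Basis" using words_lift ws by blast
  obtain v' where v': "v = lift v'" "v' \<in> Basis" using v by auto
  have "((\<lambda>s. transform l (Dw vs) (p + s *\<^sub>R v)) has_vector_derivative transform l (Dw (v' # vs)) p) (at 0)"
    unfolding v' by (rule W_has_space_deriv[OF p v'(2) vs(2)]) (use ws vs in simp)
  then have "((\<lambda>s. dir_derivs ws u (p + s *\<^sub>R v)) has_vector_derivative transform l (Dw (v' # vs)) p) (at 0)"
    by (subst line_derivative_cong[OF open_interior p]) (use u_space_derivs vs ws in auto)
  then show "(\<lambda>s. dir_derivs ws u (p + s *\<^sub>R v)) differentiable (at 0)"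
    by (rule differentiableI_vector)
qed

lemma dir_derivs_lift_fst: "dir_derivs (map lift vs) (\<lambda>p. g (fst p)) = (\<lambda>p. dir_derivs vs g (fst p))"
  by (induction vs) (auto simp: dir_deriv_def lift_def)

lemma coeff_Ck:
  assumes "mi_size \<alpha> \<le> m"
  shows "Ck_dir (lift ` Basis) k W (\<lambda>p. a \<alpha> (fst p))"
proof -
  have a: "Ck_dir Basis k (fst ` \<Omega>) (a \<alpha>)"
    using coeffs[OF assms] by (simp add: Cinf_on_def Ck_on_eq_Ck_dir)
  have sub: "fst ` W \<subseteq> fst ` \<Omega>" using interior_subset by auto
  show ?thesis
    unfolding Ck_dir_def
  proof (intro conjI allI impI ballI)
    fix ws assume ws: "set ws \<subseteq> lift ` Basis" "length ws \<le> k"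
    then obtain vs where vs: "ws = map lift vs" "set vs \<subseteq> Basis" using words_lift by blast
    have "continuous_on (fst ` \<Omega>) (dir_derivs vs (a \<alpha>))" using a vs ws by (simp add: Ck_dir_def)
    then show "continuous_on W (dir_derivs ws (\<lambda>p. a \<alpha> (fst p)))"
      unfolding vs(1) dir_derivs_lift_fst
      by (rule continuous_on_compose2) (use sub in \<open>auto intro!: continuous_intros\<close>)
  next
    fix ws v p assume ws: "set ws \<subseteq> lift ` Basis" "length ws < k" and v: "v \<in> lift ` Basis" and p: "p \<in> W"
    obtain vs where vs: "ws = map lift vs" "set vs \<subseteq> Basis" using words_lift ws by blast
    obtain v' where v': "v = lift v'" "v' \<in> Basis" using v by auto
    have "(\<lambda>s. dir_derivs vs (a \<alpha>) (fst p + s *\<^sub>R v')) differentiable (at 0)"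
    proof -
      have "fst p \<in> fst ` \<Omega>" using p sub by blast
      moreover have "length vs < k" using ws vs by simp
      ultimately show ?thesis using a vs(2) v'(2) unfolding Ck_dir_def by blast
    qed
    then show "(\<lambda>s. dir_derivs ws (\<lambda>p. a \<alpha> (fst p)) (p + s *\<^sub>R v)) differentiable (at 0)"
      unfolding vs(1) dir_derivs_lift_fst by (simp add: v' lift_def)
  qed
qed

lemma W_pos: "p \<in> W \<Longrightarrow> 0 < snd p"
  using W_chart[of "fst p" "snd p"] by (metis prod.collapse)

lemma lift_Basis: "lift ` Basis \<subseteq> Basis"
  by (auto simp: lift_def Basis_prod_def)

text \<open>Both terms are brought to the form \<open>\<integral> (\<dots>) \<psi>\<close> by moving the derivatives from the test function to \<open>u\<close>:
  two in time, giving \<open>u\<^sub>t\<^sub>t\<close>, and those of \<open>\<partial>\<^sup>\<alpha>\<close> in space, with \<open>a\<^sub>\<alpha> t\<^sup>l \<psi>\<close> as the test function. By \<open>Aw_transform\<close>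
  the spatial terms add up to \<open>t\<^sup>l\<close> times the transform of \<open>A w\<close>, which is the part of \<open>u\<^sub>t\<^sub>t\<close> beyond \<open>f\<close>.\<close>
theorem distributional_equation:
  assumes \<psi>: "\<psi> \<in> test_functions \<Omega>"
  shows "dist_tt (dist_of \<Omega> u) \<psi>
         - dist_mult (\<lambda>(x, t). complex_of_real (t powr l)) (dist_pdo m a (dist_of \<Omega> u)) \<psi>
       = dist_of \<Omega> f \<psi>"
proof -
  define K where "K = closure {p. \<psi> p \<noteq> 0}"
  have K: "compact K" "K \<subseteq> W" and \<psi>C: "\<And>k. Ck_dir Basis k UNIV \<psi>"
    using \<psi> by (auto simp: test_functions_def K_def Cinf_on_def Ck_on_eq_Ck_dir)
  have z: "\<psi> p = 0" if "p \<notin> K" for p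
    using that closure_subset[of "{p. \<psi> p \<noteq> 0}"] by (auto simp: K_def)
  have oK: "open (- K)" using compact_imp_closed[OF K(1)] by (simp add: open_Compl)
  have red: "(LINT p:\<Omega>|lborel. g p) = (LINT p:W|lborel. g p)" if "\<And>p. p \<notin> K \<Longrightarrow> g p = 0" for g :: "_ \<Rightarrow> complex"
    by (rule set_integral_eq_on_open_subset[OF interior_subset]) (use that K in auto)
  have c\<psi>: "continuous_on W \<psi>"
    using \<psi>C[of 0] by (auto simp: Ck_dir_0 intro: continuous_on_subset)
  have cpow: "continuous_on W (\<lambda>p. complex_of_real (snd p powr l))"
    by (intro continuous_intros) (use W_pos in force)
  have integ: "set_integrable lborel W (\<lambda>p. g p * \<psi> p)" if "continuous_on W g" for g
    by (rule compactly_supported_set_integrable[OF K continuous_on_mult[OF that c\<psi>]]) (simp add: z)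
  let ?AT = "\<lambda>p. snd p powr l *\<^sub>R transform l Aw p"
  have cJ: "continuous_on W utt" by (rule continuous_on_W[OF utt_cont])
  have cD: "continuous_on W (transform l (Dw (mi_dirs \<alpha>)))" if "mi_size \<alpha> \<le> m" for \<alpha>
    by (rule continuous_on_W[OF Dw_transform_cont]) (use that in \<open>simp_all add: mi_dirs\<close>)
  have ca: "continuous_on W (\<lambda>p. a \<alpha> (fst p))" if "mi_size \<alpha> \<le> m" for \<alpha>
    using coeff_Ck[OF that, of 0] by (simp add: Ck_dir_0)

  have tt: "dist_tt (dist_of \<Omega> u) \<psi> = (LINT p:W|lborel. utt p * \<psi> p)"
  proof -
    have "dist_tt (dist_of \<Omega> u) \<psi> = (LINT p:\<Omega>|lborel. u p * dir_derivs [(0, 1), (0, 1)] \<psi> p)"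
      by (simp add: dist_tt_def dist_derivs_def dist_of_def)
    also have "\<dots> = (LINT p:W|lborel. u p * dir_derivs [(0, 1), (0, 1)] \<psi> p)"
      by (rule red) (use dir_derivs_vanish[OF oK, of \<psi> _ "[(0, 1), (0, 1)]"] z in auto)
    also have "\<dots> = (-1) ^ length [(0 :: real^'n, 1 :: real), (0, 1)] *
        (LINT p:W|lborel. dir_derivs [(0, 1), (0, 1)] u p * \<psi> p)"
    proof (rule integration_by_parts_word[OF open_interior K, where B = "{(0, 1)}" and k = 2])
      show "Ck_dir {(0, 1)} 2 W u"
      proof (cases "W = {}")
        case True
        then show ?thesis by (simp add: Ck_dir_def)
      next
        case False
        then show ?thesis using u_time_derivs(3) by blast
      qed
      show "Ck_dir {(0, 1)} 2 W \<psi>" by (rule Ck_dir_mono[OF \<psi>C]) (auto simp: Basis_prod_def)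
    qed (use z in auto)
    also have "\<dots> = (LINT p:W|lborel. dir_derivs [(0, 1), (0, 1)] u p * \<psi> p)" by simp
    also have "\<dots> = (LINT p:W|lborel. utt p * \<psi> p)"
      by (rule set_lebesgue_integral_cong) (use u_time_derivs(2) in auto)
    finally show ?thesis .
  qed

  have adj: "dist_mult (\<lambda>(x, t). a \<alpha> x) (dist_derivs (map (\<lambda>i. (axis i 1, 0)) (mi_word \<alpha>)) (dist_of \<Omega> u))
        (\<lambda>p. (\<lambda>(x, t). complex_of_real (t powr l)) p * \<psi> p)
      = (LINT p:W|lborel. (a \<alpha> (fst p) * (complex_of_real (snd p powr l) * transform l (Dw (mi_dirs \<alpha>)) p)) * \<psi> p)"
    if \<alpha>: "mi_size \<alpha> \<le> m" for \<alpha>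
  proof -
    define \<eta> where "\<eta> p = a \<alpha> (fst p) * (complex_of_real (snd p powr l) * \<psi> p)" for p
    define ws where "ws = map lift (mi_dirs \<alpha>)"
    have ws: "map (\<lambda>i. (axis i 1, 0)) (mi_word \<alpha>) = ws"
      by (simp add: ws_def lift_def mi_dirs_def)
    have \<eta>z: "\<eta> p = 0" if "p \<notin> K" for p using z[OF that] by (simp add: \<eta>_def)
    have \<eta>C: "Ck_dir (lift ` Basis) m W \<eta>"
      unfolding \<eta>_def
    proof (intro Ck_dir_mult open_interior coeff_Ck \<alpha>)
      show "Ck_dir (lift ` Basis) m W (\<lambda>p. complex_of_real (snd p powr l))"
        by (rule Ck_dir_invariant[OF open_interior cpow]) (auto simp: lift_def)
      show "Ck_dir (lift ` Basis) m W \<psi>"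
        by (rule Ck_dir_mono[OF \<psi>C lift_Basis]) auto
    qed
    have "dist_mult (\<lambda>(x, t). a \<alpha> x) (dist_derivs ws (dist_of \<Omega> u))
        (\<lambda>p. (\<lambda>(x, t). complex_of_real (t powr l)) p * \<psi> p)
      = (-1) ^ length ws * (LINT p:\<Omega>|lborel. u p * dir_derivs ws \<eta> p)"
      by (simp add: dist_mult_def dist_derivs_def dist_of_def \<eta>_def[abs_def] case_prod_unfold)
    also have "(LINT p:\<Omega>|lborel. u p * dir_derivs ws \<eta> p) = (LINT p:W|lborel. u p * dir_derivs ws \<eta> p)"
      by (rule red) (use dir_derivs_vanish[OF oK, of \<eta> _ ws] \<eta>z in auto)
    also have "\<dots> = (-1) ^ length ws * (LINT p:W|lborel. dir_derivs ws u p * \<eta> p)"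
      by (rule integration_by_parts_word[OF open_interior K u_space_Ck \<eta>C])
        (use \<eta>z mi_dirs[of \<alpha>] \<alpha> in \<open>auto simp: ws_def\<close>)
    also have "(LINT p:W|lborel. dir_derivs ws u p * \<eta> p) =
        (LINT p:W|lborel. (a \<alpha> (fst p) * (complex_of_real (snd p powr l) * transform l (Dw (mi_dirs \<alpha>)) p)) * \<psi> p)"
      by (rule set_lebesgue_integral_cong)
        (use u_space_derivs[of "mi_dirs \<alpha>"] \<alpha> in \<open>auto simp: mi_dirs ws_def \<eta>_def\<close>)
    finally show ?thesis unfolding ws by (simp add: power_mult_distrib[symmetric] mult.assoc[symmetric])
  qed
  have AT: "?AT p = (\<Sum>\<alpha> | mi_size \<alpha> \<le> m. a \<alpha> (fst p) * (complex_of_real (snd p powr l) * transform l (Dw (mi_dirs \<alpha>)) p))"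
    if pW: "p \<in> W" for p
  proof -
    obtain x t where pe: "p = (x, t)" by (cases p)
    obtain U T where c: "chart U T" "x \<in> U" "0 < t" "t < T" using W_chart pW pe by metis
    show ?thesis
      using Aw_transform[OF c(1,2), of t] c
      by (simp add: pe scaleR_conv_of_real sum_distrib_left mult.left_commute)
  qed
  have pdo: "dist_mult (\<lambda>(x, t). complex_of_real (t powr l)) (dist_pdo m a (dist_of \<Omega> u)) \<psi>
      = (LINT p:W|lborel. ?AT p * \<psi> p)"
  proof -
    have "dist_mult (\<lambda>(x, t). complex_of_real (t powr l)) (dist_pdo m a (dist_of \<Omega> u)) \<psi>
      = (\<Sum>\<alpha> | mi_size \<alpha> \<le> m. LINT p:W|lborel.
          (a \<alpha> (fst p) * (complex_of_real (snd p powr l) * transform l (Dw (mi_dirs \<alpha>)) p)) * \<psi> p)"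
      unfolding dist_mult_def[of "\<lambda>(x, t). complex_of_real (t powr l)"] dist_pdo_def
      by (intro sum.cong refl adj) simp
    also have "\<dots> = (LINT p:W|lborel. \<Sum>\<alpha> | mi_size \<alpha> \<le> m.
          (a \<alpha> (fst p) * (complex_of_real (snd p powr l) * transform l (Dw (mi_dirs \<alpha>)) p)) * \<psi> p)"
    proof -
      have "set_integrable lborel W (\<lambda>p. (a \<alpha> (fst p) * (complex_of_real (snd p powr l) * transform l (Dw (mi_dirs \<alpha>)) p)) * \<psi> p)"
        if "mi_size \<alpha> \<le> m" for \<alpha>
        by (intro integ continuous_on_mult ca cpow cD that)
      then show ?thesis
        unfolding set_lebesgue_integral_def scaleR_sum_right set_integrable_def
        by (intro Bochner_Integration.integral_sum[symmetric]) simp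
    qed
    also have "\<dots> = (LINT p:W|lborel. ?AT p * \<psi> p)"
      by (rule set_lebesgue_integral_cong) (auto simp: AT sum_distrib_right)
    finally show ?thesis .
  qed
  have cAT: "continuous_on W ?AT"
  proof -
    have "continuous_on W (\<lambda>p. \<Sum>\<alpha> | mi_size \<alpha> \<le> m. a \<alpha> (fst p) * (complex_of_real (snd p powr l) * transform l (Dw (mi_dirs \<alpha>)) p))"
      by (intro continuous_on_sum continuous_on_mult ca cpow cD) auto
    then show ?thesis by (rule continuous_on_eq) (simp add: AT)
  qed
  have "dist_tt (dist_of \<Omega> u) \<psi>
         - dist_mult (\<lambda>(x, t). complex_of_real (t powr l)) (dist_pdo m a (dist_of \<Omega> u)) \<psi>
      = (LINT p:W|lborel. utt p * \<psi> p - ?AT p * \<psi> p)"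
    unfolding tt pdo by (rule set_integral_diff(2)[symmetric]) (intro integ cJ cAT)+
  also have "\<dots> = (LINT p:W|lborel. f p * \<psi> p)"
  proof (rule set_lebesgue_integral_cong, simp, intro allI impI)
    fix p assume p: "p \<in> W"
    then have "w (fst p) 0 (snd p) = f p"
      using w_init0[of "fst p" "snd p"] interior_subset by auto
    then show "utt p * \<psi> p - ?AT p * \<psi> p = f p * \<psi> p"
      by (simp add: utt_def case_prod_unfold algebra_simps)
  qed
  also have "\<dots> = dist_of \<Omega> f \<psi>"
    unfolding dist_of_def by (rule red[symmetric]) (simp add: z)
  finally show ?thesis .
qed

text \<open>At \<open>t = 0\<close> the derivative is one-sided; the values \<open>u(x, s)\<close> for small \<open>s \<ge> 0\<close> are then given by the
  transform, since \<open>(x, 0)\<close> belongs to \<open>\<Omega>\<close> by assumption and \<open>(x, s)\<close> by the choice of the box.\<close>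
lemma u_time_deriv_Omega:
  assumes p: "(x, t) \<in> \<Omega>"
  shows "((\<lambda>s. u (x, s)) has_vector_derivative ut (x, t)) (at t within {0..})"
proof -
  obtain U T where c: "chart U T" "x \<in> U" "t < T" using chart_exists p by blast
  have t: "t \<in> {0..T}" using Omega_nonneg[OF p] c by simp
  have "at t within {0..T} = at t within {0..}"
    by (rule at_within_nhd[of _ "{..<T}"]) (use c in auto)
  then have d: "((\<lambda>s. transform l w (x, s)) has_vector_derivative ut (x, t)) (at t within {0..})"
    using transform_w_t_deriv[OF c(1,2) t] by simp
  have "eventually (\<lambda>s. s \<in> {0..} \<longrightarrow> u (x, s) = transform l w (x, s)) (nhds t)"
  proof (cases "t = 0")
    case True
    have "eventually (\<lambda>s. s \<in> {..<T}) (nhds t)" by (rule eventually_nhds_in_open) (use c in auto)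
    then show ?thesis
    proof eventually_elim
      case (elim s)
      then show ?case using chart_sub[OF c(1,2), of s] u p True by (cases "s = 0") auto
    qed
  next
    case False
    have "eventually (\<lambda>s. s \<in> {0<..<T}) (nhds t)"
      by (rule eventually_nhds_in_open) (use c t False in auto)
    then show ?thesis by eventually_elim (use chart_sub[OF c(1,2)] u in auto)
  qed
  then have "((\<lambda>s. u (x, s)) has_vector_derivative ut (x, t)) (at t within {0..})
     \<longleftrightarrow> ((\<lambda>s. transform l w (x, s)) has_vector_derivative ut (x, t)) (at t within {0..})"
    using t by (intro has_vector_derivative_cong_ev) (auto elim!: eventually_mono dest: eventually_nhds_x_imp_x)
  with d show ?thesis by simp
qed

theorem solution_properties:
  "(\<forall>p\<in>\<Omega>. transform_converges l w p) \<and>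
    continuous_on \<Omega> u \<and>
    (\<forall>\<psi>\<in>test_functions \<Omega>.
       dist_tt (dist_of \<Omega> u) \<psi>
         - dist_mult (\<lambda>(x, t). complex_of_real (t powr l)) (dist_pdo m a (dist_of \<Omega> u)) \<psi>
       = dist_of \<Omega> f \<psi>) \<and>
    (\<forall>x\<in>fst ` \<Omega>. has_initial_value u \<Omega> x 0) \<and>
    (\<exists>ut. (\<forall>(x, t)\<in>\<Omega>. ((\<lambda>s. u (x, s)) has_vector_derivative ut (x, t)) (at t within {0..})) \<and>
             continuous_on \<Omega> ut \<and>
             (\<forall>x\<in>fst ` \<Omega>. has_initial_value ut \<Omega> x 0))"
proof (intro conjI ballI exI[of _ ut])
  fix p assume p: "p \<in> \<Omega>"
  obtain x t where pe: "p = (x, t)" by (cases p)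
  obtain U T where c: "chart U T" "x \<in> U" "t < T" using chart_exists p pe by blast
  then show "transform_converges l w p"
    using transform_w_converges[OF c(1,2), of t] Omega_nonneg p pe by auto
  show "case p of (x, t) \<Rightarrow> ((\<lambda>s. u (x, s)) has_vector_derivative ut (x, t)) (at t within {0..})"
    using u_time_deriv_Omega p pe by auto
next
  have e: "u p = transform l w p" if "p \<in> \<Omega>" for p using u that by (cases p) auto
  show "continuous_on \<Omega> u" by (rule continuous_on_Omega[OF transform_w_cont e])
  show "continuous_on \<Omega> ut" by (rule continuous_on_Omega[OF ut_cont refl])
  show "has_initial_value u \<Omega> x 0" if "x \<in> fst ` \<Omega>" for x
    by (rule initial_value_zero[OF that transform_w_cont e transform_w_0])
  show "has_initial_value ut \<Omega> x 0" if "x \<in> fst ` \<Omega>" for x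
    by (rule initial_value_zero[OF that ut_cont refl ut_0])
qed (rule distributional_equation)

end

theorem theorem1p5:
  fixes l :: real and m :: nat
    and \<Omega> :: "((real^'n) \<times> real) set"
    and a :: "('n \<Rightarrow> nat) \<Rightarrow> real^'n \<Rightarrow> complex"
    and f :: "(real^'n) \<times> real \<Rightarrow> complex"
    and w :: "real^'n \<Rightarrow> real \<Rightarrow> real \<Rightarrow> complex"
    and u :: "(real^'n) \<times> real \<Rightarrow> complex"
  assumes l: "l > -2"
    and domain: "half_space_domain \<Omega>" "backward_time_connected \<Omega>"
    and coeffs: "\<And>\<alpha>. mi_size \<alpha> \<le> m \<Longrightarrow> Cinf_on (fst ` \<Omega>) (a \<alpha>)"
    and f: "smooth_on \<Omega> f"
    and w_reg: "\<And>x0 t0. (x0, t0) \<in> \<Omega> \<Longrightarrow> t0 > 0 \<Longrightarrow>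
          \<exists>U. open U \<and> x0 \<in> U \<and> Cm20_on m U (phi l t0) t0 w"
    and w_eq: "\<And>x r b. (x, r) \<in> phi_image l \<Omega> \<Longrightarrow> (x, b) \<in> \<Omega> \<Longrightarrow>
          deriv_within {0..} 2 (\<lambda>\<rho>. w x \<rho> b) r - pdo m a (\<lambda>y. w y r b) x = 0"
    and w_init0: "\<And>x b. (x, b) \<in> \<Omega> \<Longrightarrow> w x 0 b = f (x, b)"
    and w_init1: "\<And>x b. (x, b) \<in> \<Omega> \<Longrightarrow> deriv_within {0..} 1 (\<lambda>\<rho>. w x \<rho> b) 0 = 0"
    and u: "\<And>x t. (x, t) \<in> \<Omega> \<Longrightarrow> u (x, t) = transform l w (x, t)"
  shows "(\<forall>p\<in>\<Omega>. transform_converges l w p) \<and>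
    continuous_on \<Omega> u \<and>
    (\<forall>\<psi>\<in>test_functions \<Omega>.
       dist_tt (dist_of \<Omega> u) \<psi>
         - dist_mult (\<lambda>(x, t). complex_of_real (t powr l)) (dist_pdo m a (dist_of \<Omega> u)) \<psi>
       = dist_of \<Omega> f \<psi>) \<and>
    (\<forall>x\<in>fst ` \<Omega>. has_initial_value u \<Omega> x 0) \<and>
    (l < 4 \<longrightarrow>
       (\<exists>ut. (\<forall>(x, t)\<in>\<Omega>. ((\<lambda>s. u (x, s)) has_vector_derivative ut (x, t)) (at t within {0..})) \<and>
             continuous_on \<Omega> ut \<and>
             (\<forall>x\<in>fst ` \<Omega>. has_initial_value ut \<Omega> x 0)))"
proof -
  interpret hyp_problem l m \<Omega> a f w u
    by (rule hyp_problem.intro) (fact assms)+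
  show ?thesis using solution_properties by blast
qed

end
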